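(* Let $(M,L)$ be a Finsler manifold with Finsler metric $g$, let $D^*$ be its Hashiguchi connection with v-curvature $S^*$ and hv-curvature $P^*$, and let $T$ and $S$ be the (h)hv-torsion and the v-curvature of the Cartan connection. Then for all $\pi$-vector fields $X,Y,Z,W$: (a) $S^*(X,Y,Z,W)=-S^*(Y,X,Z,W)$; (b) $S^*(X,Y,Z,W)=-S^*(X,Y,W,Z)$; (c) $S^*(X,Y,Z,W)=S(X,Y,Z,W)=g(T(X,W),T(Y,Z))-g(T(Y,W),T(X,Z))$; (d) $\mathfrak S_{X,Y,Z}\{(D^*_{\gamma X}S)(Y,Z,W)\}=0$; (e) $(D^*_{\gamma\eta}S)(X,Y,Z)=-2S(X,Y)Z$; (f) $(D^*_{\beta Z}S)(X,Y,W)=(D^*_{\gamma X}P^* )(Z,Y,W)-(D^*_{\gamma Y}P^* )(Z,X,W)-P^*(T(Y,Z),X)W+P^*(T(X,Z),Y)W$.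
   Context: $M$ is a real paracompact $C^\infty$ manifold of finite dimension, $\mathcal TM\subset TM$ is the set of nonzero tangent vectors, $\pi:\mathcal TM\to M$ the projection, $\pi^{-1}(TM)\to\mathcal TM$ the pullback of $TM$ by $\pi$; everything is $C^\infty$. Sections of $\pi^{-1}(TM)$ are called $\pi$-vector fields. $\eta$ is the $\pi$-vector field $\eta(u)=(u,u)$. $\rho:T(\mathcal TM)\to\pi^{-1}(TM)$ is $\rho(A)=(u,d\pi(A))$ for $A\in T_u(\mathcal TM)$, and $\gamma:\pi^{-1}(TM)\to T(\mathcal TM)$ is the vertical lift $\gamma(u,v)=\frac{d}{dt}|_{t=0}(u+tv)$; $V=\ker\rho=\operatorname{im}\gamma$. $(M,L)$ is a Finsler manifold: $L:TM\to[0,\infty)$ is smooth and positive on $\mathcal TM$, positively homogeneous of degree 1 on fibres, and the fibrewise Hessian of $E=\frac12L^2$ is positive definite on $\mathcal TM$; this Hessian (in coordinates $g_{ij}=\frac12\partial^2L^2/\partial y^i\partial y^j$) is the Finsler metric $g$ on $\pi^{-1}(TM)$. For a linear connection $D$ on $\pi^{-1}(TM)$, put $K(A)=D_A\eta$ and $H=\ker K$. $D$ is regular if $T(\mathcal TM)=V\oplus H$; then $\beta:=(\rho|_H)^{-1}:\pi^{-1}(TM)\to H$. Torsion: $\mathbf T(A,B)=D_A\rho B-D_B\rho A-\rho[A,B]$; curvature (note the sign): $\mathbf K(A,B)\rho C=-D_AD_B\rho C+D_BD_A\rho C+D_{[A,B]}\rho C$. $Q(X,Y)=\mathbf T(\beta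 X,\beta Y)$, $T(X,Y)=\mathbf T(\gamma X,\beta Y)$; h-, hv-, v-curvatures $R(X,Y)Z=\mathbf K(\beta X,\beta Y)Z$, $P(X,Y)Z=\mathbf K(\beta X,\gamma Y)Z$, $S(X,Y)Z=\mathbf K(\gamma X,\gamma Y)Z$; a hat denotes contraction with $\eta$: $\widehat P(X,Y)=P(X,Y)\eta$, etc. The Cartan connection $\nabla$ is the unique regular connection on $\pi^{-1}(TM)$ with $\nabla g=0$, $Q=0$, and $g(T(X,Y),Z)=g(T(X,Z),Y)$; unadorned $T,S,P,\widehat P,K,\beta$ refer to $\nabla$. The Hashiguchi connection $D^*$ is the unique regular connection on $\pi^{-1}(TM)$ such that $D^*_{\gamma X}g=0$, $g(T^*(X,Y),Z)=g(T^*(X,Z),Y)$, $Q^*=0$, $\widehat{P^*}=0$, and $D^*_{h^*A}L=0$ for all $A$ (where $h^*=\beta^*\circ\rho$); objects with $^*$ are those of $D^*$. Known facts: $\beta^*=\beta$, $K^*=K$, $T^*=T$, and $D^*_AY=\nabla_AY+\widehat P(\rho A,Y)$. Notation: $S(X,Y,Z,W):=g(S(X,Y)Z,W)$, likewise for $S^*$. For $B\in\{S,P^*\}$, $(D^*_AB)(X,Y,Z)=D^*_A(B(X,Y)Z)-B(D^*_AX,Y)Z-B(X,D^*_AY)Z-B(X,Y)D^*_AZ$ (vector-valued). $\mathfrak S_{X,Y,Z}$ is the cyclic sum. *)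

theory Defs
  imports "HOL-Analysis.Analysis" "HOL-Library.Function_Algebras"
begin

text \<open>Function spaces as real vector spaces: tangent vectors are encoded below as families of
  coordinate vectors, and vector fields as functions, so this gives their pointwise operations.\<close>

instantiation "fun" :: (type, real_vector) real_vector
begin

definition scaleR_fun :: "real \<Rightarrow> ('a \<Rightarrow> 'b) \<Rightarrow> 'a \<Rightarrow> 'b"
  where "scaleR_fun r f = (\<lambda>x. r *\<^sub>R f x)"

instance
  by standard (simp_all add: scaleR_fun_def fun_eq_iff algebra_simps)

end


section \<open>Smooth manifolds\<close>

text \<open>\<open>C\<^sup>k\<close> and \<open>C\<^sup>\<infinity>\<close> maps; used for open \<open>S\<close> only.\<close>

primrec Ck_on :: "nat \<Rightarrow> 'a::euclidean_space set \<Rightarrow> ('a \<Rightarrow> 'b::real_normed_vector) \<Rightarrow> bool" where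
  "Ck_on 0 S f \<longleftrightarrow> continuous_on S f"
| "Ck_on (Suc k) S f \<longleftrightarrow>
     (\<exists>f'. (\<forall>x\<in>S. (f has_derivative f' x) (at x)) \<and> (\<forall>v. Ck_on k S (\<lambda>x. f' x v)))"

definition smooth_on :: "'a::euclidean_space set \<Rightarrow> ('a \<Rightarrow> 'b::real_normed_vector) \<Rightarrow> bool"
  where "smooth_on S f \<longleftrightarrow> (\<forall>k. Ck_on k S f)"

text \<open>A chart is a pair of its domain and its coordinate map. A manifold is given by a smooth atlas,
  i.e. a set of charts; the underlying set is the union of the chart domains and the topology is
  the one for which all charts are homeomorphisms onto open sets.\<close>

type_synonym ('p, 'e) chart = "'p set \<times> ('p \<Rightarrow> 'e)"

abbreviation chart_inv :: "('p, 'e) chart \<Rightarrow> 'e \<Rightarrow> 'p"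
  where "chart_inv c \<equiv> inv_into (fst c) (snd c)"

definition manifold_points :: "('p, 'e) chart set \<Rightarrow> 'p set"
  where "manifold_points A = (\<Union>c\<in>A. fst c)"

definition charts_at :: "('p, 'e) chart set \<Rightarrow> 'p \<Rightarrow> ('p, 'e) chart set"
  where "charts_at A p = {c \<in> A. p \<in> fst c}"

definition manifold_topology :: "('p, 'e::euclidean_space) chart set \<Rightarrow> 'p topology"
  where "manifold_topology A =
    topology (\<lambda>W. W \<subseteq> manifold_points A \<and> (\<forall>c\<in>A. open (snd c ` (W \<inter> fst c))))"

definition smooth_atlas :: "('p, 'e::euclidean_space) chart set \<Rightarrow> bool"
  where "smooth_atlas A \<longleftrightarrow>
    (\<forall>c\<in>A. inj_on (snd c) (fst c) \<and> open (snd c ` fst c)) \<and>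
    (\<forall>c\<in>A. \<forall>d\<in>A. open (snd c ` (fst c \<inter> fst d)) \<and>
                   smooth_on (snd c ` (fst c \<inter> fst d)) (snd d \<circ> chart_inv c))"

definition paracompact_space :: "'p topology \<Rightarrow> bool"
  where "paracompact_space T \<longleftrightarrow>
    (\<forall>\<U>. (\<forall>U\<in>\<U>. openin T U) \<and> \<Union>\<U> = topspace T \<longrightarrow>
      (\<exists>\<V>. (\<forall>V\<in>\<V>. openin T V \<and> (\<exists>U\<in>\<U>. V \<subseteq> U)) \<and> \<Union>\<V> = topspace T \<and> locally_finite_in T \<V>))"

definition smooth_manifold :: "('p, 'e::euclidean_space) chart set \<Rightarrow> bool"
  where "smooth_manifold A \<longleftrightarrow> smooth_atlas A \<and>
    Hausdorff_space (manifold_topology A) \<and> paracompact_space (manifold_topology A)"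

definition smooth_fun :: "('p, 'e::euclidean_space) chart set \<Rightarrow> ('p \<Rightarrow> real) \<Rightarrow> bool"
  where "smooth_fun A f \<longleftrightarrow> (\<forall>c\<in>A. smooth_on (snd c ` fst c) (f \<circ> chart_inv c))"

text \<open>A tangent vector at \<open>p\<close> is the family of its coordinate vectors in all charts at \<open>p\<close>, related
  by the derivatives of the transition maps (i.e. an equivalence class of pairs of a chart and a
  coordinate vector); the entries at all other charts are set to \<open>0\<close>. It does not record \<open>p\<close>.\<close>

type_synonym ('p, 'e) tvec = "('p, 'e) chart \<Rightarrow> 'e"

definition tangent_space :: "('p, 'e::euclidean_space) chart set \<Rightarrow> 'p \<Rightarrow> ('p, 'e) tvec set"
  where "tangent_space A p = {v.
    (\<forall>c. c \<notin> charts_at A p \<longrightarrow> v c = 0) \<and>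
    (\<forall>c\<in>charts_at A p. \<forall>d\<in>charts_at A p.
       v d = frechet_derivative (snd d \<circ> chart_inv c) (at (snd c p)) (v c))}"

text \<open>Derivative of \<open>f\<close> at \<open>p\<close> along the tangent vector \<open>v\<close>; independent of the chart chosen.\<close>

definition dir_deriv ::
    "('p, 'e::euclidean_space) chart set \<Rightarrow> 'p \<Rightarrow> ('p, 'e) tvec \<Rightarrow> ('p \<Rightarrow> 'b::real_normed_vector) \<Rightarrow> 'b"
  where "dir_deriv A p v f =
    (let c = (SOME c. c \<in> charts_at A p)
     in frechet_derivative (f \<circ> chart_inv c) (at (snd c p)) (v c))"

definition differential ::
    "('p, 'e::euclidean_space) chart set \<Rightarrow> ('q, 'f::euclidean_space) chart set \<Rightarrow> ('p \<Rightarrow> 'q) \<Rightarrow>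
     'p \<Rightarrow> ('p, 'e) tvec \<Rightarrow> ('q, 'f) tvec"
  where "differential A B F p v =
    (\<lambda>c. if c \<in> charts_at B (F p) then dir_deriv A p v (snd c \<circ> F) else 0)"

definition velocity ::
    "('p, 'e::euclidean_space) chart set \<Rightarrow> (real \<Rightarrow> 'p) \<Rightarrow> real \<Rightarrow> ('p, 'e) tvec"
  where "velocity A f t =
    (\<lambda>c. if c \<in> charts_at A (f t) then vector_derivative (snd c \<circ> f) (at t) else 0)"

text \<open>Smooth vector fields on an open set \<open>W\<close>. Global fields are made \<open>0\<close> off the manifold, so that
  equality of global fields is equality of functions.\<close>

definition vector_field_on ::
    "('p, 'e::euclidean_space) chart set \<Rightarrow> 'p set \<Rightarrow> ('p \<Rightarrow> ('p, 'e) tvec) \<Rightarrow> bool"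
  where "vector_field_on A W X \<longleftrightarrow>
    (\<forall>p\<in>W. X p \<in> tangent_space A p) \<and>
    (\<forall>c\<in>A. smooth_on (snd c ` (W \<inter> fst c)) (\<lambda>z. X (chart_inv c z) c))"

definition vector_fields ::
    "('p, 'e::euclidean_space) chart set \<Rightarrow> ('p \<Rightarrow> ('p, 'e) tvec) set"
  where "vector_fields A =
    {X. vector_field_on A (manifold_points A) X \<and> (\<forall>p. p \<notin> manifold_points A \<longrightarrow> X p = 0)}"

text \<open>In each chart, \<open>[X,Y]\<^sup>i = X(Y\<^sup>i) - Y(X\<^sup>i)\<close>.\<close>

definition lie_bracket ::
    "('p, 'e::euclidean_space) chart set \<Rightarrow> ('p \<Rightarrow> ('p, 'e) tvec) \<Rightarrow> ('p \<Rightarrow> ('p, 'e) tvec) \<Rightarrow>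
     'p \<Rightarrow> ('p, 'e) tvec"
  where "lie_bracket A X Y =
    (\<lambda>p c. if c \<in> charts_at A p
           then dir_deriv A p (X p) (\<lambda>q. Y q c) - dir_deriv A p (Y p) (\<lambda>q. X q c) else 0)"


section \<open>The slit tangent bundle and the pullback bundle\<close>

type_synonym ('p, 'e) tpoint = "'p \<times> ('p, 'e) tvec"
type_synonym ('p, 'e) ttvec = "(('p, 'e) tpoint, 'e \<times> 'e) tvec"

definition tangent_bundle :: "('p, 'e::euclidean_space) chart set \<Rightarrow> ('p, 'e) tpoint set"
  where "tangent_bundle A = {u. fst u \<in> manifold_points A \<and> snd u \<in> tangent_space A (fst u)}"

definition slit_bundle :: "('p, 'e::euclidean_space) chart set \<Rightarrow> ('p, 'e) tpoint set"
  where "slit_bundle A = {u \<in> tangent_bundle A. snd u \<noteq> 0}"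

definition slit_chart ::
    "('p, 'e::euclidean_space) chart set \<Rightarrow> ('p, 'e) chart \<Rightarrow> (('p, 'e) tpoint, 'e \<times> 'e) chart"
  where "slit_chart A c = ({u \<in> slit_bundle A. fst u \<in> fst c}, (\<lambda>u. (snd c (fst u), snd u c)))"

definition slit_atlas ::
    "('p, 'e::euclidean_space) chart set \<Rightarrow> (('p, 'e) tpoint, 'e \<times> 'e) chart set"
  where "slit_atlas A = slit_chart A ` A"

text \<open>Sections of \<open>\<pi>\<^sup>-\<^sup>1(TM)\<close>: the element \<open>(u, v)\<close> of the fibre over \<open>u\<close> is represented by
  \<open>v \<in> T\<^bsub>\<pi>(u)\<^esub>M\<close> alone.\<close>

type_synonym ('p, 'e) pfield = "('p, 'e) tpoint \<Rightarrow> ('p, 'e) tvec"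
type_synonym ('p, 'e) tfield = "('p, 'e) tpoint \<Rightarrow> ('p, 'e) ttvec"

definition pi_field_on ::
    "('p, 'e::euclidean_space) chart set \<Rightarrow> ('p, 'e) tpoint set \<Rightarrow> ('p, 'e) pfield \<Rightarrow> bool"
  where "pi_field_on A W X \<longleftrightarrow>
    (\<forall>u\<in>W. X u \<in> tangent_space A (fst u)) \<and>
    (\<forall>c\<in>A. smooth_on (snd (slit_chart A c) ` (W \<inter> fst (slit_chart A c)))
                     (\<lambda>z. X (chart_inv (slit_chart A c) z) c))"

definition pi_fields :: "('p, 'e::euclidean_space) chart set \<Rightarrow> ('p, 'e) pfield set"
  where "pi_fields A = {X. pi_field_on A (slit_bundle A) X \<and> (\<forall>u. u \<notin> slit_bundle A \<longrightarrow> X u = 0)}"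

definition eta :: "('p, 'e::euclidean_space) chart set \<Rightarrow> ('p, 'e) pfield"
  where "eta A = (\<lambda>u. if u \<in> slit_bundle A then snd u else 0)"

definition rho ::
    "('p, 'e::euclidean_space) chart set \<Rightarrow> ('p, 'e) tpoint \<Rightarrow> ('p, 'e) ttvec \<Rightarrow> ('p, 'e) tvec"
  where "rho A u a = differential (slit_atlas A) A fst u a"

definition gamma ::
    "('p, 'e::euclidean_space) chart set \<Rightarrow> ('p, 'e) tpoint \<Rightarrow> ('p, 'e) tvec \<Rightarrow> ('p, 'e) ttvec"
  where "gamma A u v = velocity (slit_atlas A) (\<lambda>t. (fst u, snd u + t *\<^sub>R v)) 0"

definition rho_field :: "('p, 'e::euclidean_space) chart set \<Rightarrow> ('p, 'e) tfield \<Rightarrow> ('p, 'e) pfield"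
  where "rho_field A a = (\<lambda>u. if u \<in> slit_bundle A then rho A u (a u) else 0)"

definition gamma_field :: "('p, 'e::euclidean_space) chart set \<Rightarrow> ('p, 'e) pfield \<Rightarrow> ('p, 'e) tfield"
  where "gamma_field A X = (\<lambda>u. if u \<in> slit_bundle A then gamma A u (X u) else 0)"


section \<open>Linear connections on the pullback bundle\<close>

text \<open>\<open>D u a Y\<close> is \<open>D\<^sub>aY\<close> for a vector \<open>a\<close> tangent to the slit bundle at \<open>u\<close> and a section \<open>Y\<close>.
  The last condition says that the map \<open>a \<mapsto> D\<^sub>aY\<close> of vector bundles is smooth, i.e. that it
  sends smooth local vector fields to smooth local sections.\<close>

type_synonym ('p, 'e) pconn =
  "('p, 'e) tpoint \<Rightarrow> ('p, 'e) ttvec \<Rightarrow> ('p, 'e) pfield \<Rightarrow> ('p, 'e) tvec"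

definition linear_connection ::
    "('p, 'e::euclidean_space) chart set \<Rightarrow> ('p, 'e) pconn \<Rightarrow> bool"
  where "linear_connection A D \<longleftrightarrow>
    (\<forall>u\<in>slit_bundle A. \<forall>a\<in>tangent_space (slit_atlas A) u. \<forall>Y\<in>pi_fields A.
       D u a Y \<in> tangent_space A (fst u) \<and>
       (\<forall>b\<in>tangent_space (slit_atlas A) u. D u (a + b) Y = D u a Y + D u b Y) \<and>
       (\<forall>r. D u (r *\<^sub>R a) Y = r *\<^sub>R D u a Y) \<and>
       (\<forall>Z\<in>pi_fields A. D u a (Y + Z) = D u a Y + D u a Z) \<and>
       (\<forall>f. smooth_fun (slit_atlas A) f \<longrightarrow>
          D u a (\<lambda>w. f w *\<^sub>R Y w) = dir_deriv (slit_atlas A) u a f *\<^sub>R Y u + f u *\<^sub>R D u a Y)) \<and>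
    (\<forall>W a. \<forall>Y\<in>pi_fields A.
       openin (manifold_topology (slit_atlas A)) W \<and> vector_field_on (slit_atlas A) W a \<longrightarrow>
       pi_field_on A W (\<lambda>u. D u (a u) Y))"

definition cov ::
    "('p, 'e::euclidean_space) chart set \<Rightarrow> ('p, 'e) pconn \<Rightarrow> ('p, 'e) tfield \<Rightarrow>
     ('p, 'e) pfield \<Rightarrow> ('p, 'e) pfield"
  where "cov A D a Y = (\<lambda>u. if u \<in> slit_bundle A then D u (a u) Y else 0)"

definition vertical_space ::
    "('p, 'e::euclidean_space) chart set \<Rightarrow> ('p, 'e) tpoint \<Rightarrow> ('p, 'e) ttvec set"
  where "vertical_space A u = {a \<in> tangent_space (slit_atlas A) u. rho A u a = 0}"

definition conn_map ::
    "('p, 'e::euclidean_space) chart set \<Rightarrow> ('p, 'e) pconn \<Rightarrow> ('p, 'e) tpoint \<Rightarrow>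
     ('p, 'e) ttvec \<Rightarrow> ('p, 'e) tvec"
  where "conn_map A D u a = D u a (eta A)"

definition horizontal_space ::
    "('p, 'e::euclidean_space) chart set \<Rightarrow> ('p, 'e) pconn \<Rightarrow> ('p, 'e) tpoint \<Rightarrow> ('p, 'e) ttvec set"
  where "horizontal_space A D u = {a \<in> tangent_space (slit_atlas A) u. conn_map A D u a = 0}"

definition regular_connection ::
    "('p, 'e::euclidean_space) chart set \<Rightarrow> ('p, 'e) pconn \<Rightarrow> bool"
  where "regular_connection A D \<longleftrightarrow> linear_connection A D \<and>
    (\<forall>u\<in>slit_bundle A.
       vertical_space A u \<inter> horizontal_space A D u = {0} \<and>
       {a + b | a b. a \<in> vertical_space A u \<and> b \<in> horizontal_space A D u}
         = tangent_space (slit_atlas A) u)"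

definition beta ::
    "('p, 'e::euclidean_space) chart set \<Rightarrow> ('p, 'e) pconn \<Rightarrow> ('p, 'e) tpoint \<Rightarrow>
     ('p, 'e) tvec \<Rightarrow> ('p, 'e) ttvec"
  where "beta A D u = inv_into (horizontal_space A D u) (rho A u)"

definition beta_field ::
    "('p, 'e::euclidean_space) chart set \<Rightarrow> ('p, 'e) pconn \<Rightarrow> ('p, 'e) pfield \<Rightarrow> ('p, 'e) tfield"
  where "beta_field A D X = (\<lambda>u. if u \<in> slit_bundle A then beta A D u (X u) else 0)"

definition torsion ::
    "('p, 'e::euclidean_space) chart set \<Rightarrow> ('p, 'e) pconn \<Rightarrow> ('p, 'e) tfield \<Rightarrow>
     ('p, 'e) tfield \<Rightarrow> ('p, 'e) pfield"
  where "torsion A D a b =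
    cov A D a (rho_field A b) - cov A D b (rho_field A a)
      - rho_field A (lie_bracket (slit_atlas A) a b)"

text \<open>Note the sign convention.\<close>

definition curvature ::
    "('p, 'e::euclidean_space) chart set \<Rightarrow> ('p, 'e) pconn \<Rightarrow> ('p, 'e) tfield \<Rightarrow>
     ('p, 'e) tfield \<Rightarrow> ('p, 'e) pfield \<Rightarrow> ('p, 'e) pfield"
  where "curvature A D a b Z =
    - cov A D a (cov A D b Z) + cov A D b (cov A D a Z)
      + cov A D (lie_bracket (slit_atlas A) a b) Z"

definition h_torsion ::
    "('p, 'e::euclidean_space) chart set \<Rightarrow> ('p, 'e) pconn \<Rightarrow> ('p, 'e) pfield \<Rightarrow>
     ('p, 'e) pfield \<Rightarrow> ('p, 'e) pfield"
  where "h_torsion A D X Y = torsion A D (beta_field A D X) (beta_field A D Y)"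

definition hv_torsion ::
    "('p, 'e::euclidean_space) chart set \<Rightarrow> ('p, 'e) pconn \<Rightarrow> ('p, 'e) pfield \<Rightarrow>
     ('p, 'e) pfield \<Rightarrow> ('p, 'e) pfield"
  where "hv_torsion A D X Y = torsion A D (gamma_field A X) (beta_field A D Y)"

definition hv_curvature ::
    "('p, 'e::euclidean_space) chart set \<Rightarrow> ('p, 'e) pconn \<Rightarrow> ('p, 'e) pfield \<Rightarrow>
     ('p, 'e) pfield \<Rightarrow> ('p, 'e) pfield \<Rightarrow> ('p, 'e) pfield"
  where "hv_curvature A D X Y Z = curvature A D (beta_field A D X) (gamma_field A Y) Z"

definition v_curvature ::
    "('p, 'e::euclidean_space) chart set \<Rightarrow> ('p, 'e) pconn \<Rightarrow> ('p, 'e) pfield \<Rightarrow>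
     ('p, 'e) pfield \<Rightarrow> ('p, 'e) pfield \<Rightarrow> ('p, 'e) pfield"
  where "v_curvature A D X Y Z = curvature A D (gamma_field A X) (gamma_field A Y) Z"

definition cov_tensor ::
    "('p, 'e::euclidean_space) chart set \<Rightarrow> ('p, 'e) pconn \<Rightarrow> ('p, 'e) tfield \<Rightarrow>
     (('p, 'e) pfield \<Rightarrow> ('p, 'e) pfield \<Rightarrow> ('p, 'e) pfield \<Rightarrow> ('p, 'e) pfield) \<Rightarrow>
     ('p, 'e) pfield \<Rightarrow> ('p, 'e) pfield \<Rightarrow> ('p, 'e) pfield \<Rightarrow> ('p, 'e) pfield"
  where "cov_tensor A D a B X Y Z =
    cov A D a (B X Y Z) - B (cov A D a X) Y Z - B X (cov A D a Y) Z - B X Y (cov A D a Z)"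


section \<open>Finsler manifolds, Cartan and Hashiguchi connections\<close>

text \<open>The Hessian at \<open>u\<close> of the restriction of \<open>E = L\<^sup>2/2\<close> to the fibre through \<open>u\<close>.\<close>

definition finsler_metric ::
    "(('p, 'e::euclidean_space) tpoint \<Rightarrow> real) \<Rightarrow> ('p, 'e) tpoint \<Rightarrow>
     ('p, 'e) tvec \<Rightarrow> ('p, 'e) tvec \<Rightarrow> real"
  where "finsler_metric L u v w =
    deriv (\<lambda>s. deriv (\<lambda>t. (L (fst u, snd u + s *\<^sub>R v + t *\<^sub>R w))\<^sup>2 / 2) 0) 0"

definition finsler_manifold ::
    "('p, 'e::euclidean_space) chart set \<Rightarrow> (('p, 'e) tpoint \<Rightarrow> real) \<Rightarrow> bool"
  where "finsler_manifold A L \<longleftrightarrow>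
    smooth_manifold A \<and>
    (\<forall>u\<in>tangent_bundle A. 0 \<le> L u) \<and>
    smooth_fun (slit_atlas A) L \<and>
    (\<forall>u\<in>slit_bundle A. 0 < L u) \<and>
    (\<forall>u\<in>tangent_bundle A. \<forall>r>0. L (fst u, r *\<^sub>R snd u) = r * L u) \<and>
    (\<forall>u\<in>slit_bundle A. \<forall>v\<in>tangent_space A (fst u). v \<noteq> 0 \<longrightarrow> 0 < finsler_metric L u v v)"

definition metric_field ::
    "(('p, 'e::euclidean_space) tpoint \<Rightarrow> real) \<Rightarrow> ('p, 'e) pfield \<Rightarrow> ('p, 'e) pfield \<Rightarrow>
     ('p, 'e) tpoint \<Rightarrow> real"
  where "metric_field L X Y = (\<lambda>u. finsler_metric L u (X u) (Y u))"

text \<open>\<open>(D\<^sub>ag)(X, Y)\<close> for a vector field \<open>a\<close> on the slit bundle.\<close>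

definition cov_metric ::
    "('p, 'e::euclidean_space) chart set \<Rightarrow> (('p, 'e) tpoint \<Rightarrow> real) \<Rightarrow> ('p, 'e) pconn \<Rightarrow>
     ('p, 'e) tfield \<Rightarrow> ('p, 'e) pfield \<Rightarrow> ('p, 'e) pfield \<Rightarrow> ('p, 'e) tpoint \<Rightarrow> real"
  where "cov_metric A L D a X Y = (\<lambda>u.
    dir_deriv (slit_atlas A) u (a u) (metric_field L X Y)
      - metric_field L (cov A D a X) Y u - metric_field L X (cov A D a Y) u)"

definition hv_torsion_symmetric ::
    "('p, 'e::euclidean_space) chart set \<Rightarrow> (('p, 'e) tpoint \<Rightarrow> real) \<Rightarrow> ('p, 'e) pconn \<Rightarrow> bool"
  where "hv_torsion_symmetric A L D \<longleftrightarrow>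
    (\<forall>X\<in>pi_fields A. \<forall>Y\<in>pi_fields A. \<forall>Z\<in>pi_fields A. \<forall>u\<in>slit_bundle A.
       metric_field L (hv_torsion A D X Y) Z u = metric_field L (hv_torsion A D X Z) Y u)"

definition cartan_connection ::
    "('p, 'e::euclidean_space) chart set \<Rightarrow> (('p, 'e) tpoint \<Rightarrow> real) \<Rightarrow> ('p, 'e) pconn \<Rightarrow> bool"
  where "cartan_connection A L D \<longleftrightarrow>
    regular_connection A D \<and>
    (\<forall>a\<in>vector_fields (slit_atlas A). \<forall>X\<in>pi_fields A. \<forall>Y\<in>pi_fields A. \<forall>u\<in>slit_bundle A.
       cov_metric A L D a X Y u = 0) \<and>
    (\<forall>X\<in>pi_fields A. \<forall>Y\<in>pi_fields A. h_torsion A D X Y = 0) \<and>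
    hv_torsion_symmetric A L D"

text \<open>The last condition is \<open>D\<^bsub>hA\<^esub>L = 0\<close> with \<open>h = \<beta> \<circ> \<rho>\<close>; on the function \<open>L\<close>, \<open>D\<close> acts as the
  derivative.\<close>

definition hashiguchi_connection ::
    "('p, 'e::euclidean_space) chart set \<Rightarrow> (('p, 'e) tpoint \<Rightarrow> real) \<Rightarrow> ('p, 'e) pconn \<Rightarrow> bool"
  where "hashiguchi_connection A L D \<longleftrightarrow>
    regular_connection A D \<and>
    (\<forall>V\<in>pi_fields A. \<forall>X\<in>pi_fields A. \<forall>Y\<in>pi_fields A. \<forall>u\<in>slit_bundle A.
       cov_metric A L D (gamma_field A V) X Y u = 0) \<and>
    hv_torsion_symmetric A L D \<and>
    (\<forall>X\<in>pi_fields A. \<forall>Y\<in>pi_fields A. h_torsion A D X Y = 0) \<and>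
    (\<forall>X\<in>pi_fields A. \<forall>Y\<in>pi_fields A. hv_curvature A D X Y (eta A) = 0) \<and>
    (\<forall>a\<in>vector_fields (slit_atlas A). \<forall>u\<in>slit_bundle A.
       dir_deriv (slit_atlas A) u (beta A D u (rho A u (a u))) L = 0)"

end

theory Submission
  imports Defs
begin

text \<open>For \<open>\<pi>\<close>-vector fields put \<open>\<nabla>\<^sup>v\<^sub>X Y = \<rho>[\<gamma>X, h]\<close>, where \<open>h\<close> is any vector field with \<open>\<rho> h = Y\<close>. This
  is well defined, and by the Jacobi identity it is flat and satisfies
  \<open>[\<gamma>X, \<gamma>Y] = \<gamma>(\<nabla>\<^sup>v\<^sub>X Y - \<nabla>\<^sup>v\<^sub>Y X)\<close>; the metric is the second \<open>\<nabla>\<^sup>v\<close>-derivative of \<open>E = L\<^sup>2/2\<close>. Both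
  connections are metric in vertical directions with self-adjoint \<open>T\<close>, hence \<open>2 g(T(X, Y), Z) =
  (\<nabla>\<^sup>v\<^sub>X g)(Y, Z)\<close> in both cases: they have the same totally symmetric \<open>T\<close>, the same vertical covariant
  derivative and the same \<open>S\<close>. Flatness of \<open>\<nabla>\<^sup>v\<close> gives \<open>S(X, Y) = [T\<^sub>X, T\<^sub>Y]\<close>, and (d) and (f) are
  instances of the second Bianchi identity, where \<open>[\<gamma>X, \<beta>Z] = \<beta>(\<nabla>\<^sup>v\<^sub>X Z) - \<gamma>(D\<^sup>*\<^bsub>\<beta>Z\<^esub> X)\<close> by the vanishing
  of the contracted hv-curvature; (e) is (d) with \<open>X = \<eta>\<close>. Finally, (f) needs that both connections
  have the same horizontal lift \<open>\<beta>\<close>, which follows by comparing two Koszul formulas.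

  All of this takes place in the modules of global fields and uses no multiplication by functions, so
  that neither local extensions nor bump functions are needed.\<close>

section \<open>Calculus\<close>

text \<open>Global fields suffice for two reasons. Nondegeneracy of g is tested on the difference of
  the two fields to be compared, which is itself global. And the global lift of a \<pi>-vector field
  is its horizontal lift \<beta> for a regular connection. The price is the smoothness of \<beta>,
  which is obtained in each chart by solving a linear system with smooth coefficients. Coordinates
  otherwise serve only to verify the axioms of the abstract calculus. However, E is constant along
  horizontal fields, and this makes the connection metric whenever one argument of g is \<eta> or
  the direction is \<beta>\<eta>. Koszul's formula for the horizontal derivative of \<eta> contains
  only derivatives of these two kinds.\<close>

definition dd :: "('a::real_normed_vector \<Rightarrow> 'b::real_normed_vector) \<Rightarrow> 'a \<Rightarrow> 'a \<Rightarrow> 'b"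
  where "dd f z v = frechet_derivative f (at z) v"

lemma dd_eqI: "(f has_derivative f') (at z) \<Longrightarrow> dd f z v = f' v"
  unfolding dd_def using frechet_derivative_at by metis

lemma dd_works: "f differentiable (at z) \<Longrightarrow> (f has_derivative dd f z) (at z)"
  unfolding dd_def using frechet_derivative_works by blast

lemma dd_linear: "f differentiable (at z) \<Longrightarrow> linear (dd f z)"
  using dd_works has_derivative_linear by blast

text \<open>Both sides are the same Hilbert choice from the same predicate, so points of
  non-differentiability are covered as well.\<close>

lemma dd_cong:
  assumes "open S" "z \<in> S" "\<And>x. x \<in> S \<Longrightarrow> f x = h x"
  shows "dd f z v = dd h z v"
proof -
  have "(f has_derivative D) (at z) \<longleftrightarrow> (h has_derivative D) (at z)" for D
    using assms has_derivative_transform_within_open by (metis (full_types))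
  then show ?thesis by (simp add: dd_def frechet_derivative_def)
qed

lemma differentiable_cong_open:
  assumes "open S" "z \<in> S" "\<And>x. x \<in> S \<Longrightarrow> f x = h x"
  shows "f differentiable (at z) \<longleftrightarrow> h differentiable (at z)"
  using assms has_derivative_transform_within_open unfolding differentiable_def by (metis (full_types))

lemma Ck_on_cong:
  assumes "open S" "\<And>x. x \<in> S \<Longrightarrow> f x = h x" "Ck_on k S f"
  shows "Ck_on k S h"
  using assms(2,3)
proof (induction k arbitrary: f h)
  case 0
  then show ?case by (simp cong: continuous_on_cong)
next
  case (Suc k)
  then obtain f' where f': "\<forall>x\<in>S. (f has_derivative f' x) (at x)" "\<forall>v. Ck_on k S (\<lambda>x. f' x v)"
    by auto
  have "\<forall>x\<in>S. (h has_derivative f' x) (at x)"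
    using f'(1) has_derivative_transform_within_open[OF _ assms(1)] Suc.prems(1) by blast
  with f'(2) show ?case by auto
qed

lemma Ck_on_mono: "Ck_on (Suc k) S f \<Longrightarrow> Ck_on k S f"
proof (induction k arbitrary: f)
  case 0
  then show ?case
    unfolding Ck_on.simps by (meson continuous_at_imp_continuous_on has_derivative_continuous)
next
  case (Suc k)
  then obtain f' where "\<forall>x\<in>S. (f has_derivative f' x) (at x)" "\<forall>v. Ck_on (Suc k) S (\<lambda>x. f' x v)"
    by auto
  with Suc.IH show ?case by auto
qed

lemma Ck_on_subset: "Ck_on k S f \<Longrightarrow> T \<subseteq> S \<Longrightarrow> Ck_on k T f"
proof (induction k arbitrary: f)
  case 0
  then show ?case by (auto intro: continuous_on_subset)
next
  case (Suc k)
  then obtain f' where "\<forall>x\<in>S. (f has_derivative f' x) (at x)" "\<forall>v. Ck_on k S (\<lambda>x. f' x v)"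
    by auto
  with Suc.IH Suc.prems(2) show ?case by (auto intro!: exI[of _ f'])
qed

text \<open>Derivatives are unique, so the existential derivative in \<open>Ck_on\<close> may be
  replaced by \<open>dd\<close>; this turns the recursion into one on the explicit maps
  \<open>\<lambda>x. dd f x v\<close>.\<close>

lemma Ck_on_Suc_dd:
  assumes "open S"
  shows "Ck_on (Suc k) S f \<longleftrightarrow> (\<forall>x\<in>S. f differentiable (at x)) \<and> (\<forall>v. Ck_on k S (\<lambda>x. dd f x v))"
    (is "?L \<longleftrightarrow> ?R")
proof
  assume ?L
  then obtain f' where f': "\<forall>x\<in>S. (f has_derivative f' x) (at x)" "\<forall>v. Ck_on k S (\<lambda>x. f' x v)"
    by auto
  have "Ck_on k S (\<lambda>x. dd f x v)" for v
    by (rule Ck_on_cong[OF assms _ f'(2)[rule_format, of v]]) (use f'(1) dd_eqI in \<open>metis\<close>)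
  with f'(1) show ?R by (auto simp: differentiable_def)
next
  assume ?R
  then show ?L by (auto intro!: exI[of _ "dd f"] dd_works)
qed

lemma smooth_on_iff_dd:
  assumes "open S"
  shows "smooth_on S f \<longleftrightarrow> (\<forall>x\<in>S. f differentiable (at x)) \<and> (\<forall>v. smooth_on S (\<lambda>x. dd f x v))"
  unfolding smooth_on_def using Ck_on_Suc_dd[OF assms] Ck_on_mono by blast

lemma smooth_on_differentiable: "open S \<Longrightarrow> smooth_on S f \<Longrightarrow> x \<in> S \<Longrightarrow> f differentiable (at x)"
  using smooth_on_iff_dd by blast

lemma smooth_on_dd: "open S \<Longrightarrow> smooth_on S f \<Longrightarrow> smooth_on S (\<lambda>x. dd f x v)"
  using smooth_on_iff_dd by blast

lemma smooth_on_cong: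
  "open S \<Longrightarrow> (\<And>x. x \<in> S \<Longrightarrow> f x = h x) \<Longrightarrow> smooth_on S f \<Longrightarrow> smooth_on S h"
  unfolding smooth_on_def using Ck_on_cong by blast

lemma smooth_on_subset: "smooth_on S f \<Longrightarrow> T \<subseteq> S \<Longrightarrow> smooth_on T f"
  unfolding smooth_on_def using Ck_on_subset by blast

lemma Ck_on_const [simp]: "Ck_on k S (\<lambda>x. c)"
proof (induction k arbitrary: c)
  case (Suc k)
  then show ?case by (auto intro!: exI[of _ "\<lambda>x v. 0"])
qed auto

lemma smooth_on_const [simp, intro]: "smooth_on S (\<lambda>x. c)"
  by (simp add: smooth_on_def)

lemma smooth_on_bounded_linear:
  assumes "bounded_linear h" and "smooth_on S f"
  shows "smooth_on S (\<lambda>x. h (f x))"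
proof -
  have "Ck_on k S (\<lambda>x. h (f x))" if "Ck_on k S f" for k
    using that
  proof (induction k arbitrary: f)
    case 0
    then show ?case using assms(1) by (simp add: bounded_linear.continuous_on)
  next
    case (Suc k)
    then obtain f' where "\<forall>x\<in>S. (f has_derivative f' x) (at x)" "\<forall>v. Ck_on k S (\<lambda>x. f' x v)"
      by auto
    then show ?case
      using Suc.IH
      by (auto intro!: exI[of _ "\<lambda>x v. h (f' x v)"] bounded_linear.has_derivative[OF assms(1)])
  qed
  then show ?thesis using assms unfolding smooth_on_def by blast
qed

lemma smooth_on_id [simp, intro]: "smooth_on S (\<lambda>x::'a::euclidean_space. x)"
proof -
  have "Ck_on k S (\<lambda>x. x)" for k
    by (cases k) (auto intro!: exI[of _ "\<lambda>x v. v"])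
  then show ?thesis by (simp add: smooth_on_def)
qed

lemma Ck_on_add:
  assumes "Ck_on k S f" "Ck_on k S h"
  shows "Ck_on k S (\<lambda>x. f x + h x)"
  using assms
proof (induction k arbitrary: f h)
  case 0
  then show ?case by (simp add: continuous_on_add)
next
  case (Suc k)
  then obtain f' h' where "\<forall>x\<in>S. (f has_derivative f' x) (at x)" "\<forall>v. Ck_on k S (\<lambda>x. f' x v)"
    "\<forall>x\<in>S. (h has_derivative h' x) (at x)" "\<forall>v. Ck_on k S (\<lambda>x. h' x v)"
    by auto
  then show ?case
    using Suc.IH by (auto intro!: exI[of _ "\<lambda>x v. f' x v + h' x v"] has_derivative_add)
qed

lemma smooth_on_add: "smooth_on S f \<Longrightarrow> smooth_on S h \<Longrightarrow> smooth_on S (\<lambda>x. f x + h x)"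
  by (simp add: smooth_on_def Ck_on_add)

lemma smooth_on_minus: "smooth_on S f \<Longrightarrow> smooth_on S (\<lambda>x. - f x)"
  by (rule smooth_on_bounded_linear[OF bounded_linear_minus[OF bounded_linear_ident]])

lemma smooth_on_diff: "smooth_on S f \<Longrightarrow> smooth_on S h \<Longrightarrow> smooth_on S (\<lambda>x. f x - h x)"
  using smooth_on_add[of S f "\<lambda>x. - h x"] smooth_on_minus[of S h] by simp

lemma Ck_on_sum: "finite I \<Longrightarrow> (\<And>i. i \<in> I \<Longrightarrow> Ck_on k S (f i)) \<Longrightarrow> Ck_on k S (\<lambda>x. \<Sum>i\<in>I. f i x)"
  by (induction I rule: finite_induct) (auto intro: Ck_on_add)

lemma smooth_on_sum:
  "(\<And>i. i \<in> I \<Longrightarrow> smooth_on S (f i)) \<Longrightarrow> smooth_on S (\<lambda>x. \<Sum>i\<in>I. f i x)"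
  by (cases "finite I") (auto simp: smooth_on_def intro: Ck_on_sum)

lemma Ck_on_bilinear:
  assumes "bounded_bilinear p" "Ck_on k S f" "Ck_on k S h"
  shows "Ck_on k S (\<lambda>x. p (f x) (h x))"
  using assms(2,3)
proof (induction k arbitrary: f h)
  case 0
  then show ?case using assms(1) by (simp add: bounded_bilinear.continuous_on)
next
  case (Suc k)
  then obtain f' h' where "\<forall>x\<in>S. (f has_derivative f' x) (at x)" "\<forall>v. Ck_on k S (\<lambda>x. f' x v)"
    "\<forall>x\<in>S. (h has_derivative h' x) (at x)" "\<forall>v. Ck_on k S (\<lambda>x. h' x v)"
    by auto
  moreover have "Ck_on k S f" "Ck_on k S h"
    using Suc.prems Ck_on_mono by blast+
  ultimately show ?case
    using Suc.IH
    by (auto intro!: exI[of _ "\<lambda>x v. p (f x) (h' x v) + p (f' x v) (h x)"] Ck_on_add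
        bounded_bilinear.FDERIV[OF assms(1)])
qed

lemma smooth_on_scaleR: "smooth_on S f \<Longrightarrow> smooth_on S h \<Longrightarrow> smooth_on S (\<lambda>x. f x *\<^sub>R h x)"
  by (simp add: smooth_on_def Ck_on_bilinear[OF bounded_bilinear_scaleR])

lemma smooth_on_inner_left: "smooth_on S f \<Longrightarrow> smooth_on S (\<lambda>x. f x \<bullet> v)"
  by (rule smooth_on_bounded_linear[OF bounded_linear_inner_left])

lemma smooth_on_fst: "smooth_on S f \<Longrightarrow> smooth_on S (\<lambda>x. fst (f x))"
  by (rule smooth_on_bounded_linear[OF bounded_linear_fst])

lemma smooth_on_snd: "smooth_on S f \<Longrightarrow> smooth_on S (\<lambda>x. snd (f x))"
  by (rule smooth_on_bounded_linear[OF bounded_linear_snd])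

lemma smooth_on_Pair: 
  assumes "smooth_on S f" "smooth_on S h" shows "smooth_on S (\<lambda>x. (f x, h x))"
proof -
  have 1: "bounded_linear (\<lambda>x. (x, 0))" "bounded_linear (\<lambda>x. (0, x))"
    by (intro bounded_linear_Pair bounded_linear_ident bounded_linear_zero)+
  have "smooth_on S (\<lambda>x. (f x, 0) + (0, h x))"
    by (intro smooth_on_add smooth_on_bounded_linear[OF 1(1)] smooth_on_bounded_linear[OF 1(2)] assms)
  then show ?thesis by simp
qed

lemma linear_euclidean_expansion:
  fixes l :: "'a::euclidean_space \<Rightarrow> 'b::real_vector"
  assumes "linear l"
  shows "l v = (\<Sum>i\<in>Basis. (v \<bullet> i) *\<^sub>R l i)"
proof -
  have "l v = l (\<Sum>i\<in>Basis. (v \<bullet> i) *\<^sub>R i)" by (simp add: euclidean_representation)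
  also have "\<dots> = (\<Sum>i\<in>Basis. (v \<bullet> i) *\<^sub>R l i)"
    using assms by (simp add: linear_sum linear_cmul)
  finally show ?thesis .
qed

lemma Ck_on_compose:
  assumes "open S" "open T" "f ` S \<subseteq> T" "Ck_on k S f" "Ck_on k T h"
  shows "Ck_on k S (\<lambda>x. h (f x))"
  using assms(4,5)
proof (induction k arbitrary: h)
  case 0
  then show ?case using assms(3) by (metis Ck_on.simps(1) continuous_on_compose2)
next
  case (Suc k)
  have f: "f differentiable (at x)" if "x \<in> S" for x
    using Suc.prems(1) that Ck_on_Suc_dd[OF assms(1)] by blast
  have h: "h differentiable (at x)" if "x \<in> T" for x
    using Suc.prems(2) that Ck_on_Suc_dd[OF assms(2)] by blast
  have fk: "Ck_on k S f" using Suc.prems(1) Ck_on_mono by blast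
  \<comment> \<open>In the chain rule the direction \<open>dd f x v\<close> moves with x, whereas
    \<open>Ck_on\<close> controls derivatives in fixed directions only. Expanding in the basis gives
    products of maps that are controlled.\<close>
  have d: "((\<lambda>x. h (f x)) has_derivative (\<lambda>v. \<Sum>i\<in>Basis. (dd f x v \<bullet> i) *\<^sub>R dd h (f x) i)) (at x)"
    if x: "x \<in> S" for x
  proof -
    have fx: "f x \<in> T" using x assms(3) by blast
    have "((\<lambda>x. h (f x)) has_derivative (\<lambda>v. dd h (f x) (dd f x v))) (at x)"
      by (rule has_derivative_compose[OF dd_works[OF f[OF x]] dd_works[OF h[OF fx]]])
    moreover have "dd h (f x) (dd f x v) = (\<Sum>i\<in>Basis. (dd f x v \<bullet> i) *\<^sub>R dd h (f x) i)" for v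
      by (rule linear_euclidean_expansion[OF dd_linear[OF h[OF fx]]])
    ultimately show ?thesis by simp
  qed
  have "Ck_on k S (\<lambda>x. \<Sum>i\<in>Basis. (dd f x v \<bullet> i) *\<^sub>R dd h (f x) i)" for v
  proof (intro Ck_on_sum finite_Basis Ck_on_bilinear[OF bounded_bilinear_scaleR])
    fix i :: 'b
    have "Ck_on k S (\<lambda>x. dd f x v)"
      using Suc.prems(1) Ck_on_Suc_dd[OF assms(1)] by blast
    then show "Ck_on k S (\<lambda>x. dd f x v \<bullet> i)"
      by (intro Ck_on_bilinear[OF bounded_bilinear_inner]) auto
    show "Ck_on k S (\<lambda>x. dd h (f x) i)"
      by (rule Suc.IH[OF fk]) (use Suc.prems(2) Ck_on_Suc_dd[OF assms(2)] in blast)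
  qed
  with d show ?case
    unfolding Ck_on.simps
    by (intro exI[of _ "\<lambda>x v. \<Sum>i\<in>Basis. (dd f x v \<bullet> i) *\<^sub>R dd h (f x) i"]) blast
qed

lemma smooth_on_compose:
  assumes "open S" "open T" "f ` S \<subseteq> T" "smooth_on S f" "smooth_on T h"
  shows "smooth_on S (\<lambda>x. h (f x))"
  using assms Ck_on_compose unfolding smooth_on_def by blast

lemma smooth_on_dd_field:
  assumes "open S" "smooth_on S f" "smooth_on S v"
  shows "smooth_on S (\<lambda>x. dd f x (v x))"
proof (rule smooth_on_cong[OF assms(1)])
  show "(\<Sum>i\<in>Basis. (v x \<bullet> i) *\<^sub>R dd f x i) = dd f x (v x)" if "x \<in> S" for x
    using smooth_on_differentiable[OF assms(1,2) that] dd_linear linear_euclidean_expansion by metis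
  show "smooth_on S (\<lambda>x. \<Sum>i\<in>Basis. (v x \<bullet> i) *\<^sub>R dd f x i)"
    by (intro smooth_on_sum smooth_on_scaleR smooth_on_inner_left smooth_on_dd assms)
qed

text \<open>Product rule for a derivative along a moving direction. The last summand is the one that
  produces Lie brackets, and later the correction term in the Hessian.\<close>

lemma dd_dd_field:
  assumes "open S" "smooth_on S f" "smooth_on S v" "z \<in> S"
  shows "dd (\<lambda>x. dd f x (v x)) z w = dd (\<lambda>x. dd f x (v z)) z w + dd f z (dd v z w)"
proof -
  have lin: "linear (dd f x)" if "x \<in> S" for x
    using smooth_on_differentiable[OF assms(1,2) that] by (rule dd_linear)
  have df: "(\<lambda>x. dd f x i) differentiable (at z)" for i
    using smooth_on_differentiable[OF assms(1) smooth_on_dd[OF assms(1,2)] assms(4)] .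
  have dv: "v differentiable (at z)"
    using smooth_on_differentiable[OF assms(1,3,4)] .
  have "((\<lambda>x. \<Sum>i\<in>Basis. (v x \<bullet> i) *\<^sub>R dd f x i) has_derivative
      (\<lambda>w. \<Sum>i\<in>Basis. (v z \<bullet> i) *\<^sub>R dd (\<lambda>x. dd f x i) z w + (dd v z w \<bullet> i) *\<^sub>R dd f z i)) (at z)"
    by (intro has_derivative_sum has_derivative_scaleR has_derivative_inner_left dd_works df dv)
  then have "((\<lambda>x. dd f x (v x)) has_derivative
      (\<lambda>w. \<Sum>i\<in>Basis. (v z \<bullet> i) *\<^sub>R dd (\<lambda>x. dd f x i) z w + (dd v z w \<bullet> i) *\<^sub>R dd f z i)) (at z)"
    by (rule has_derivative_transform_within_open[OF _ assms(1,4)])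
      (use lin linear_euclidean_expansion in metis)
  then have 1: "dd (\<lambda>x. dd f x (v x)) z w =
      (\<Sum>i\<in>Basis. (v z \<bullet> i) *\<^sub>R dd (\<lambda>x. dd f x i) z w + (dd v z w \<bullet> i) *\<^sub>R dd f z i)"
    by (rule dd_eqI)
  have "((\<lambda>x. \<Sum>i\<in>Basis. (v z \<bullet> i) *\<^sub>R dd f x i) has_derivative
      (\<lambda>w. \<Sum>i\<in>Basis. (v z \<bullet> i) *\<^sub>R dd (\<lambda>x. dd f x i) z w)) (at z)"
    by (intro has_derivative_sum has_derivative_scaleR_right dd_works df)
  then have "((\<lambda>x. dd f x (v z)) has_derivative
      (\<lambda>w. \<Sum>i\<in>Basis. (v z \<bullet> i) *\<^sub>R dd (\<lambda>x. dd f x i) z w)) (at z)"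
    by (rule has_derivative_transform_within_open[OF _ assms(1,4)])
      (use lin linear_euclidean_expansion in metis)
  then have 2: "dd (\<lambda>x. dd f x (v z)) z w = (\<Sum>i\<in>Basis. (v z \<bullet> i) *\<^sub>R dd (\<lambda>x. dd f x i) z w)"
    by (rule dd_eqI)
  show ?thesis
    unfolding 1 2 linear_euclidean_expansion[OF lin[OF assms(4)], of "dd v z w"]
    by (simp add: sum.distrib)
qed

lemma dd_compose:
  assumes "f differentiable (at z)" "h differentiable (at (f z))"
  shows "dd (\<lambda>x. h (f x)) z v = dd h (f z) (dd f z v)"
  by (rule dd_eqI[OF has_derivative_compose[OF dd_works[OF assms(1)] dd_works[OF assms(2)]]])

lemma dd_bounded_linear:
  assumes "bounded_linear h" "f differentiable (at z)"
  shows "dd (\<lambda>x. h (f x)) z v = h (dd f z v)"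
  by (rule dd_eqI[OF bounded_linear.has_derivative[OF assms(1) dd_works[OF assms(2)]]])

lemma has_vector_derivative_line:
  assumes "f differentiable (at (p + s *\<^sub>R v))"
  shows "((\<lambda>s. f (p + s *\<^sub>R v)) has_vector_derivative dd f (p + s *\<^sub>R v) v) (at s)"
proof -
  have 1: "((\<lambda>s. p + s *\<^sub>R v) has_derivative (\<lambda>t. t *\<^sub>R v)) (at s)"
    by (auto intro!: derivative_eq_intros)
  have "((\<lambda>s. f (p + s *\<^sub>R v)) has_derivative (\<lambda>t. dd f (p + s *\<^sub>R v) (t *\<^sub>R v))) (at s)"
    by (rule has_derivative_compose[OF 1 dd_works[OF assms]])
  then show ?thesis
    using dd_linear[OF assms] by (simp add: has_vector_derivative_def linear_cmul)
qed

section \<open>Symmetry of second derivatives\<close>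

lemma second_difference_mvt:
  fixes f :: "'a::euclidean_space \<Rightarrow> real"
  assumes f: "smooth_on (ball z r) f" and h: "0 < h" "h * (norm v + norm w) < r"
  obtains p where "p \<in> ball z r"
    "f (z + h *\<^sub>R v + h *\<^sub>R w) - f (z + h *\<^sub>R v) - f (z + h *\<^sub>R w) + f z
      = h * h * dd (\<lambda>x. dd f x v) p w"
proof -
  have inball: "z + s *\<^sub>R v + t *\<^sub>R w \<in> ball z r" if "0 \<le> s" "s \<le> h" "0 \<le> t" "t \<le> h" for s t
  proof -
    have "norm (s *\<^sub>R v + t *\<^sub>R w) \<le> s * norm v + t * norm w"
      using that by (metis abs_of_nonneg norm_scaleR norm_triangle_ineq)
    also have "\<dots> \<le> h * norm v + h * norm w"
      using that by (intro add_mono mult_right_mono) auto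
    also have "\<dots> < r" using h by (simp add: distrib_left)
    finally have "norm (- (s *\<^sub>R v + t *\<^sub>R w)) < r" by (simp only: norm_minus_cancel)
    then show ?thesis by (simp add: dist_norm)
  qed
  have diff: "f differentiable (at x)" "(\<lambda>x. dd f x v) differentiable (at x)" if "x \<in> ball z r" for x
    using smooth_on_differentiable[OF open_ball f that]
      smooth_on_differentiable[OF open_ball smooth_on_dd[OF open_ball f] that] by auto
  \<comment> \<open>The increment of f over the step h w, as a function of the displacement along v.
    The mean value theorem is applied to it, and then once more in the direction w.\<close>
  define \<phi> where "\<phi> s = f ((z + h *\<^sub>R w) + s *\<^sub>R v) - f (z + s *\<^sub>R v)" for s
  have "(\<phi> has_real_derivative dd f ((z + h *\<^sub>R w) + s *\<^sub>R v) v - dd f (z + s *\<^sub>R v) v) (at s)"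
    if "0 \<le> s" "s \<le> h" for s
    unfolding \<phi>_def has_real_derivative_iff_has_vector_derivative
    using inball[of s h] inball[of s 0] that h
    by (intro has_vector_derivative_diff has_vector_derivative_line diff) (auto simp: algebra_simps)
  then obtain s where s: "0 < s" "s < h"
    "\<phi> h - \<phi> 0 = (h - 0) * (dd f ((z + h *\<^sub>R w) + s *\<^sub>R v) v - dd f (z + s *\<^sub>R v) v)"
    using MVT2[OF h(1), of \<phi> "\<lambda>s. dd f ((z + h *\<^sub>R w) + s *\<^sub>R v) v - dd f (z + s *\<^sub>R v) v"] by blast
  have "((\<lambda>t. dd f ((z + s *\<^sub>R v) + t *\<^sub>R w) v) has_real_derivative
      dd (\<lambda>x. dd f x v) ((z + s *\<^sub>R v) + t *\<^sub>R w) w) (at t)" if "0 \<le> t" "t \<le> h" for t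
    unfolding has_real_derivative_iff_has_vector_derivative
    by (rule has_vector_derivative_line, rule diff(2), rule inball) (use that s in auto)
  then obtain t where t: "0 < t" "t < h"
    "dd f ((z + s *\<^sub>R v) + h *\<^sub>R w) v - dd f ((z + s *\<^sub>R v) + 0 *\<^sub>R w) v
      = (h - 0) * dd (\<lambda>x. dd f x v) ((z + s *\<^sub>R v) + t *\<^sub>R w) w"
    using MVT2[OF h(1), of "\<lambda>t. dd f ((z + s *\<^sub>R v) + t *\<^sub>R w) v"
        "\<lambda>t. dd (\<lambda>x. dd f x v) ((z + s *\<^sub>R v) + t *\<^sub>R w) w"] by blast
  show ?thesis
  proof (rule that)
    show "(z + s *\<^sub>R v) + t *\<^sub>R w \<in> ball z r" using s t inball by auto
    have "\<phi> h - \<phi> 0 = h * (h * dd (\<lambda>x. dd f x v) ((z + s *\<^sub>R v) + t *\<^sub>R w) w)"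
      using s(3) t(3) by (simp add: add_ac)
    then show "f (z + h *\<^sub>R v + h *\<^sub>R w) - f (z + h *\<^sub>R v) - f (z + h *\<^sub>R w) + f z
      = h * h * dd (\<lambda>x. dd f x v) ((z + s *\<^sub>R v) + t *\<^sub>R w) w"
      by (simp add: \<phi>_def add_ac)
  qed
qed

text \<open>The second difference is symmetric in v and w and equals h * h times either mixed
  derivative at some nearby point. If the two differed at z, continuity would keep them apart on a
  small ball.\<close>

lemma dd_dd_commute_real:
  fixes f :: "'a::euclidean_space \<Rightarrow> real"
  assumes S: "open S" "z \<in> S" and f: "smooth_on S f"
  shows "dd (\<lambda>x. dd f x v) z w = dd (\<lambda>x. dd f x w) z v"
proof (rule ccontr)
  define A where "A x = dd (\<lambda>x. dd f x v) x w" for x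
  define B where "B x = dd (\<lambda>x. dd f x w) x v" for x
  assume "\<not> ?thesis"
  then have d: "0 < dist (A z) (B z) / 2" by (simp add: A_def B_def)
  have cA: "isCont A z" and cB: "isCont B z"
    unfolding A_def B_def using S f
    by (auto intro!: differentiable_imp_continuous_within smooth_on_differentiable smooth_on_dd)
  obtain r1 where r1: "r1 > 0" "\<And>x. dist x z < r1 \<Longrightarrow> dist (A x) (A z) < dist (A z) (B z) / 2"
    using cA[unfolded continuous_at_eps_delta, rule_format, OF d] by blast
  obtain r2 where r2: "r2 > 0" "\<And>x. dist x z < r2 \<Longrightarrow> dist (B x) (B z) < dist (A z) (B z) / 2"
    using cB[unfolded continuous_at_eps_delta, rule_format, OF d] by blast
  note r = r1 r2
  obtain r0 where r0: "r0 > 0" "ball z r0 \<subseteq> S" using S open_contains_ball by blast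
  define R where "R = min r0 (min r1 r2)"
  \<comment> \<open>Makes both steps together at most half of R; the summand 1 covers v = w =
    0.\<close>
  define h where "h = R / (2 * (norm v + norm w + 1))"
  have R: "R > 0" using r r0 by (simp add: R_def)
  have n: "0 < norm v + norm w + 1" by (simp add: add_nonneg_pos)
  have h: "0 < h" unfolding h_def using R n by simp
  have "h * (norm v + norm w) \<le> h * (norm v + norm w + 1)" using h by simp
  also have "\<dots> = R / 2" using n by (simp add: h_def field_simps)
  finally have hR: "h * (norm v + norm w) < R" using R by simp
  have sm: "smooth_on (ball z R) f" using f r0 by (rule_tac smooth_on_subset) (auto simp: R_def)
  obtain p where p: "p \<in> ball z R"
    "f (z + h *\<^sub>R v + h *\<^sub>R w) - f (z + h *\<^sub>R v) - f (z + h *\<^sub>R w) + f z = h * h * A p"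
    using second_difference_mvt[OF sm h hR] unfolding A_def by blast
  obtain q where q: "q \<in> ball z R"
    "f (z + h *\<^sub>R w + h *\<^sub>R v) - f (z + h *\<^sub>R w) - f (z + h *\<^sub>R v) + f z = h * h * B q"
    using second_difference_mvt[OF sm h, of w v] hR unfolding B_def by (auto simp: add.commute)
  have "h * h * A p = h * h * B q"
    unfolding p(2)[symmetric] q(2)[symmetric] by (simp add: algebra_simps)
  then have "A p = B q" using h by simp
  moreover have "dist (A p) (A z) < dist (A z) (B z) / 2" "dist (B q) (B z) < dist (A z) (B z) / 2"
    using r p(1) q(1) by (auto simp: R_def dist_commute)
  ultimately show False
    using dist_triangle2[of "A z" "B z" "A p"] by (simp add: dist_commute)
qed

lemma dd_dd_commute:
  fixes f :: "'a::euclidean_space \<Rightarrow> 'b::euclidean_space"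
  assumes S: "open S" "z \<in> S" and f: "smooth_on S f"
  shows "dd (\<lambda>x. dd f x v) z w = dd (\<lambda>x. dd f x w) z v"
proof (rule euclidean_eqI)
  fix i :: 'b
  have 1: "dd (\<lambda>x. f x \<bullet> i) x u = dd f x u \<bullet> i" if "x \<in> S" for x u
    using smooth_on_differentiable[OF S(1) f that] by (rule dd_bounded_linear[OF bounded_linear_inner_left])
  have 2: "dd (\<lambda>x. dd f x v) z w \<bullet> i = dd (\<lambda>x. dd (\<lambda>x. f x \<bullet> i) x v) z w" for v w
  proof -
    have "dd (\<lambda>x. dd f x v) z w \<bullet> i = dd (\<lambda>x. dd f x v \<bullet> i) z w"
      using smooth_on_differentiable[OF S(1) smooth_on_dd[OF S(1) f] S(2)]
      by (intro dd_bounded_linear[OF bounded_linear_inner_left, symmetric])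
    also have "\<dots> = dd (\<lambda>x. dd (\<lambda>x. f x \<bullet> i) x v) z w"
      by (rule dd_cong[OF S]) (simp add: 1)
    finally show ?thesis .
  qed
  show "dd (\<lambda>x. dd f x v) z w \<bullet> i = dd (\<lambda>x. dd f x w) z v \<bullet> i"
    unfolding 2 by (rule dd_dd_commute_real[OF S smooth_on_inner_left[OF f]])
qed

text \<open>The second derivatives of f cancel by symmetry and only the two correction terms of
  \<open>dd_dd_field\<close> remain. This is the coordinate form of both [X, Y] f = X (Y f) - Y (X
  f) and the Jacobi identity.\<close>

lemma dd_commutator:
  fixes f :: "'a::euclidean_space \<Rightarrow> 'b::euclidean_space"
  assumes "open S" "z \<in> S" "smooth_on S f" "smooth_on S X" "smooth_on S Y"
  shows "dd (\<lambda>x. dd f x (Y x)) z (X z) - dd (\<lambda>x. dd f x (X x)) z (Y z)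
    = dd f z (dd Y z (X z) - dd X z (Y z))"
proof -
  have "linear (dd f z)" using assms smooth_on_differentiable dd_linear by blast
  then show ?thesis
    unfolding dd_dd_field[OF assms(1,3,4,2)] dd_dd_field[OF assms(1,3,5,2)]
    using dd_dd_commute[OF assms(1-3), of "X z" "Y z"] by (simp add: linear_diff)
qed

section \<open>Smooth dependence of the solution of a linear system\<close>

text \<open>Injectivity at z gives a lower bound c; near z the images of the basis vectors move by
  less than c / 2 in total, which leaves the bound c / 2, uniformly on a ball.\<close>

lemma linear_solution_bound:
  fixes B :: "'a::euclidean_space \<Rightarrow> 'n::euclidean_space \<Rightarrow> 'n"
  assumes S: "open S" "z \<in> S" and lin: "\<And>x. x \<in> S \<Longrightarrow> linear (B x)" and inj: "inj (B z)"
    and B: "\<And>v. continuous_on S (\<lambda>x. B x v)"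
  obtains c d where "0 < c" "0 < d" "ball z d \<subseteq> S" "\<And>x v. x \<in> ball z d \<Longrightarrow> c * norm v \<le> norm (B x v)"
proof -
  obtain c where c: "c > 0" "\<And>v. c * norm v \<le> norm (B z v)"
    using linear_inj_bounded_below_pos[OF lin[OF S(2)] inj] by blast
  have "continuous_on S (\<lambda>x. \<Sum>i\<in>Basis. norm (B x i - B z i))"
    by (intro continuous_intros B)
  then have "isCont (\<lambda>x. \<Sum>i\<in>Basis. norm (B x i - B z i)) z"
    using S continuous_on_eq_continuous_at by blast
  then have "\<forall>e>0. \<exists>d>0. \<forall>x. dist x z < d \<longrightarrow> \<bar>\<Sum>i\<in>Basis. norm (B x i - B z i)\<bar> < e"
    by (simp add: continuous_at_eps_delta dist_real_def)
  then obtain d1 where d1: "d1 > 0"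
    "\<And>x. dist x z < d1 \<Longrightarrow> \<bar>(\<Sum>i\<in>Basis. norm (B x i - B z i))\<bar> < c / 2"
    using half_gt_zero[OF c(1)] by blast
  obtain d2 where d2: "d2 > 0" "ball z d2 \<subseteq> S" using S open_contains_ball by blast
  show ?thesis
  proof (rule that[of "c / 2" "min d1 d2"])
    show "ball z (min d1 d2) \<subseteq> S" using d2 by auto
    fix x v assume x: "x \<in> ball z (min d1 d2)"
    then have xS: "x \<in> S" using d2 by auto
    have "B x v - B z v = (\<Sum>i\<in>Basis. (v \<bullet> i) *\<^sub>R (B x i - B z i))"
      by (simp add: linear_euclidean_expansion[OF lin[OF xS], of v]
          linear_euclidean_expansion[OF lin[OF S(2)], of v] scaleR_diff_right sum_subtractf)
    then have "norm (B x v - B z v) \<le> (\<Sum>i\<in>Basis. \<bar>v \<bullet> i\<bar> * norm (B x i - B z i))"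
      by (metis (mono_tags, lifting) norm_scaleR sum.cong sum_norm_le order_refl)
    also have "\<dots> \<le> (\<Sum>i\<in>Basis. norm v * norm (B x i - B z i))"
      by (intro sum_mono mult_right_mono Basis_le_norm) auto
    also have "\<dots> \<le> norm v * (c / 2)"
      unfolding sum_distrib_left[symmetric]
      by (intro mult_left_mono) (use d1(2)[of x] x in \<open>auto simp: dist_commute\<close>)
    finally have "norm (B x v - B z v) \<le> c / 2 * norm v" by (simp add: mult.commute)
    moreover have "norm (B z v) \<le> norm (B x v) + norm (B x v - B z v)"
      by (metis add.commute norm_minus_commute norm_triangle_sub)
    ultimately show "c / 2 * norm v \<le> norm (B x v)" using c(2)[of v] by simp
  qed (use c d1 d2 in auto)
qed

text \<open>The difference w x - w z solves the system at x with right-hand side b x - B x (w z),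
  which tends to 0.\<close>

lemma linear_solution_continuous:
  fixes B :: "'a::euclidean_space \<Rightarrow> 'n::euclidean_space \<Rightarrow> 'n"
  assumes S: "open S" and lin: "\<And>x. x \<in> S \<Longrightarrow> linear (B x)" and inj: "\<And>x. x \<in> S \<Longrightarrow> inj (B x)"
    and B: "\<And>v. continuous_on S (\<lambda>x. B x v)" and b: "continuous_on S b"
    and w: "\<And>x. x \<in> S \<Longrightarrow> B x (w x) = b x"
  shows "continuous_on S w"
proof (rule continuous_at_imp_continuous_on, rule ballI)
  fix z assume z: "z \<in> S"
  obtain c d where cd: "0 < c" "0 < d" "ball z d \<subseteq> S" "\<And>x v. x \<in> ball z d \<Longrightarrow> c * norm v \<le> norm (B x v)"
    using linear_solution_bound[OF S z lin inj[OF z] B] by blast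
  have "continuous_on S (\<lambda>x. b x - B x (w z))" by (intro continuous_intros b B)
  then have cont: "isCont (\<lambda>x. b x - B x (w z)) z" using S z continuous_on_eq_continuous_at by blast
  show "isCont w z"
    unfolding continuous_at_eps_delta
  proof (intro allI impI)
    fix e :: real assume e: "0 < e"
    have "\<forall>e>0. \<exists>d>0. \<forall>x. dist x z < d \<longrightarrow> norm (b x - B x (w z)) < e"
      using cont w[OF z] by (simp add: continuous_at_eps_delta dist_norm)
    then obtain d' where d': "d' > 0" "\<And>x. dist x z < d' \<Longrightarrow> norm (b x - B x (w z)) < c * e"
      using mult_pos_pos[OF cd(1) e] by blast
    have "dist (w x) (w z) < e" if "dist x z < min d d'" for x
    proof -
      have x: "x \<in> ball z d" "x \<in> S" using that cd by (auto simp: dist_commute)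
      have "c * norm (w x - w z) \<le> norm (b x - B x (w z))"
        using cd(4)[OF x(1), of "w x - w z"] by (simp add: linear_diff[OF lin[OF x(2)]] w[OF x(2)])
      also have "\<dots> < c * e" using d' that by auto
      finally show ?thesis using cd(1) by (simp add: dist_norm)
    qed
    then show "\<exists>d>0. \<forall>x. dist x z < d \<longrightarrow> dist (w x) (w z) < e"
      using cd(2) d'(1) by (intro exI[of _ "min d d'"]) auto
  qed
qed

text \<open>The candidate derivative comes from formally differentiating B x (w x) = b x. Its error,
  seen through B x, vanishes to first order, and the uniform lower bound carries this over to
  w.\<close>

lemma linear_solution_derivative:
  fixes B :: "'a::euclidean_space \<Rightarrow> 'n::euclidean_space \<Rightarrow> 'n"
  assumes S: "open S" "z \<in> S" and lin: "\<And>x. x \<in> S \<Longrightarrow> linear (B x)" and inj: "\<And>x. x \<in> S \<Longrightarrow> inj (B x)"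
    and B: "\<And>v x. x \<in> S \<Longrightarrow> (\<lambda>x. B x v) differentiable (at x)" and b: "b differentiable (at z)"
    and w: "\<And>x. x \<in> S \<Longrightarrow> B x (w x) = b x"
  shows "w differentiable (at z)"
    and "B z (dd w z h) = dd b z h - (\<Sum>i\<in>Basis. (w z \<bullet> i) *\<^sub>R dd (\<lambda>x. B x i) z h)"
proof -
  have Bc: "continuous_on S (\<lambda>x. B x v)" for v
    using B by (simp add: continuous_at_imp_continuous_on differentiable_imp_continuous_within)
  obtain c d where cd: "0 < c" "0 < d" "ball z d \<subseteq> S" "\<And>x v. x \<in> ball z d \<Longrightarrow> c * norm v \<le> norm (B x v)"
    using linear_solution_bound[OF S lin inj[OF S(2)] Bc] by blast
  obtain G where G: "linear G" "\<And>v. B z (G v) = v"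
    using linear_injective_imp_surjective[OF lin[OF S(2)] inj[OF S(2)] refl] lin[OF S(2)]
    by (metis (no_types, lifting) linear_surjective_right_inverse comp_apply id_apply)
  define R where "R h = dd b z h - (\<Sum>i\<in>Basis. (w z \<bullet> i) *\<^sub>R dd (\<lambda>x. B x i) z h)" for h
  define D where "D h = G (R h)" for h
  have "linear R"
    unfolding R_def
    by (intro linear_compose_sub linear_compose_sum dd_linear b ballI linear_compose_scale_right B S)
  then have D: "linear D" unfolding D_def using G(1) linear_compose[of R G] by (simp add: o_def)
  have BD: "B z (D h) = R h" for h by (simp add: D_def G)
  \<comment> \<open>This is B x (w x - w z - D (x - z)), the error of the linear approximation seen
    through B x. It is expanded in the basis because differentiability is known for fixed arguments
    of B.\<close>
  define \<phi> where "\<phi> x = b x - (\<Sum>i\<in>Basis. (w z \<bullet> i) *\<^sub>R B x i) - (\<Sum>i\<in>Basis. (D (x - z) \<bullet> i) *\<^sub>R B x i)" for x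
  have "((\<lambda>x. x - z) has_derivative (\<lambda>h. h)) (at z)"
    by (auto intro!: derivative_eq_intros)
  then have DD: "((\<lambda>x. D (x - z)) has_derivative D) (at z)"
    using bounded_linear.has_derivative[OF linear_conv_bounded_linear[THEN iffD1, OF D]] by blast
  have "(\<phi> has_derivative (\<lambda>h. dd b z h - (\<Sum>i\<in>Basis. (w z \<bullet> i) *\<^sub>R dd (\<lambda>x. B x i) z h)
      - (\<Sum>i\<in>Basis. (D (z - z) \<bullet> i) *\<^sub>R dd (\<lambda>x. B x i) z h + (D h \<bullet> i) *\<^sub>R B z i))) (at z)"
    unfolding \<phi>_def
    by (intro has_derivative_diff has_derivative_sum has_derivative_scaleR_right has_derivative_scaleR
        has_derivative_inner_left DD dd_works b B S)
  moreover have "(\<lambda>h. dd b z h - (\<Sum>i\<in>Basis. (w z \<bullet> i) *\<^sub>R dd (\<lambda>x. B x i) z h)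
      - (\<Sum>i\<in>Basis. (D (z - z) \<bullet> i) *\<^sub>R dd (\<lambda>x. B x i) z h + (D h \<bullet> i) *\<^sub>R B z i)) = (\<lambda>h. 0)"
  proof
    fix h
    have "(\<Sum>i\<in>Basis. (D h \<bullet> i) *\<^sub>R B z i) = R h"
      using linear_euclidean_expansion[OF lin[OF S(2)], of "D h"] BD by simp
    then show "dd b z h - (\<Sum>i\<in>Basis. (w z \<bullet> i) *\<^sub>R dd (\<lambda>x. B x i) z h)
      - (\<Sum>i\<in>Basis. (D (z - z) \<bullet> i) *\<^sub>R dd (\<lambda>x. B x i) z h + (D h \<bullet> i) *\<^sub>R B z i) = 0"
      using D by (simp add: linear_0 R_def)
  qed
  ultimately have \<phi>: "(\<phi> has_derivative (\<lambda>h. 0)) (at z)" by simp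
  have exp: "B x v = (\<Sum>i\<in>Basis. (v \<bullet> i) *\<^sub>R B x i)" if "x \<in> S" for x v
    using linear_euclidean_expansion lin that by blast
  have \<phi>_eq: "\<phi> x = B x (w x - w z - D (x - z))" if "x \<in> S" for x
    using that exp[OF that, of "w z"] exp[OF that, of "D (x - z)"] w
    by (simp add: \<phi>_def linear_diff[OF lin])
  have \<phi>0: "\<phi> z = 0" using \<phi>_eq[OF S(2)] D lin[OF S(2)] by (simp add: linear_0)
  have "(w has_derivative D) (at z)"
    unfolding has_derivative_at_alt
  proof (intro conjI allI impI)
    show "bounded_linear D" using D linear_conv_bounded_linear by blast
    fix e :: real assume e: "0 < e"
    have "0 < c * e" using e cd(1) by simp
    have "\<forall>e>0. \<exists>d>0. \<forall>x. norm (x - z) < d \<longrightarrow> norm (\<phi> x) \<le> e * norm (x - z)"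
      using \<phi> \<phi>0 by (simp add: has_derivative_at_alt)
    then obtain d' where d': "d' > 0" "\<And>x. norm (x - z) < d' \<Longrightarrow> norm (\<phi> x) \<le> c * e * norm (x - z)"
      using \<open>0 < c * e\<close> by blast
    have "norm (w x - w z - D (x - z)) \<le> e * norm (x - z)" if "norm (x - z) < min d d'" for x
    proof -
      have x: "x \<in> ball z d" using that by (simp add: dist_norm norm_minus_commute)
      have "c * norm (w x - w z - D (x - z)) \<le> norm (\<phi> x)"
        using cd(4)[OF x] \<phi>_eq[of x] x cd(3) by auto
      also have "\<dots> \<le> c * (e * norm (x - z))" using d'(2) that by (simp add: mult.assoc)
      finally show ?thesis using cd(1) by simp
    qed
    then show "\<exists>d>0. \<forall>x. norm (x - z) < d \<longrightarrow> norm (w x - w z - D (x - z)) \<le> e * norm (x - z)"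
      using cd(2) d'(1) by (intro exI[of _ "min d d'"]) auto
  qed
  then show "w differentiable (at z)" "B z (dd w z h) = dd b z h - (\<Sum>i\<in>Basis. (w z \<bullet> i) *\<^sub>R dd (\<lambda>x. B x i) z h)"
    using BD by (auto simp: differentiable_def dd_eqI R_def)
qed

text \<open>The derivative of w solves the same system with a new right-hand side, which contains w
  and the derivative of b. So the induction runs over all right-hand sides at once, and each order
  of b yields one order of w.\<close>

lemma smooth_on_linear_solution:
  fixes B :: "'a::euclidean_space \<Rightarrow> 'n::euclidean_space \<Rightarrow> 'n"
  assumes S: "open S" and lin: "\<And>x. x \<in> S \<Longrightarrow> linear (B x)" and inj: "\<And>x. x \<in> S \<Longrightarrow> inj (B x)"
    and B: "\<And>v. smooth_on S (\<lambda>x. B x v)" and b: "smooth_on S b"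
    and w: "\<And>x. x \<in> S \<Longrightarrow> B x (w x) = b x"
  shows "smooth_on S w"
proof -
  have B0: "continuous_on S (\<lambda>x. B x v)" for v
    using B unfolding smooth_on_def by (metis Ck_on.simps(1))
  have Bd: "(\<lambda>x. B x v) differentiable (at x)" if "x \<in> S" for v x
    using smooth_on_differentiable[OF S B that] .
  have "Ck_on k S w" if "Ck_on k S b" "\<And>x. x \<in> S \<Longrightarrow> B x (w x) = b x" for k b w
    using that
  proof (induction k arbitrary: b w)
    case 0
    then show ?case using linear_solution_continuous[OF S lin inj B0] by simp
  next
    case (Suc k)
    have b: "b differentiable (at x)" if "x \<in> S" for x
      using Suc.prems(1) Ck_on_Suc_dd[OF S] that by blast
    note der = linear_solution_derivative[OF S _ lin inj Bd b Suc.prems(2)]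
    have wk: "Ck_on k S w" by (rule Suc.IH[OF Ck_on_mono[OF Suc.prems(1)] Suc.prems(2)])
    have "Ck_on k S (\<lambda>x. dd w x h)" for h
    proof (rule Suc.IH)
      show "B x (dd w x h) = dd b x h - (\<Sum>i\<in>Basis. (w x \<bullet> i) *\<^sub>R dd (\<lambda>x. B x i) x h)"
        if "x \<in> S" for x using der(2)[OF that] that by blast
      have 1: "Ck_on k S (\<lambda>x. dd b x h)" using Suc.prems(1) Ck_on_Suc_dd[OF S] by blast
      have "Ck_on k S (\<lambda>x. (-1) *\<^sub>R (\<Sum>i\<in>Basis. (w x \<bullet> i) *\<^sub>R dd (\<lambda>x. B x i) x h))"
        using wk smooth_on_dd[OF S B] unfolding smooth_on_def
        by (intro Ck_on_sum finite_Basis Ck_on_bilinear[OF bounded_bilinear_scaleR]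
            Ck_on_bilinear[OF bounded_bilinear_inner] Ck_on_const) auto
      from Ck_on_add[OF 1 this]
      show "Ck_on k S (\<lambda>x. dd b x h - (\<Sum>i\<in>Basis. (w x \<bullet> i) *\<^sub>R dd (\<lambda>x. B x i) x h))" by simp
    qed
    then show ?case using der(1) Ck_on_Suc_dd[OF S] by blast
  qed
  then show ?thesis using b w unfolding smooth_on_def by blast
qed

section \<open>Manifolds in charts\<close>

text \<open>Used for two atlases: that of M and that of the slit tangent bundle.\<close>

locale atlas =
  fixes B :: "('q, 'f::euclidean_space) chart set"
  assumes atlas: "smooth_atlas B"
begin

lemma inj_chart: "c \<in> B \<Longrightarrow> inj_on (snd c) (fst c)"
  and open_chart_image: "c \<in> B \<Longrightarrow> open (snd c ` fst c)"
  and open_overlap: "c \<in> B \<Longrightarrow> d \<in> B \<Longrightarrow> open (snd c ` (fst c \<inter> fst d))"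
  and smooth_transition: "c \<in> B \<Longrightarrow> d \<in> B \<Longrightarrow>
    smooth_on (snd c ` (fst c \<inter> fst d)) (snd d \<circ> chart_inv c)"
  using atlas unfolding smooth_atlas_def by blast+

lemma chart_inv_left [simp]: "c \<in> B \<Longrightarrow> p \<in> fst c \<Longrightarrow> chart_inv c (snd c p) = p"
  by (simp add: inj_chart)

lemma chart_inv_in [simp]: "z \<in> snd c ` fst c \<Longrightarrow> chart_inv c z \<in> fst c"
  by (rule inv_into_into)

lemma chart_inv_right [simp]: "z \<in> snd c ` fst c \<Longrightarrow> snd c (chart_inv c z) = z"
  by (rule f_inv_into_f)

lemma charts_at_iff: "c \<in> charts_at B p \<longleftrightarrow> c \<in> B \<and> p \<in> fst c"
  by (simp add: charts_at_def)

lemma manifold_points_iff: "p \<in> manifold_points B \<longleftrightarrow> (\<exists>c. c \<in> charts_at B p)"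
  by (simp add: charts_at_iff manifold_points_def Bex_def)

lemma chart_image_Int:
  assumes "c \<in> B"
  shows "snd c ` (U \<inter> V \<inter> fst c) = snd c ` (U \<inter> fst c) \<inter> snd c ` (V \<inter> fst c)"
  using inj_on_image_Int[OF inj_chart[OF assms], of "U \<inter> fst c" "V \<inter> fst c"]
  by (simp add: Int_ac)

text \<open>Injectivity of the charts enters for intersections, whose chart image must be the
  intersection of the images.\<close>

lemma openin_manifold_topology:
  "openin (manifold_topology B) W \<longleftrightarrow> W \<subseteq> manifold_points B \<and> (\<forall>c\<in>B. open (snd c ` (W \<inter> fst c)))"
proof -
  have "istopology (\<lambda>W. W \<subseteq> manifold_points B \<and> (\<forall>c\<in>B. open (snd c ` (W \<inter> fst c))))"
    unfolding istopology_def
  proof (intro conjI allI impI ballI)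
    fix U V c assume *: "U \<subseteq> manifold_points B \<and> (\<forall>c\<in>B. open (snd c ` (U \<inter> fst c)))"
      "V \<subseteq> manifold_points B \<and> (\<forall>c\<in>B. open (snd c ` (V \<inter> fst c)))"
    then show "U \<inter> V \<subseteq> manifold_points B" by blast
    assume "c \<in> B"
    then show "open (snd c ` (U \<inter> V \<inter> fst c))" using * by (simp add: chart_image_Int open_Int)
  next
    fix K c assume *: "\<forall>U\<in>K. U \<subseteq> manifold_points B \<and> (\<forall>c\<in>B. open (snd c ` (U \<inter> fst c)))"
    then show "\<Union>K \<subseteq> manifold_points B" by blast
    assume "c \<in> B"
    then have "open (\<Union>U\<in>K. snd c ` (U \<inter> fst c))" using * by blast
    moreover have "snd c ` (\<Union>K \<inter> fst c) = (\<Union>U\<in>K. snd c ` (U \<inter> fst c))" by blast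
    ultimately show "open (snd c ` (\<Union>K \<inter> fst c))" by simp
  qed
  then show ?thesis by (simp add: manifold_topology_def topology_inverse')
qed

lemma openin_chart_domain: "c \<in> B \<Longrightarrow> openin (manifold_topology B) (fst c)"
  unfolding openin_manifold_topology
  using open_overlap[of _ c] by (auto simp: manifold_points_def Int_commute)

lemma manifold_points_Int_chart: "c \<in> B \<Longrightarrow> manifold_points B \<inter> fst c = fst c"
  by (auto simp: manifold_points_def)

lemma openin_manifold_points: "openin (manifold_topology B) (manifold_points B)"
  unfolding openin_manifold_topology by (auto simp: manifold_points_Int_chart open_chart_image)

lemma overlap_transition:
  assumes "c \<in> B" "z \<in> snd c ` (fst c \<inter> fst d)"
  shows "z \<in> snd c ` fst c" "chart_inv c z \<in> fst c" "chart_inv c z \<in> fst d"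
    "snd d (chart_inv c z) \<in> snd d ` (fst d \<inter> fst c)"
  using assms by auto

subsection \<open>Tangent vectors\<close>

lemma transition_differentiable:
  assumes "c \<in> charts_at B p" "d \<in> charts_at B p"
  shows "(snd d \<circ> chart_inv c) differentiable (at (snd c p))"
  using assms by (intro smooth_on_differentiable[OF open_overlap smooth_transition])
    (auto simp: charts_at_iff)

lemma tangent_space_iff:
  "v \<in> tangent_space B p \<longleftrightarrow> (\<forall>c. c \<notin> charts_at B p \<longrightarrow> v c = 0) \<and>
    (\<forall>c\<in>charts_at B p. \<forall>d\<in>charts_at B p. v d = dd (snd d \<circ> chart_inv c) (snd c p) (v c))"
  by (simp add: tangent_space_def dd_def)

lemma tangent_transition:
  "v \<in> tangent_space B p \<Longrightarrow> c \<in> charts_at B p \<Longrightarrow> d \<in> charts_at B p \<Longrightarrow>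
    v d = dd (snd d \<circ> chart_inv c) (snd c p) (v c)"
  unfolding tangent_space_iff by blast

lemma tangent_outside: "v \<in> tangent_space B p \<Longrightarrow> c \<notin> charts_at B p \<Longrightarrow> v c = 0"
  unfolding tangent_space_iff by blast

lemma tangent_eqI:
  assumes "v \<in> tangent_space B p" "w \<in> tangent_space B p" "c \<in> charts_at B p" "v c = w c"
  shows "v = w"
proof
  fix d show "v d = w d"
    using assms(4) tangent_transition[OF assms(1,3), of d] tangent_transition[OF assms(2,3), of d]
      tangent_outside[OF assms(1), of d] tangent_outside[OF assms(2), of d]
    by (cases "d \<in> charts_at B p") auto
qed

lemma tangentI:
  assumes "\<And>c. c \<notin> charts_at B p \<Longrightarrow> v c = 0"
    and "\<And>c d. c \<in> charts_at B p \<Longrightarrow> d \<in> charts_at B p \<Longrightarrow>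
      v d = dd (snd d \<circ> chart_inv c) (snd c p) (v c)"
  shows "v \<in> tangent_space B p"
  using assms unfolding tangent_space_iff by blast

lemma tangent_add:
  assumes "v \<in> tangent_space B p" "w \<in> tangent_space B p"
  shows "v + w \<in> tangent_space B p"
proof (rule tangentI)
  fix c d assume c: "c \<in> charts_at B p" and d: "d \<in> charts_at B p"
  show "(v + w) d = dd (snd d \<circ> chart_inv c) (snd c p) ((v + w) c)"
    using linear_add[OF dd_linear[OF transition_differentiable[OF c d]]] tangent_transition[OF assms(1) c d] tangent_transition[OF assms(2) c d]
    by (simp add: scaleR_fun_def)
qed (use tangent_outside[OF assms(1)] tangent_outside[OF assms(2)] in \<open>simp add: scaleR_fun_def\<close>)

lemma tangent_scaleR:
  assumes "v \<in> tangent_space B p"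
  shows "r *\<^sub>R v \<in> tangent_space B p"
proof (rule tangentI)
  fix c d assume c: "c \<in> charts_at B p" and d: "d \<in> charts_at B p"
  show "(r *\<^sub>R v) d = dd (snd d \<circ> chart_inv c) (snd c p) ((r *\<^sub>R v) c)"
    using linear_cmul[OF dd_linear[OF transition_differentiable[OF c d]]] tangent_transition[OF assms(1) c d]
    by (simp add: scaleR_fun_def)
qed (use tangent_outside[OF assms(1)] in \<open>simp add: scaleR_fun_def\<close>)

lemma tangent_minus:
  assumes "v \<in> tangent_space B p"
  shows "- v \<in> tangent_space B p"
proof (rule tangentI)
  fix c d assume c: "c \<in> charts_at B p" and d: "d \<in> charts_at B p"
  show "(- v) d = dd (snd d \<circ> chart_inv c) (snd c p) ((- v) c)"
    using linear_neg[OF dd_linear[OF transition_differentiable[OF c d]]] tangent_transition[OF assms(1) c d]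
    by (simp add: scaleR_fun_def)
qed (use tangent_outside[OF assms(1)] in \<open>simp add: scaleR_fun_def\<close>)

lemma tangent_diff: "v \<in> tangent_space B p \<Longrightarrow> w \<in> tangent_space B p \<Longrightarrow> v - w \<in> tangent_space B p"
  using tangent_add[of v p "- w"] tangent_minus[of w p] by simp

lemma tangent_zero: "0 \<in> tangent_space B p"
  by (rule tangentI) (simp_all add: linear_0[OF dd_linear[OF transition_differentiable]])

lemma transition_cocycle:
  assumes "c \<in> charts_at B p" "d \<in> charts_at B p" "f differentiable (at (snd d p))"
  shows "dd (\<lambda>z. f (snd d (chart_inv c z))) (snd c p) e
    = dd f (snd d p) (dd (snd d \<circ> chart_inv c) (snd c p) e)"
proof -
  have "chart_inv c (snd c p) = p" using assms(1) by (simp add: charts_at_iff)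
  then show ?thesis
    using dd_compose[of "snd d \<circ> chart_inv c" "snd c p" f e] transition_differentiable[OF assms(1,2)]
      assms(3) by simp
qed

text \<open>The tangent vector with coordinates e in the chart c. With e fixed and p varying, these
  are the coordinate vector fields of the chart, to which the smoothness condition on a connection
  is applied later.\<close>

definition tvec_of :: "'q \<Rightarrow> ('q, 'f) chart \<Rightarrow> 'f \<Rightarrow> ('q, 'f) tvec"
  where "tvec_of p c e =
    (\<lambda>d. if d \<in> charts_at B p then dd (snd d \<circ> chart_inv c) (snd c p) e else 0)"

lemma tvec_of_self:
  assumes "c \<in> charts_at B p"
  shows "tvec_of p c e c = e"
proof -
  have c: "c \<in> B" "p \<in> fst c" using assms by (auto simp: charts_at_iff)
  have "dd (snd c \<circ> chart_inv c) (snd c p) e = dd (\<lambda>z. z) (snd c p) e"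
    by (rule dd_cong[OF open_chart_image[OF c(1)]]) (use c in auto)
  also have "\<dots> = e" by (rule dd_eqI) simp
  finally show ?thesis using assms by (simp add: tvec_of_def)
qed

lemma chart_overlap_mem: "c \<in> charts_at B p \<Longrightarrow> d \<in> charts_at B p \<Longrightarrow> snd c p \<in> snd c ` (fst c \<inter> fst d)"
  by (auto simp: charts_at_iff)

lemma tvec_of_tangent:
  assumes c: "c \<in> charts_at B p"
  shows "tvec_of p c e \<in> tangent_space B p"
proof (rule tangentI)
  fix d d' assume d: "d \<in> charts_at B p" and d': "d' \<in> charts_at B p"
  have "dd (snd d' \<circ> chart_inv c) (snd c p) e
      = dd (\<lambda>z. (snd d' \<circ> chart_inv d) (snd d (chart_inv c z))) (snd c p) e"
    by (rule dd_cong[OF open_overlap chart_overlap_mem[OF c d]]) (use c d in \<open>auto simp: charts_at_iff\<close>)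
  also have "\<dots> = dd (snd d' \<circ> chart_inv d) (snd d p) (dd (snd d \<circ> chart_inv c) (snd c p) e)"
    by (rule transition_cocycle[OF c d transition_differentiable[OF d d']])
  finally show "tvec_of p c e d' = dd (snd d' \<circ> chart_inv d) (snd d p) (tvec_of p c e d)"
    using d d' by (simp add: tvec_of_def)
qed (simp add: tvec_of_def)

lemma tvec_of_eq: "v \<in> tangent_space B p \<Longrightarrow> c \<in> charts_at B p \<Longrightarrow> tvec_of p c (v c) = v"
  by (rule tangent_eqI[OF tvec_of_tangent]) (auto simp: tvec_of_self)

text \<open>Removes the arbitrary choice of a chart in \<open>dir_deriv\<close>: the chain rule for
  the transition map moves the chosen chart to the given one.\<close>

lemma dir_deriv_chart:
  assumes c: "c \<in> charts_at B p" and v: "v \<in> tangent_space B p"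
    and f: "(f \<circ> chart_inv c) differentiable (at (snd c p))"
  shows "dir_deriv B p v f = dd (f \<circ> chart_inv c) (snd c p) (v c)"
proof -
  define d where "d = (SOME c. c \<in> charts_at B p)"
  have d: "d \<in> charts_at B p" unfolding d_def using c by (rule someI)
  have "dir_deriv B p v f = dd (f \<circ> chart_inv d) (snd d p) (v d)"
    by (simp add: dir_deriv_def d_def dd_def Let_def)
  also have "\<dots> = dd (\<lambda>z. (f \<circ> chart_inv c) (snd c (chart_inv d z))) (snd d p) (v d)"
    by (rule dd_cong[OF open_overlap chart_overlap_mem[OF d c]]) (use c d in \<open>auto simp: charts_at_iff\<close>)
  also have "\<dots> = dd (f \<circ> chart_inv c) (snd c p) (dd (snd c \<circ> chart_inv d) (snd d p) (v d))"
    by (rule transition_cocycle[OF d c f])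
  also have "dd (snd c \<circ> chart_inv d) (snd d p) (v d) = v c"
    using tangent_transition[OF v d c] by simp
  finally show ?thesis .
qed

subsection \<open>Vector fields\<close>

abbreviation rep :: "('q \<Rightarrow> ('q, 'f) tvec) \<Rightarrow> ('q, 'f) chart \<Rightarrow> 'f \<Rightarrow> 'f"
  where "rep X c \<equiv> \<lambda>z. X (chart_inv c z) c"

lemma vector_fieldsI:
  assumes "\<And>p. p \<in> manifold_points B \<Longrightarrow> X p \<in> tangent_space B p"
    and "\<And>p. p \<notin> manifold_points B \<Longrightarrow> X p = 0"
    and "\<And>c. c \<in> B \<Longrightarrow> smooth_on (snd c ` fst c) (rep X c)"
  shows "X \<in> vector_fields B"
  using assms by (simp add: vector_fields_def vector_field_on_def manifold_points_Int_chart)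

lemma vector_fields_tangent: "X \<in> vector_fields B \<Longrightarrow> X p \<in> tangent_space B p"
  by (cases "p \<in> manifold_points B") (auto simp: vector_fields_def vector_field_on_def tangent_zero)

lemma vector_fields_outside: "X \<in> vector_fields B \<Longrightarrow> c \<notin> charts_at B p \<Longrightarrow> X p c = 0"
  using vector_fields_tangent tangent_outside by blast

lemma vector_fields_rep: "X \<in> vector_fields B \<Longrightarrow> c \<in> B \<Longrightarrow> smooth_on (snd c ` fst c) (rep X c)"
  by (auto simp: vector_fields_def vector_field_on_def manifold_points_Int_chart)

lemma vector_fields_rep_differentiable:
  "X \<in> vector_fields B \<Longrightarrow> c \<in> charts_at B p \<Longrightarrow> rep X c differentiable (at (snd c p))"
  by (intro smooth_on_differentiable[OF open_chart_image vector_fields_rep])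
    (auto simp: charts_at_iff)

lemma vector_fields_zero: "0 \<in> vector_fields B"
  by (rule vector_fieldsI) (auto simp: tangent_zero)

lemma vector_fields_add: "X \<in> vector_fields B \<Longrightarrow> Y \<in> vector_fields B \<Longrightarrow> X + Y \<in> vector_fields B"
  by (rule vector_fieldsI)
    (auto simp: tangent_add vector_fields_tangent smooth_on_add vector_fields_rep manifold_points_iff
      vector_fields_outside fun_eq_iff)

lemma vector_fields_minus: "X \<in> vector_fields B \<Longrightarrow> - X \<in> vector_fields B"
  by (rule vector_fieldsI)
    (auto simp: tangent_minus vector_fields_tangent smooth_on_minus vector_fields_rep manifold_points_iff
      vector_fields_outside fun_eq_iff)

lemma lie_bracket_chart:
  assumes X: "X \<in> vector_fields B" and Y: "Y \<in> vector_fields B" and c: "c \<in> charts_at B p"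
  shows "lie_bracket B X Y p c
    = dd (rep Y c) (snd c p) (X p c) - dd (rep X c) (snd c p) (Y p c)"
  using c dir_deriv_chart[OF c vector_fields_tangent[OF X], of "\<lambda>q. Y q c"]
    dir_deriv_chart[OF c vector_fields_tangent[OF Y], of "\<lambda>q. X q c"]
    vector_fields_rep_differentiable[OF X c] vector_fields_rep_differentiable[OF Y c]
  by (simp add: lie_bracket_def o_def)

lemma lie_bracket_rep:
  assumes "X \<in> vector_fields B" "Y \<in> vector_fields B" "c \<in> B" "z \<in> snd c ` fst c"
  shows "rep (lie_bracket B X Y) c z = dd (rep Y c) z (rep X c z) - dd (rep X c) z (rep Y c z)"
  using lie_bracket_chart[OF assms(1,2), of c "chart_inv c z"] assms(3,4) by (simp add: charts_at_iff)

text \<open>The first summand, a second derivative of the transition map, is what keeps the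
  derivative of components from being tensorial. It is symmetric in X and Y and so drops out of the
  Lie bracket.\<close>

lemma dir_deriv_components:
  assumes X: "X \<in> vector_fields B" and Y: "Y \<in> vector_fields B"
    and c: "c \<in> charts_at B p" and d: "d \<in> charts_at B p"
  shows "dir_deriv B p (X p) (\<lambda>q. Y q d)
    = dd (\<lambda>z. dd (snd d \<circ> chart_inv c) z (Y p c)) (snd c p) (X p c)
      + dd (snd d \<circ> chart_inv c) (snd c p) (dd (rep Y c) (snd c p) (X p c))"
proof -
  let ?S = "snd c ` (fst c \<inter> fst d)" and ?\<tau> = "snd d \<circ> chart_inv c"
  have cB: "c \<in> B" and dB: "d \<in> B" and p: "p \<in> fst c" using c d by (auto simp: charts_at_iff)
  have S: "open ?S" "snd c p \<in> ?S" using open_overlap chart_overlap_mem c d cB dB by auto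
  have eq: "((\<lambda>q. Y q d) \<circ> chart_inv c) z = dd ?\<tau> z (rep Y c z)" if "z \<in> ?S" for z
    using tangent_transition[OF vector_fields_tangent[OF Y], of c "chart_inv c z" d]
      overlap_transition[OF cB that] cB dB by (simp add: charts_at_iff)
  have Yc: "smooth_on ?S (rep Y c)"
    by (rule smooth_on_subset[OF vector_fields_rep[OF Y cB]]) auto
  note \<tau> = smooth_transition[OF cB dB]
  have sm: "smooth_on ?S (\<lambda>z. dd ?\<tau> z (rep Y c z))"
    by (rule smooth_on_dd_field[OF S(1) \<tau> Yc])
  have "((\<lambda>q. Y q d) \<circ> chart_inv c) differentiable (at (snd c p))"
    using smooth_on_differentiable[OF S(1) sm S(2)]
    by (rule iffD2[OF differentiable_cong_open[OF S], rotated]) (rule eq)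
  then have "dir_deriv B p (X p) (\<lambda>q. Y q d) = dd ((\<lambda>q. Y q d) \<circ> chart_inv c) (snd c p) (X p c)"
    by (rule dir_deriv_chart[OF c vector_fields_tangent[OF X]])
  also have "\<dots> = dd (\<lambda>z. dd ?\<tau> z (rep Y c z)) (snd c p) (X p c)"
    by (rule dd_cong[OF S eq])
  also have "\<dots> = dd (\<lambda>z. dd ?\<tau> z (rep Y c (snd c p))) (snd c p) (X p c)
      + dd ?\<tau> (snd c p) (dd (rep Y c) (snd c p) (X p c))"
    by (rule dd_dd_field[OF S(1) \<tau> Yc S(2)])
  finally show ?thesis using cB p by simp
qed

lemma lie_bracket_closed:
  assumes X: "X \<in> vector_fields B" and Y: "Y \<in> vector_fields B"
  shows "lie_bracket B X Y \<in> vector_fields B"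
proof (rule vector_fieldsI)
  fix p
  show "lie_bracket B X Y p \<in> tangent_space B p"
  proof (rule tangentI)
    fix c d assume c: "c \<in> charts_at B p" and d: "d \<in> charts_at B p"
    let ?S = "snd c ` (fst c \<inter> fst d)" and ?\<tau> = "snd d \<circ> chart_inv c"
    have cB: "c \<in> B" and dB: "d \<in> B" using c d by (auto simp: charts_at_iff)
    have "dd (\<lambda>z. dd ?\<tau> z (Y p c)) (snd c p) (X p c) = dd (\<lambda>z. dd ?\<tau> z (X p c)) (snd c p) (Y p c)"
      by (rule dd_dd_commute[OF open_overlap[OF cB dB] chart_overlap_mem[OF c d] smooth_transition[OF cB dB]])
    moreover have "lie_bracket B X Y p d
        = dir_deriv B p (X p) (\<lambda>q. Y q d) - dir_deriv B p (Y p) (\<lambda>q. X q d)"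
      using d by (simp add: lie_bracket_def)
    ultimately show "lie_bracket B X Y p d = dd ?\<tau> (snd c p) (lie_bracket B X Y p c)"
      using dir_deriv_components[OF X Y c d] dir_deriv_components[OF Y X c d]
      by (simp add: lie_bracket_chart[OF X Y c]
          linear_diff[OF dd_linear[OF transition_differentiable[OF c d]]])
  qed (simp add: lie_bracket_def)
next
  fix p assume "p \<notin> manifold_points B"
  then show "lie_bracket B X Y p = 0" by (auto simp: manifold_points_iff lie_bracket_def)
next
  fix c assume c: "c \<in> B"
  note S = open_chart_image[OF c]
  show "smooth_on (snd c ` fst c) (rep (lie_bracket B X Y) c)"
    by (rule smooth_on_cong[OF S lie_bracket_rep[OF X Y c, symmetric]])
      (auto intro!: smooth_on_diff smooth_on_dd_field S vector_fields_rep X Y c)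
qed

lemma vector_field_eqI:
  assumes "X \<in> vector_fields B" "Y \<in> vector_fields B"
    and "\<And>p c. c \<in> charts_at B p \<Longrightarrow> X p c = Y p c"
  shows "X = Y"
proof (intro ext)
  fix p c show "X p c = Y p c"
    using assms(3)[of c p] vector_fields_outside[OF assms(1), of c p] vector_fields_outside[OF assms(2), of c p]
    by (cases "c \<in> charts_at B p") auto
qed

lemma lie_bracket_add_left:
  assumes X: "X \<in> vector_fields B" and Y: "Y \<in> vector_fields B" and Z: "Z \<in> vector_fields B"
  shows "lie_bracket B (X + Y) Z = lie_bracket B X Z + lie_bracket B Y Z"
proof (rule vector_field_eqI)
  fix p c assume c: "c \<in> charts_at B p"
  have "dd (rep (X + Y) c) (snd c p) v = dd (rep X c) (snd c p) v + dd (rep Y c) (snd c p) v" for v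
    using has_derivative_add[OF dd_works[OF vector_fields_rep_differentiable[OF X c]]
        dd_works[OF vector_fields_rep_differentiable[OF Y c]]]
    by (simp add: dd_eqI)
  then show "lie_bracket B (X + Y) Z p c = (lie_bracket B X Z + lie_bracket B Y Z) p c"
    using X Y Z c linear_add[OF dd_linear[OF vector_fields_rep_differentiable[OF Z c]]]
    by (simp add: lie_bracket_chart vector_fields_add)
qed (use assms in \<open>auto intro!: lie_bracket_closed vector_fields_add\<close>)

lemma lie_bracket_antisym: "lie_bracket B X Y = - lie_bracket B Y X"
  by (auto simp: lie_bracket_def fun_eq_iff)

lemma lie_bracket_jacobi:
  assumes X: "X \<in> vector_fields B" and Y: "Y \<in> vector_fields B" and Z: "Z \<in> vector_fields B"
  shows "lie_bracket B X (lie_bracket B Y Z) + lie_bracket B Y (lie_bracket B Z X)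
    + lie_bracket B Z (lie_bracket B X Y) = 0"
proof (rule vector_field_eqI)
  fix p c assume c: "c \<in> charts_at B p"
  have cB: "c \<in> B" and p: "p \<in> fst c" using c by (auto simp: charts_at_iff)
  let ?S = "snd c ` fst c" and ?z = "snd c p"
  have S: "open ?S" "?z \<in> ?S" using open_chart_image[OF cB] p by auto
  define m where "m U V W = dd (\<lambda>z. dd (rep W c) z (rep V c z)) ?z (rep U c ?z)" for U V W
  \<comment> \<open>The derivative of U along [V, W] is a commutator of iterated derivatives by
    \<open>dd_commutator\<close>. Each double bracket thus becomes four terms \<open>m\<close>, and
    the twelve terms of the cyclic sum cancel.\<close>
  have *: "lie_bracket B U (lie_bracket B V W) p c = m U V W - m U W V - (m V W U - m W V U)"
    if U: "U \<in> vector_fields B" and V: "V \<in> vector_fields B" and W: "W \<in> vector_fields B" for U V W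
  proof -
    have "dd (rep (lie_bracket B V W) c) ?z (U p c)
        = dd (\<lambda>z. dd (rep W c) z (rep V c z) - dd (rep V c) z (rep W c z)) ?z (U p c)"
      by (rule dd_cong[OF S]) (rule lie_bracket_rep[OF V W cB])
    also have "\<dots> = m U V W - m U W V"
    proof -
      have "(\<lambda>z. dd (rep W c) z (rep V c z)) differentiable (at ?z)"
          "(\<lambda>z. dd (rep V c) z (rep W c z)) differentiable (at ?z)"
        by (intro smooth_on_differentiable[OF S(1)] smooth_on_dd_field S vector_fields_rep V W cB)+
      from has_derivative_diff[OF this[THEN dd_works]] show ?thesis
        using cB p by (simp add: m_def dd_eqI)
    qed
    finally show ?thesis
      using dd_commutator[OF S vector_fields_rep[OF U cB] vector_fields_rep[OF V cB] vector_fields_rep[OF W cB]]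
        cB p
      by (simp add: lie_bracket_chart[OF U lie_bracket_closed[OF V W] c] lie_bracket_chart[OF V W c] m_def)
  qed
  show "(lie_bracket B X (lie_bracket B Y Z) + lie_bracket B Y (lie_bracket B Z X)
      + lie_bracket B Z (lie_bracket B X Y)) p c = 0 p c"
    by (simp add: * X Y Z)
qed (use assms in \<open>auto intro!: lie_bracket_closed vector_fields_add vector_fields_zero\<close>)

subsection \<open>Functions\<close>

text \<open>As for vector fields, the value 0 off the manifold makes equality of global functions
  equality in HOL, as the abstract calculus requires.\<close>

definition smooth_funs :: "('q \<Rightarrow> real) set"
  where "smooth_funs = {f. smooth_fun B f \<and> (\<forall>p. p \<notin> manifold_points B \<longrightarrow> f p = 0)}"

definition deriv_along :: "('q \<Rightarrow> ('q, 'f) tvec) \<Rightarrow> ('q \<Rightarrow> real) \<Rightarrow> 'q \<Rightarrow> real"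
  where "deriv_along X f = (\<lambda>p. if p \<in> manifold_points B then dir_deriv B p (X p) f else 0)"

lemma smooth_funs_rep: "f \<in> smooth_funs \<Longrightarrow> c \<in> B \<Longrightarrow> smooth_on (snd c ` fst c) (f \<circ> chart_inv c)"
  by (simp add: smooth_funs_def smooth_fun_def)

lemma smooth_funs_zero: "0 \<in> smooth_funs"
  by (simp add: smooth_funs_def smooth_fun_def o_def)

lemma smooth_funs_add: "f \<in> smooth_funs \<Longrightarrow> h \<in> smooth_funs \<Longrightarrow> f + h \<in> smooth_funs"
  by (simp add: smooth_funs_def smooth_fun_def o_def smooth_on_add)

lemma smooth_funs_minus: "f \<in> smooth_funs \<Longrightarrow> - f \<in> smooth_funs"
  by (simp add: smooth_funs_def smooth_fun_def o_def smooth_on_minus)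

lemma smooth_funs_rep_differentiable:
  "f \<in> smooth_funs \<Longrightarrow> c \<in> charts_at B p \<Longrightarrow> (f \<circ> chart_inv c) differentiable (at (snd c p))"
  by (intro smooth_on_differentiable[OF open_chart_image smooth_funs_rep])
    (auto simp: charts_at_iff)

lemma deriv_along_chart:
  assumes "X \<in> vector_fields B" "f \<in> smooth_funs" "c \<in> charts_at B p"
  shows "deriv_along X f p = dd (f \<circ> chart_inv c) (snd c p) (X p c)"
proof -
  have "p \<in> manifold_points B" using assms(3) manifold_points_iff by blast
  then show ?thesis
    using dir_deriv_chart[OF assms(3) vector_fields_tangent[OF assms(1)]
        smooth_funs_rep_differentiable[OF assms(2,3)]]
    by (simp add: deriv_along_def)
qed

lemma deriv_along_rep:
  assumes "X \<in> vector_fields B" "f \<in> smooth_funs" "c \<in> B" "z \<in> snd c ` fst c"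
  shows "(deriv_along X f \<circ> chart_inv c) z = dd (f \<circ> chart_inv c) z (rep X c z)"
  using deriv_along_chart[OF assms(1,2), of c "chart_inv c z"] assms(3,4) by (simp add: charts_at_iff)

lemma deriv_along_closed:
  assumes "X \<in> vector_fields B" "f \<in> smooth_funs"
  shows "deriv_along X f \<in> smooth_funs"
proof -
  have "smooth_on (snd c ` fst c) (deriv_along X f \<circ> chart_inv c)" if c: "c \<in> B" for c
    by (rule smooth_on_cong[OF open_chart_image[OF c] deriv_along_rep[OF assms c, symmetric]])
      (auto intro!: smooth_on_dd_field open_chart_image smooth_funs_rep vector_fields_rep assms c)
  then show ?thesis by (simp add: smooth_funs_def smooth_fun_def deriv_along_def)
qed

lemma smooth_funs_eqI:
  assumes "f \<in> smooth_funs" "h \<in> smooth_funs" "\<And>p c. c \<in> charts_at B p \<Longrightarrow> f p = h p"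
  shows "f = h"
proof
  fix p show "f p = h p"
    using assms by (cases "p \<in> manifold_points B") (auto simp: smooth_funs_def manifold_points_iff)
qed

lemma deriv_along_add_left:
  assumes "X \<in> vector_fields B" "Y \<in> vector_fields B" "f \<in> smooth_funs"
  shows "deriv_along (X + Y) f = deriv_along X f + deriv_along Y f"
proof (rule smooth_funs_eqI)
  fix p c assume c: "c \<in> charts_at B p"
  show "deriv_along (X + Y) f p = (deriv_along X f + deriv_along Y f) p"
    using linear_add[OF dd_linear[OF smooth_funs_rep_differentiable[OF assms(3) c]]] assms c
    by (simp add: deriv_along_chart vector_fields_add)
qed (use assms in \<open>auto intro!: deriv_along_closed vector_fields_add smooth_funs_add\<close>)

lemma deriv_along_add_right:
  assumes "X \<in> vector_fields B" "f \<in> smooth_funs" "h \<in> smooth_funs"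
  shows "deriv_along X (f + h) = deriv_along X f + deriv_along X h"
proof (rule smooth_funs_eqI)
  fix p c assume c: "c \<in> charts_at B p"
  have "dd ((f + h) \<circ> chart_inv c) (snd c p) v
      = dd (f \<circ> chart_inv c) (snd c p) v + dd (h \<circ> chart_inv c) (snd c p) v" for v
    using has_derivative_add[OF dd_works[OF smooth_funs_rep_differentiable[OF assms(2) c]]
        dd_works[OF smooth_funs_rep_differentiable[OF assms(3) c]]]
    by (simp add: dd_eqI o_def)
  then show "deriv_along X (f + h) p = (deriv_along X f + deriv_along X h) p"
    using assms c by (simp add: deriv_along_chart smooth_funs_add)
qed (use assms in \<open>auto intro!: deriv_along_closed smooth_funs_add\<close>)

lemma deriv_along_lie_bracket:
  assumes X: "X \<in> vector_fields B" and Y: "Y \<in> vector_fields B" and f: "f \<in> smooth_funs"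
  shows "deriv_along (lie_bracket B X Y) f
    = deriv_along X (deriv_along Y f) - deriv_along Y (deriv_along X f)"
proof (rule smooth_funs_eqI)
  fix p c assume c: "c \<in> charts_at B p"
  have cB: "c \<in> B" and p: "p \<in> fst c" using c by (auto simp: charts_at_iff)
  let ?S = "snd c ` fst c" and ?z = "snd c p"
  have S: "open ?S" "?z \<in> ?S" using open_chart_image[OF cB] p by auto
  have *: "deriv_along X (deriv_along Y f) p
      = dd (\<lambda>z. dd (f \<circ> chart_inv c) z (rep Y c z)) ?z (rep X c ?z)"
    if X: "X \<in> vector_fields B" and Y: "Y \<in> vector_fields B" for X Y
    using deriv_along_chart[OF X deriv_along_closed[OF Y f] c]
      dd_cong[OF S, of "deriv_along Y f \<circ> chart_inv c" _ "rep X c ?z", OF deriv_along_rep[OF Y f cB]] cB p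
    by simp
  show "deriv_along (lie_bracket B X Y) f p
    = (deriv_along X (deriv_along Y f) - deriv_along Y (deriv_along X f)) p"
    using dd_commutator[OF S smooth_funs_rep[OF f cB] vector_fields_rep[OF X cB] vector_fields_rep[OF Y cB]]
      deriv_along_chart[OF lie_bracket_closed[OF X Y] f c] cB p
    by (simp add: *[OF X Y] *[OF Y X] lie_bracket_chart[OF X Y c])
next
  show "deriv_along X (deriv_along Y f) - deriv_along Y (deriv_along X f) \<in> smooth_funs"
    using X Y f smooth_funs_add[OF _ smooth_funs_minus, of "deriv_along X (deriv_along Y f)"]
    by (simp add: deriv_along_closed)
qed (use assms in \<open>auto intro!: deriv_along_closed lie_bracket_closed\<close>)

end

section \<open>The derivative of a map as a function of base point and direction\<close>

lemma dd_compose_fst: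
  assumes "k differentiable (at (fst p))"
  shows "dd (\<lambda>p. k (fst p)) p v = dd k (fst p) (fst v)"
proof -
  have "dd fst p v = fst v" by (rule dd_eqI) (auto intro!: derivative_eq_intros)
  moreover have "fst differentiable (at p)"
    by (rule differentiableI) (rule bounded_linear_imp_has_derivative[OF bounded_linear_fst])
  ultimately show ?thesis using dd_compose[of fst p k v] assms by simp
qed

text \<open>The value at (z, y) is the derivative of the map p to f (fst p) along the smooth field
  (snd p, 0). This reduces both claims to the calculus of derivatives along fields.\<close>

lemma smooth_on_dd_pair:
  assumes "open S" "smooth_on S f" "open U" "fst ` U \<subseteq> S"
  shows "smooth_on U (\<lambda>p. dd f (fst p) (snd p))"
    and "(z, y) \<in> U \<Longrightarrow> dd (\<lambda>p. dd f (fst p) (snd p)) (z, y) (h, w)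
      = dd (\<lambda>x. dd f x y) z h + dd f z w"
proof -
  have diff: "f differentiable (at (fst p))" if "p \<in> U" for p
    using smooth_on_differentiable[OF assms(1,2)] assms(4) that by blast
  have F: "smooth_on U (\<lambda>p. f (fst p))"
    by (rule smooth_on_compose[OF assms(3,1,4) smooth_on_fst[OF smooth_on_id] assms(2)])
  have V: "smooth_on U (\<lambda>p::'a \<times> 'a. (snd p, 0::'a))"
    by (intro smooth_on_Pair smooth_on_snd smooth_on_id smooth_on_const)
  have eq: "dd (\<lambda>p. f (fst p)) p (snd p, 0) = dd f (fst p) (snd p)" if "p \<in> U" for p
    using dd_compose_fst[OF diff[OF that], of "(snd p, 0)"] by simp
  show "smooth_on U (\<lambda>p. dd f (fst p) (snd p))"
    by (rule smooth_on_cong[OF assms(3) eq smooth_on_dd_field[OF assms(3) F V]])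
  assume q: "(z, y) \<in> U"
  have "dd (\<lambda>p. dd f (fst p) (snd p)) (z, y) (h, w)
      = dd (\<lambda>p. dd (\<lambda>p. f (fst p)) p (snd p, 0)) (z, y) (h, w)"
    by (rule dd_cong[OF assms(3) q, symmetric]) (rule eq)
  also have "\<dots> = dd (\<lambda>p. dd (\<lambda>p. f (fst p)) p (y, 0)) (z, y) (h, w)
      + dd (\<lambda>p. f (fst p)) (z, y) (dd (\<lambda>p. (snd p, 0)) (z, y) (h, w))"
    using dd_dd_field[OF assms(3) F V q] by simp
  also have "dd (\<lambda>p. (snd p, 0)) (z, y) (h, w) = (w, 0::'a)"
    by (rule dd_eqI[of _ "\<lambda>p. (snd p, 0)", simplified, THEN trans])
      (auto intro!: derivative_eq_intros)
  also have "dd (\<lambda>p. f (fst p)) (z, y) (w, 0) = dd f z w"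
    using dd_compose_fst[OF diff[OF q]] by simp
  also have "dd (\<lambda>p. dd (\<lambda>p. f (fst p)) p (y, 0)) (z, y) (h, w) = dd (\<lambda>p. dd f (fst p) y) (z, y) (h, w)"
    by (rule dd_cong[OF assms(3) q]) (use dd_compose_fst[OF diff] in simp)
  also have "\<dots> = dd (\<lambda>x. dd f x y) z h"
    using dd_compose_fst[of "\<lambda>x. dd f x y" "(z, y)" "(h, w)"]
      smooth_on_differentiable[OF assms(1) smooth_on_dd[OF assms(1,2)]] assms(4) q by force
  finally show "dd (\<lambda>p. dd f (fst p) (snd p)) (z, y) (h, w) = dd (\<lambda>x. dd f x y) z h + dd f z w" .
qed

context atlas
begin

lemma tvec_of_linear:
  assumes c: "c \<in> charts_at B p"
  shows "tvec_of p c (x + y) = tvec_of p c x + tvec_of p c y"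
    and "tvec_of p c (r *\<^sub>R x) = r *\<^sub>R tvec_of p c x"
proof -
  note lin = dd_linear[OF transition_differentiable[OF c]]
  show "tvec_of p c (x + y) = tvec_of p c x + tvec_of p c y"
    by (rule ext) (simp add: tvec_of_def linear_add[OF lin])
  show "tvec_of p c (r *\<^sub>R x) = r *\<^sub>R tvec_of p c x"
    by (rule ext) (simp add: tvec_of_def scaleR_fun_def linear_cmul[OF lin])
qed

lemma tvec_of_vector_field_on:
  assumes c: "c \<in> B"
  shows "vector_field_on B (fst c) (\<lambda>p. tvec_of p c e)"
  unfolding vector_field_on_def
proof (intro conjI ballI)
  show "tvec_of p c e \<in> tangent_space B p" if "p \<in> fst c" for p
    using tvec_of_tangent c that by (simp add: charts_at_iff)
  fix d assume d: "d \<in> B"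
  let ?S = "snd d ` (fst c \<inter> fst d)" and ?T = "snd c ` (fst c \<inter> fst d)"
  have S: "open ?S" "open ?T"
    using open_overlap[OF d c] open_overlap[OF c d] by (simp_all add: Int_commute)
  have \<tau>: "smooth_on ?T (snd d \<circ> chart_inv c)" "smooth_on ?S (snd c \<circ> chart_inv d)"
    using smooth_transition[OF c d] smooth_transition[OF d c] by (simp_all add: Int_commute)
  have "smooth_on ?S (\<lambda>z. dd (snd d \<circ> chart_inv c) ((snd c \<circ> chart_inv d) z) e)"
    by (rule smooth_on_compose[OF S _ \<tau>(2) smooth_on_dd[OF S(2) \<tau>(1)]]) (use d in auto)
  then show "smooth_on ?S (\<lambda>z. tvec_of (chart_inv d z) c e d)"
    by (rule smooth_on_cong[OF S(1), rotated]) (use c d in \<open>auto simp: tvec_of_def charts_at_iff\<close>)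
qed

end

section \<open>The slit tangent bundle in charts\<close>

locale base_atlas = atlas A
  for A :: "('p, 'e::euclidean_space) chart set"
begin

lemma slit_bundle_iff:
  "u \<in> slit_bundle A \<longleftrightarrow> fst u \<in> manifold_points A \<and> snd u \<in> tangent_space A (fst u) \<and> snd u \<noteq> 0"
  by (auto simp: slit_bundle_def tangent_bundle_def)

lemma slit_chart_dom: "u \<in> fst (slit_chart A c) \<longleftrightarrow> u \<in> slit_bundle A \<and> fst u \<in> fst c"
  and slit_chart_map: "snd (slit_chart A c) u = (snd c (fst u), snd u c)"
  by (auto simp: slit_chart_def)

text \<open>A tangent vector that vanishes in one chart vanishes in all. Hence removing the zero
  section amounts, in every chart, to removing 0 from the second factor.\<close>

lemma slit_bundle_component_nonzero:
  "u \<in> slit_bundle A \<Longrightarrow> c \<in> charts_at A (fst u) \<Longrightarrow> snd u c \<noteq> 0"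
  using tangent_eqI[OF _ tangent_zero, of "snd u" "fst u" c] by (simp add: slit_bundle_iff) metis

lemma slit_bundle_fst_tangent: "u \<in> slit_bundle A \<Longrightarrow> snd u \<in> tangent_space A (fst u)"
  by (simp add: slit_bundle_iff)

lemma slit_chart_inj: "c \<in> A \<Longrightarrow> inj_on (snd (slit_chart A c)) (fst (slit_chart A c))"
proof (rule inj_onI)
  fix u v assume c: "c \<in> A" and u: "u \<in> fst (slit_chart A c)" and v: "v \<in> fst (slit_chart A c)"
    and eq: "snd (slit_chart A c) u = snd (slit_chart A c) v"
  have fst: "fst u = fst v"
    using inj_onD[OF inj_chart[OF c]] u v eq by (auto simp: slit_chart_dom slit_chart_map)
  have "u \<in> slit_bundle A" "v \<in> slit_bundle A" "c \<in> charts_at A (fst u)" "snd u c = snd v c"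
    using u v c eq by (simp_all add: slit_chart_dom slit_chart_map charts_at_iff)
  then have "snd u = snd v"
    using tangent_eqI[of "snd u" "fst u" "snd v" c] slit_bundle_fst_tangent[of u]
      slit_bundle_fst_tangent[of v] fst by simp
  with fst show "u = v" by (simp add: prod_eq_iff)
qed

lemma slit_point:
  assumes "c \<in> A" "z \<in> snd c ` fst c" "y \<noteq> 0"
  shows "(chart_inv c z, tvec_of (chart_inv c z) c y) \<in> fst (slit_chart A c)"
    and "snd (slit_chart A c) (chart_inv c z, tvec_of (chart_inv c z) c y) = (z, y)"
proof -
  have c: "c \<in> charts_at A (chart_inv c z)" using assms by (simp add: charts_at_iff)
  then have *: "tvec_of (chart_inv c z) c y c = y" by (rule tvec_of_self)
  then have "tvec_of (chart_inv c z) c y \<noteq> 0" using assms(3) by auto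
  moreover have "chart_inv c z \<in> manifold_points A"
    unfolding manifold_points_iff using c by blast
  ultimately show "(chart_inv c z, tvec_of (chart_inv c z) c y) \<in> fst (slit_chart A c)"
    using tvec_of_tangent[OF c] assms by (simp add: slit_chart_dom slit_bundle_iff)
  show "snd (slit_chart A c) (chart_inv c z, tvec_of (chart_inv c z) c y) = (z, y)"
    using * assms by (simp add: slit_chart_map)
qed

lemma slit_chart_overlap_image:
  assumes c: "c \<in> A" and d: "d \<in> A"
  shows "snd (slit_chart A c) ` (fst (slit_chart A c) \<inter> fst (slit_chart A d))
    = (snd c ` (fst c \<inter> fst d)) \<times> (- {0})"
proof (intro set_eqI iffI)
  fix q assume "q \<in> snd (slit_chart A c) ` (fst (slit_chart A c) \<inter> fst (slit_chart A d))"
  then obtain u where u: "u \<in> slit_bundle A" "fst u \<in> fst c" "fst u \<in> fst d"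
      "q = (snd c (fst u), snd u c)"
    unfolding image_iff Bex_def Int_iff slit_chart_dom slit_chart_map by blast
  then show "q \<in> (snd c ` (fst c \<inter> fst d)) \<times> (- {0})"
    using slit_bundle_component_nonzero[of u c] c by (simp add: charts_at_iff)
next
  fix q assume q: "q \<in> (snd c ` (fst c \<inter> fst d)) \<times> (- {0::'e})"
  then obtain z y where zy: "q = (z, y)" "z \<in> snd c ` (fst c \<inter> fst d)" "y \<noteq> 0" by auto
  let ?u = "(chart_inv c z, tvec_of (chart_inv c z) c y)"
  have z: "z \<in> snd c ` fst c" "chart_inv c z \<in> fst d" using overlap_transition[OF c zy(2)] by auto
  have "?u \<in> fst (slit_chart A c) \<inter> fst (slit_chart A d)"
    using slit_point(1)[OF c z(1) zy(3)] z by (simp add: slit_chart_dom)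
  then show "q \<in> snd (slit_chart A c) ` (fst (slit_chart A c) \<inter> fst (slit_chart A d))"
    using slit_point(2)[OF c z(1) zy(3)] zy(1) by force
qed

lemma slit_chart_image: "c \<in> A \<Longrightarrow> snd (slit_chart A c) ` fst (slit_chart A c) = (snd c ` fst c) \<times> (- {0})"
  using slit_chart_overlap_image[of c c] by simp

lemma slit_chart_inv:
  assumes "c \<in> A" "z \<in> snd c ` fst c" "y \<noteq> 0"
  shows "chart_inv (slit_chart A c) (z, y) = (chart_inv c z, tvec_of (chart_inv c z) c y)"
  using inv_into_f_f[OF slit_chart_inj[OF assms(1)] slit_point(1)[OF assms]] slit_point(2)[OF assms]
  by simp

lemma slit_transition:
  assumes c: "c \<in> A" and d: "d \<in> A" and q: "q \<in> (snd c ` (fst c \<inter> fst d)) \<times> (- {0})"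
  shows "(snd (slit_chart A d) \<circ> chart_inv (slit_chart A c)) q
    = ((snd d \<circ> chart_inv c) (fst q), dd (snd d \<circ> chart_inv c) (fst q) (snd q))"
proof -
  obtain z y where zy: "q = (z, y)" "z \<in> snd c ` (fst c \<inter> fst d)" "y \<noteq> 0" using q by auto
  then show ?thesis
    using overlap_transition[OF c zy(2)] c d
    by (simp add: slit_chart_inv slit_chart_map tvec_of_def charts_at_iff)
qed

lemma smooth_slit_transition:
  assumes c: "c \<in> A" and d: "d \<in> A"
  shows "smooth_on ((snd c ` (fst c \<inter> fst d)) \<times> (- {0}))
    (\<lambda>q. ((snd d \<circ> chart_inv c) (fst q), dd (snd d \<circ> chart_inv c) (fst q) (snd q)))"
proof -
  let ?S = "snd c ` (fst c \<inter> fst d)"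
  have S: "open ?S" "open (?S \<times> (- {0::'e}))" "fst ` (?S \<times> (- {0::'e})) \<subseteq> ?S"
    using open_overlap[OF c d] by (auto intro!: open_Times)
  show ?thesis
    by (intro smooth_on_Pair smooth_on_dd_pair(1)[OF S(1) smooth_transition[OF c d] S(2,3)]
        smooth_on_compose[OF S(2,1,3) smooth_on_fst[OF smooth_on_id] smooth_transition[OF c d]])
qed

lemma smooth_atlas_slit: "smooth_atlas (slit_atlas A)"
  unfolding smooth_atlas_def slit_atlas_def
proof (intro conjI ballI; elim imageE; hypsubst)
  fix c assume c: "c \<in> A"
  show "inj_on (snd (slit_chart A c)) (fst (slit_chart A c))" by (rule slit_chart_inj[OF c])
  show "open (snd (slit_chart A c) ` fst (slit_chart A c))"
    unfolding slit_chart_image[OF c] by (intro open_Times open_chart_image c) auto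
  fix d assume d: "d \<in> A"
  show *: "open (snd (slit_chart A c) ` (fst (slit_chart A c) \<inter> fst (slit_chart A d)))"
    unfolding slit_chart_overlap_image[OF c d] by (intro open_Times open_overlap c d) auto
  show "smooth_on (snd (slit_chart A c) ` (fst (slit_chart A c) \<inter> fst (slit_chart A d)))
      (snd (slit_chart A d) \<circ> chart_inv (slit_chart A c))"
    by (rule smooth_on_cong[OF *, rotated])
      (use slit_transition[OF c d] smooth_slit_transition[OF c d] in
        \<open>simp_all only: slit_chart_overlap_image[OF c d]\<close>)
qed

sublocale slit: atlas "slit_atlas A"
  by standard (rule smooth_atlas_slit)

lemma slit_atlas_in: "c \<in> A \<Longrightarrow> slit_chart A c \<in> slit_atlas A"
  by (simp add: slit_atlas_def)

lemma slit_charts_at: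
  "C \<in> charts_at (slit_atlas A) u \<longleftrightarrow> u \<in> slit_bundle A \<and> (\<exists>c\<in>charts_at A (fst u). C = slit_chart A c)"
proof -
  have "C \<in> charts_at (slit_atlas A) u \<longleftrightarrow> (\<exists>c. c \<in> A \<and> C = slit_chart A c \<and> u \<in> fst (slit_chart A c))"
    unfolding charts_at_def slit_atlas_def by blast
  then show ?thesis
    unfolding slit_chart_dom Bex_def charts_at_iff by blast
qed

lemma slit_chart_at: "u \<in> slit_bundle A \<Longrightarrow> c \<in> charts_at A (fst u) \<Longrightarrow> slit_chart A c \<in> charts_at (slit_atlas A) u"
  unfolding slit_charts_at by blast

lemma slit_bundle_chart: "u \<in> slit_bundle A \<Longrightarrow> \<exists>c. c \<in> charts_at A (fst u)"
  unfolding slit_bundle_iff manifold_points_iff by blast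

lemma slit_manifold_points: "manifold_points (slit_atlas A) = slit_bundle A"
  unfolding set_eq_iff slit.manifold_points_iff slit_charts_at using slit_bundle_chart by blast

text \<open>The Jacobian is block triangular; its off-diagonal block is the second derivative of the
  transition map of M.\<close>

lemma dd_slit_transition:
  assumes u: "u \<in> slit_bundle A" and c: "c \<in> charts_at A (fst u)" and d: "d \<in> charts_at A (fst u)"
  shows "dd (snd (slit_chart A d) \<circ> chart_inv (slit_chart A c)) (snd (slit_chart A c) u) e
    = (dd (snd d \<circ> chart_inv c) (snd c (fst u)) (fst e),
       dd (\<lambda>x. dd (snd d \<circ> chart_inv c) x (snd u c)) (snd c (fst u)) (fst e)
         + dd (snd d \<circ> chart_inv c) (snd c (fst u)) (snd e))"
proof -
  let ?S = "snd c ` (fst c \<inter> fst d)" and ?\<tau> = "snd d \<circ> chart_inv c"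
  have cA: "c \<in> A" "d \<in> A" using c d by (auto simp: charts_at_iff)
  have S: "open ?S" "open (?S \<times> (- {0::'e}))" "fst ` (?S \<times> (- {0::'e})) \<subseteq> ?S"
    using open_overlap[OF cA] by (auto intro!: open_Times)
  have q: "(snd c (fst u), snd u c) \<in> ?S \<times> (- {0})"
    using slit_bundle_component_nonzero[OF u c] chart_overlap_mem[OF c d] by simp
  note \<tau> = smooth_transition[OF cA]
  have "dd (snd (slit_chart A d) \<circ> chart_inv (slit_chart A c)) (snd (slit_chart A c) u) e
      = dd (\<lambda>q. (?\<tau> (fst q), dd ?\<tau> (fst q) (snd q))) (snd c (fst u), snd u c) e"
    unfolding slit_chart_map[of c u] by (rule dd_cong[OF S(2) q slit_transition[OF cA]])
  also have "\<dots> = (dd (\<lambda>q. ?\<tau> (fst q)) (snd c (fst u), snd u c) e,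
      dd (\<lambda>q. dd ?\<tau> (fst q) (snd q)) (snd c (fst u), snd u c) e)"
    by (intro dd_eqI has_derivative_Pair dd_works smooth_on_differentiable[OF S(2) _ q]
        smooth_on_compose[OF S(2,1,3) smooth_on_fst[OF smooth_on_id] \<tau>]
        smooth_on_dd_pair(1)[OF S(1) \<tau> S(2,3)])
  also have "dd (\<lambda>q. ?\<tau> (fst q)) (snd c (fst u), snd u c) e = dd ?\<tau> (snd c (fst u)) (fst e)"
    using dd_compose_fst[of ?\<tau> "(snd c (fst u), snd u c)" e] transition_differentiable[OF c d] by simp
  also have "dd (\<lambda>q. dd ?\<tau> (fst q) (snd q)) (snd c (fst u), snd u c) e
      = dd (\<lambda>x. dd ?\<tau> x (snd u c)) (snd c (fst u)) (fst e) + dd ?\<tau> (snd c (fst u)) (snd e)"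
    using smooth_on_dd_pair(2)[OF S(1) \<tau> S(2,3) q, of "fst e" "snd e"] by simp
  finally show ?thesis .
qed

text \<open>The two parts of a vector transform by the two rows of that Jacobian. When the first
  part is 0, the second transforms like a tangent vector of M, which is what identifies vertical
  vectors with lifts.\<close>

lemma slit_tangentI:
  assumes u: "u \<in> slit_bundle A"
    and out: "\<And>C. C \<notin> charts_at (slit_atlas A) u \<Longrightarrow> a C = 0"
    and h: "\<And>c d. c \<in> charts_at A (fst u) \<Longrightarrow> d \<in> charts_at A (fst u) \<Longrightarrow>
      fst (a (slit_chart A d)) = dd (snd d \<circ> chart_inv c) (snd c (fst u)) (fst (a (slit_chart A c)))"
    and v: "\<And>c d. c \<in> charts_at A (fst u) \<Longrightarrow> d \<in> charts_at A (fst u) \<Longrightarrow>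
      snd (a (slit_chart A d))
      = dd (\<lambda>x. dd (snd d \<circ> chart_inv c) x (snd u c)) (snd c (fst u)) (fst (a (slit_chart A c)))
        + dd (snd d \<circ> chart_inv c) (snd c (fst u)) (snd (a (slit_chart A c)))"
  shows "a \<in> tangent_space (slit_atlas A) u"
proof (rule slit.tangentI)
  fix C D assume "C \<in> charts_at (slit_atlas A) u" "D \<in> charts_at (slit_atlas A) u"
  then obtain c d where cd: "c \<in> charts_at A (fst u)" "C = slit_chart A c"
    "d \<in> charts_at A (fst u)" "D = slit_chart A d"
    unfolding slit_charts_at by blast
  show "a D = dd (snd D \<circ> chart_inv C) (snd C u) (a C)"
    unfolding cd dd_slit_transition[OF u cd(1,3)] using h[OF cd(1,3)] v[OF cd(1,3)]
    by (simp add: prod_eq_iff)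
qed (rule out)

lemma slit_tangent_transition:
  assumes "u \<in> slit_bundle A" "a \<in> tangent_space (slit_atlas A) u"
    "c \<in> charts_at A (fst u)" "d \<in> charts_at A (fst u)"
  shows "fst (a (slit_chart A d)) = dd (snd d \<circ> chart_inv c) (snd c (fst u)) (fst (a (slit_chart A c)))"
    and "snd (a (slit_chart A d))
      = dd (\<lambda>x. dd (snd d \<circ> chart_inv c) x (snd u c)) (snd c (fst u)) (fst (a (slit_chart A c)))
        + dd (snd d \<circ> chart_inv c) (snd c (fst u)) (snd (a (slit_chart A c)))"
  using slit.tangent_transition[OF assms(2) slit_chart_at[OF assms(1,3)] slit_chart_at[OF assms(1,4)]]
  unfolding dd_slit_transition[OF assms(1,3,4)] by simp_all

subsection \<open>The vertical lift and the projection\<close>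

lemma gamma_component:
  assumes "u \<in> slit_bundle A" "c \<in> charts_at A (fst u)"
  shows "gamma A u v (slit_chart A c) = (0, v c)"
proof -
  have "vector_derivative (\<lambda>t. (snd c (fst u), snd u c + t *\<^sub>R v c)) (at 0) = (0, v c)"
    by (rule vector_derivative_at) (auto intro!: derivative_eq_intros)
  moreover have "snd (slit_chart A c) \<circ> (\<lambda>t. (fst u, snd u + t *\<^sub>R v))
      = (\<lambda>t. (snd c (fst u), snd u c + t *\<^sub>R v c))"
    by (simp add: fun_eq_iff slit_chart_map scaleR_fun_def)
  ultimately show ?thesis
    using slit_chart_at[OF assms] by (simp add: gamma_def velocity_def)
qed

lemma gamma_outside: "C \<notin> charts_at (slit_atlas A) u \<Longrightarrow> gamma A u v C = 0"
  by (simp add: gamma_def velocity_def)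

lemma gamma_tangent:
  assumes u: "u \<in> slit_bundle A" and v: "v \<in> tangent_space A (fst u)"
  shows "gamma A u v \<in> tangent_space (slit_atlas A) u"
proof (rule slit_tangentI[OF u gamma_outside])
  fix c d assume c: "c \<in> charts_at A (fst u)" and d: "d \<in> charts_at A (fst u)"
  have "(\<lambda>x. dd (snd d \<circ> chart_inv c) x (snd u c)) differentiable (at (snd c (fst u)))"
    by (rule smooth_on_differentiable[OF open_overlap smooth_on_dd[OF open_overlap smooth_transition]
          chart_overlap_mem[OF c d]]) (use c d in \<open>auto simp: charts_at_iff\<close>)
  then show "snd (gamma A u v (slit_chart A d))
      = dd (\<lambda>x. dd (snd d \<circ> chart_inv c) x (snd u c)) (snd c (fst u)) (fst (gamma A u v (slit_chart A c)))
        + dd (snd d \<circ> chart_inv c) (snd c (fst u)) (snd (gamma A u v (slit_chart A c)))"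
    using tangent_transition[OF v c d]
    by (simp add: gamma_component[OF u c] gamma_component[OF u d] linear_0[OF dd_linear])
  show "fst (gamma A u v (slit_chart A d))
      = dd (snd d \<circ> chart_inv c) (snd c (fst u)) (fst (gamma A u v (slit_chart A c)))"
    by (simp add: gamma_component[OF u c] gamma_component[OF u d]
        linear_0[OF dd_linear[OF transition_differentiable[OF c d]]])
qed

lemma rho_component:
  assumes u: "u \<in> slit_bundle A" and a: "a \<in> tangent_space (slit_atlas A) u" and c: "c \<in> charts_at A (fst u)"
  shows "rho A u a c = fst (a (slit_chart A c))"
proof -
  have cA: "c \<in> A" using c by (simp add: charts_at_iff)
  let ?D = "snd (slit_chart A c) ` fst (slit_chart A c)"
  have D: "open ?D" "snd (slit_chart A c) u \<in> ?D"
    using slit.open_chart_image[OF slit_atlas_in[OF cA]] u c by (auto simp: slit_chart_dom charts_at_iff)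
  have eq: "(snd c \<circ> fst \<circ> chart_inv (slit_chart A c)) q = fst q" if "q \<in> ?D" for q
    using slit.chart_inv_right[of q "slit_chart A c"] that by (simp add: slit_chart_map prod_eq_iff)
  have "(fst has_derivative fst) (at (snd (slit_chart A c) u))"
    by (auto intro!: derivative_eq_intros)
  then have der: "((snd c \<circ> fst \<circ> chart_inv (slit_chart A c)) has_derivative fst) (at (snd (slit_chart A c) u))"
    by (rule has_derivative_transform_within_open[OF _ D]) (simp only: eq)
  have "dir_deriv (slit_atlas A) u a (snd c \<circ> fst) = fst (a (slit_chart A c))"
    using slit.dir_deriv_chart[OF slit_chart_at[OF u c] a differentiableI[OF der]] dd_eqI[OF der] by simp
  then show ?thesis using c by (simp add: rho_def differential_def)
qed

lemma rho_tangent: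
  assumes u: "u \<in> slit_bundle A" and a: "a \<in> tangent_space (slit_atlas A) u"
  shows "rho A u a \<in> tangent_space A (fst u)"
proof (rule tangentI)
  show "rho A u a c = 0" if "c \<notin> charts_at A (fst u)" for c
    using that by (simp add: rho_def differential_def)
next
  fix c d assume c: "c \<in> charts_at A (fst u)" and d: "d \<in> charts_at A (fst u)"
  show "rho A u a d = dd (snd d \<circ> chart_inv c) (snd c (fst u)) (rho A u a c)"
    unfolding rho_component[OF u a c] rho_component[OF u a d]
    by (rule slit_tangent_transition(1)[OF u a c d])
qed

lemma rho_outside: "c \<notin> charts_at A (fst u) \<Longrightarrow> rho A u a c = 0"
  by (simp add: rho_def differential_def)

lemma rho_add:
  assumes "u \<in> slit_bundle A" "a \<in> tangent_space (slit_atlas A) u" "b \<in> tangent_space (slit_atlas A) u"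
  shows "rho A u (a + b) = rho A u a + rho A u b"
proof
  fix c show "rho A u (a + b) c = (rho A u a + rho A u b) c"
    using assms slit.tangent_add[OF assms(2,3)]
    by (cases "c \<in> charts_at A (fst u)") (simp_all add: rho_component rho_outside)
qed

end

context base_atlas
begin

section \<open>Sections of the pullback bundle\<close>

abbreviation dom :: "('p, 'e) chart \<Rightarrow> ('e \<times> 'e) set"
  where "dom c \<equiv> snd (slit_chart A c) ` fst (slit_chart A c)"

abbreviation prep :: "('p, 'e) pfield \<Rightarrow> ('p, 'e) chart \<Rightarrow> 'e \<times> 'e \<Rightarrow> 'e"
  where "prep X c \<equiv> \<lambda>q. X (chart_inv (slit_chart A c) q) c"

lemma open_dom: "c \<in> A \<Longrightarrow> open (dom c)"
  by (rule slit.open_chart_image[OF slit_atlas_in])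

lemma dom_inv:
  assumes "c \<in> A" "q \<in> dom c"
  shows "chart_inv (slit_chart A c) q \<in> slit_bundle A"
    and "c \<in> charts_at A (fst (chart_inv (slit_chart A c) q))"
    and "snd (slit_chart A c) (chart_inv (slit_chart A c) q) = q"
  using slit.chart_inv_in[OF assms(2)] slit.chart_inv_right[OF assms(2)] assms(1)
  unfolding slit_chart_dom charts_at_iff by blast+

lemma slit_chart_in:
  assumes "u \<in> slit_bundle A" "c \<in> charts_at A (fst u)"
  shows "c \<in> A" "u \<in> fst (slit_chart A c)" "snd (slit_chart A c) u \<in> dom c"
    "chart_inv (slit_chart A c) (snd (slit_chart A c) u) = u"
proof -
  show c: "c \<in> A" and u: "u \<in> fst (slit_chart A c)"
    using assms by (simp_all add: slit_chart_dom charts_at_iff)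
  then show "snd (slit_chart A c) u \<in> dom c"
    "chart_inv (slit_chart A c) (snd (slit_chart A c) u) = u"
    using slit.chart_inv_left[OF slit_atlas_in] by auto
qed

lemma slit_Int_chart: "slit_bundle A \<inter> fst (slit_chart A c) = fst (slit_chart A c)"
  by (auto simp: slit_chart_dom)

lemma pi_fieldsI:
  assumes "\<And>u. u \<in> slit_bundle A \<Longrightarrow> X u \<in> tangent_space A (fst u)"
    and "\<And>u. u \<notin> slit_bundle A \<Longrightarrow> X u = 0"
    and "\<And>c. c \<in> A \<Longrightarrow> smooth_on (dom c) (prep X c)"
  shows "X \<in> pi_fields A"
  using assms unfolding pi_fields_def pi_field_on_def slit_Int_chart by blast

lemma pi_fields_outside: "X \<in> pi_fields A \<Longrightarrow> u \<notin> slit_bundle A \<Longrightarrow> X u = 0"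
  unfolding pi_fields_def by blast

lemma pi_fields_tangent: "X \<in> pi_fields A \<Longrightarrow> X u \<in> tangent_space A (fst u)"
  using tangent_zero[of "fst u"] pi_fields_outside[of X u]
  by (cases "u \<in> slit_bundle A") (simp_all add: pi_fields_def pi_field_on_def)

lemma pi_fields_rep: "X \<in> pi_fields A \<Longrightarrow> c \<in> A \<Longrightarrow> smooth_on (dom c) (prep X c)"
  unfolding pi_fields_def pi_field_on_def slit_Int_chart by blast

lemma pi_fields_rep_differentiable:
  assumes "X \<in> pi_fields A" "u \<in> slit_bundle A" "c \<in> charts_at A (fst u)"
  shows "prep X c differentiable (at (snd (slit_chart A c) u))"
  using slit_chart_in[OF assms(2,3)] smooth_on_differentiable[OF open_dom pi_fields_rep[OF assms(1)]]
  by blast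

lemma pi_fields_eqI:
  assumes "X \<in> pi_fields A" "Y \<in> pi_fields A"
    and "\<And>u c. u \<in> slit_bundle A \<Longrightarrow> c \<in> charts_at A (fst u) \<Longrightarrow> X u c = Y u c"
  shows "X = Y"
proof
  fix u show "X u = Y u"
  proof (cases "u \<in> slit_bundle A")
    case True
    then obtain c where "c \<in> charts_at A (fst u)" using slit_bundle_chart by blast
    then show ?thesis
      using tangent_eqI[OF pi_fields_tangent[OF assms(1)] pi_fields_tangent[OF assms(2)]] assms(3) True
      by blast
  qed (simp add: pi_fields_outside assms)
qed

lemma pi_fields_zero: "0 \<in> pi_fields A"
  by (rule pi_fieldsI) (auto simp: tangent_zero)

lemma pi_fields_add:
  assumes X: "X \<in> pi_fields A" and Y: "Y \<in> pi_fields A"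
  shows "X + Y \<in> pi_fields A"
proof (rule pi_fieldsI)
  show "(X + Y) u \<in> tangent_space A (fst u)" for u
    using tangent_add[OF pi_fields_tangent[OF X] pi_fields_tangent[OF Y]] by simp
qed (simp_all add: smooth_on_add pi_fields_rep X Y pi_fields_outside zero_fun_def plus_fun_def)

lemma pi_fields_minus:
  assumes X: "X \<in> pi_fields A"
  shows "- X \<in> pi_fields A"
proof (rule pi_fieldsI)
  show "(- X) u \<in> tangent_space A (fst u)" for u
    using tangent_minus[OF pi_fields_tangent[OF X]] by simp
qed (simp_all add: smooth_on_minus pi_fields_rep X pi_fields_outside zero_fun_def fun_Compl_def)

lemma slit_vector_field_eqI:
  assumes "a \<in> vector_fields (slit_atlas A)" "b \<in> vector_fields (slit_atlas A)"
    and "\<And>u c. u \<in> slit_bundle A \<Longrightarrow> c \<in> charts_at A (fst u) \<Longrightarrow>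
      a u (slit_chart A c) = b u (slit_chart A c)"
  shows "a = b"
  by (rule slit.vector_field_eqI[OF assms(1,2)]) (use assms(3) in \<open>unfold slit_charts_at, blast\<close>)

lemma slit_vector_fieldsI:
  assumes "\<And>u. u \<in> slit_bundle A \<Longrightarrow> a u \<in> tangent_space (slit_atlas A) u"
    and "\<And>u. u \<notin> slit_bundle A \<Longrightarrow> a u = 0"
    and "\<And>c. c \<in> A \<Longrightarrow> smooth_on (dom c) (slit.rep a (slit_chart A c))"
  shows "a \<in> vector_fields (slit_atlas A)"
proof (rule slit.vector_fieldsI)
  fix C assume "C \<in> slit_atlas A"
  then obtain c where "c \<in> A" "C = slit_chart A c" unfolding slit_atlas_def by blast
  then show "smooth_on (snd C ` fst C) (slit.rep a C)" using assms(3) by blast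
qed (simp_all add: slit_manifold_points assms(1,2))

lemma gamma_field_component:
  "u \<in> slit_bundle A \<Longrightarrow> c \<in> charts_at A (fst u) \<Longrightarrow> gamma_field A X u (slit_chart A c) = (0, X u c)"
  by (simp add: gamma_field_def gamma_component)

lemma gamma_field_closed: "X \<in> pi_fields A \<Longrightarrow> gamma_field A X \<in> vector_fields (slit_atlas A)"
proof (rule slit_vector_fieldsI)
  assume X: "X \<in> pi_fields A"
  show "gamma_field A X u \<in> tangent_space (slit_atlas A) u" if "u \<in> slit_bundle A" for u
    using that by (simp add: gamma_field_def gamma_tangent pi_fields_tangent[OF X])
  show "smooth_on (dom c) (slit.rep (gamma_field A X) (slit_chart A c))" if c: "c \<in> A" for c
    by (rule smooth_on_cong[OF open_dom[OF c] _ smooth_on_Pair[OF smooth_on_const pi_fields_rep[OF X c]]])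
      (simp add: gamma_field_component dom_inv[OF c])
qed (simp add: gamma_field_def)

lemma gamma_field_add:
  assumes "X \<in> pi_fields A" "Y \<in> pi_fields A"
  shows "gamma_field A (X + Y) = gamma_field A X + gamma_field A Y"
  by (rule slit_vector_field_eqI)
    (simp_all add: gamma_field_closed slit.vector_fields_add pi_fields_add assms gamma_field_component)

lemma rho_field_component:
  "a \<in> vector_fields (slit_atlas A) \<Longrightarrow> u \<in> slit_bundle A \<Longrightarrow> c \<in> charts_at A (fst u) \<Longrightarrow>
    rho_field A a u c = fst (a u (slit_chart A c))"
  by (simp add: rho_field_def rho_component slit.vector_fields_tangent)

lemma rho_field_rep:
  "a \<in> vector_fields (slit_atlas A) \<Longrightarrow> c \<in> A \<Longrightarrow> q \<in> dom c \<Longrightarrow>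
    prep (rho_field A a) c q = fst (slit.rep a (slit_chart A c) q)"
  by (simp add: rho_field_component dom_inv)

lemma rho_field_closed:
  assumes a: "a \<in> vector_fields (slit_atlas A)"
  shows "rho_field A a \<in> pi_fields A"
proof (rule pi_fieldsI)
  show "rho_field A a u \<in> tangent_space A (fst u)" if "u \<in> slit_bundle A" for u
    using that by (simp add: rho_field_def rho_tangent slit.vector_fields_tangent[OF a])
  show "smooth_on (dom c) (prep (rho_field A a) c)" if c: "c \<in> A" for c
    by (rule smooth_on_cong[OF open_dom[OF c] rho_field_rep[OF a c, symmetric]
          smooth_on_fst[OF slit.vector_fields_rep[OF a slit_atlas_in[OF c]]]])
qed (simp add: rho_field_def)

lemma rho_field_add:
  assumes "a \<in> vector_fields (slit_atlas A)" "b \<in> vector_fields (slit_atlas A)"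
  shows "rho_field A (a + b) = rho_field A a + rho_field A b"
  by (rule pi_fields_eqI)
    (simp_all add: rho_field_closed slit.vector_fields_add pi_fields_add assms rho_field_component)

lemma rho_gamma_field: "X \<in> pi_fields A \<Longrightarrow> rho_field A (gamma_field A X) = 0"
  by (rule pi_fields_eqI)
    (simp_all add: rho_field_closed gamma_field_closed pi_fields_zero rho_field_component gamma_field_component)

text \<open>The lifted field is read off from the second components. They transform without the
  second-derivative correction because the first components vanish.\<close>

lemma ker_rho_field:
  assumes a: "a \<in> vector_fields (slit_atlas A)" and "rho_field A a = 0"
  shows "\<exists>X\<in>pi_fields A. a = gamma_field A X"
proof -
  define X where "X u = (\<lambda>c. if u \<in> slit_bundle A \<and> c \<in> charts_at A (fst u)
    then snd (a u (slit_chart A c)) else 0)" for u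
  have fst: "fst (a u (slit_chart A c)) = 0" if "u \<in> slit_bundle A" "c \<in> charts_at A (fst u)" for u c
    using rho_field_component[OF a that] assms(2) by simp
  have X: "X \<in> pi_fields A"
  proof (rule pi_fieldsI)
    fix u assume u: "u \<in> slit_bundle A"
    show "X u \<in> tangent_space A (fst u)"
    proof (rule tangentI)
      fix c d assume c: "c \<in> charts_at A (fst u)" and d: "d \<in> charts_at A (fst u)"
      have "(\<lambda>x. dd (snd d \<circ> chart_inv c) x (snd u c)) differentiable (at (snd c (fst u)))"
        by (rule smooth_on_differentiable[OF open_overlap smooth_on_dd[OF open_overlap smooth_transition]
              chart_overlap_mem[OF c d]]) (use c d in \<open>simp_all add: charts_at_iff\<close>)
      then show "X u d = dd (snd d \<circ> chart_inv c) (snd c (fst u)) (X u c)"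
        using slit_tangent_transition(2)[OF u slit.vector_fields_tangent[OF a] c d] u c d
        by (simp add: X_def fst linear_0[OF dd_linear])
    qed (simp add: X_def)
  next
    fix c assume c: "c \<in> A"
    show "smooth_on (dom c) (prep X c)"
      by (rule smooth_on_cong[OF open_dom[OF c] _
            smooth_on_snd[OF slit.vector_fields_rep[OF a slit_atlas_in[OF c]]]])
        (simp add: X_def dom_inv[OF c])
  qed (simp add: X_def fun_eq_iff)
  moreover have "a = gamma_field A X"
    by (rule slit_vector_field_eqI[OF a gamma_field_closed[OF X]])
      (simp add: gamma_field_component prod_eq_iff fst, simp add: X_def)
  ultimately show ?thesis by blast
qed

lemma eta_closed: "eta A \<in> pi_fields A"
proof (rule pi_fieldsI)
  show "smooth_on (dom c) (prep (eta A) c)" if c: "c \<in> A" for c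
  proof (rule smooth_on_cong[OF open_dom[OF c] _ smooth_on_snd[OF smooth_on_id]])
    fix q assume "q \<in> dom c"
    from dom_inv[OF c this] show "snd q = prep (eta A) c q"
      by (simp add: eta_def slit_chart_map prod_eq_iff)
  qed
qed (simp_all add: eta_def slit_bundle_fst_tangent)

text \<open>The other half of the bracket is 0, since \<gamma>X has first component 0 everywhere. So
  in a chart the projected bracket differentiates the components of \<rho>a along the fibre, and
  depends on a only through \<rho>a.\<close>

lemma rho_bracket_gamma:
  assumes X: "X \<in> pi_fields A" and a: "a \<in> vector_fields (slit_atlas A)"
    and u: "u \<in> slit_bundle A" and c: "c \<in> charts_at A (fst u)"
  shows "rho_field A (lie_bracket (slit_atlas A) (gamma_field A X) a) u c
    = dd (prep (rho_field A a) c) (snd (slit_chart A c) u) (0, X u c)"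
proof -
  let ?q = "snd (slit_chart A c) u" and ?C = "slit_chart A c"
  note sc = slit_chart_in[OF u c]
  note gX = gamma_field_closed[OF X] and C = slit_chart_at[OF u c]
  have "fst (dd (slit.rep a ?C) ?q (0, X u c)) = dd (\<lambda>q. fst (slit.rep a ?C q)) ?q (0, X u c)"
    by (rule dd_bounded_linear[OF bounded_linear_fst slit.vector_fields_rep_differentiable[OF a C], symmetric])
  also have "\<dots> = dd (prep (rho_field A a) c) ?q (0, X u c)"
    by (rule dd_cong[OF open_dom[OF sc(1)] sc(3) rho_field_rep[OF a sc(1), symmetric]])
  finally have 1: "fst (dd (slit.rep a ?C) ?q (0, X u c)) = dd (prep (rho_field A a) c) ?q (0, X u c)" .
  have "fst (dd (slit.rep (gamma_field A X) ?C) ?q v) = dd (\<lambda>q. fst (slit.rep (gamma_field A X) ?C q)) ?q v" for v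
    by (rule dd_bounded_linear[OF bounded_linear_fst slit.vector_fields_rep_differentiable[OF gX C], symmetric])
  moreover have "dd (\<lambda>q. fst (slit.rep (gamma_field A X) ?C q)) ?q v = dd (\<lambda>q. 0) ?q v" for v
    by (rule dd_cong[OF open_dom[OF sc(1)] sc(3)]) (simp add: gamma_field_component dom_inv[OF sc(1)])
  moreover have "dd (\<lambda>q. 0 :: 'e) ?q v = 0" for v
    by (rule dd_eqI) simp
  ultimately have 2: "fst (dd (slit.rep (gamma_field A X) ?C) ?q v) = 0" for v by metis
  show ?thesis
    using 1 2
    by (simp add: rho_field_component[OF slit.lie_bracket_closed[OF gX a] u c]
        slit.lie_bracket_chart[OF gX a C] gamma_field_component[OF u c])
qed

lemma rho_bracket_gamma_gamma:
  assumes "X \<in> pi_fields A" "Y \<in> pi_fields A"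
  shows "rho_field A (lie_bracket (slit_atlas A) (gamma_field A X) (gamma_field A Y)) = 0"
proof (rule pi_fields_eqI[OF rho_field_closed pi_fields_zero])
  fix u c assume u: "u \<in> slit_bundle A" and c: "c \<in> charts_at A (fst u)"
  have "dd (\<lambda>q. 0 :: 'e) (snd (slit_chart A c) u) v = 0" for v :: "'e \<times> 'e"
    by (rule dd_eqI) simp
  then show "rho_field A (lie_bracket (slit_atlas A) (gamma_field A X) (gamma_field A Y)) u c = 0 u c"
    by (simp add: rho_bracket_gamma[OF assms(1) gamma_field_closed[OF assms(2)] u c] rho_gamma_field[OF assms(2)])
qed (intro slit.lie_bracket_closed gamma_field_closed assms)

text \<open>In a chart \<eta> is the fibre coordinate, whose derivative along the fibre is the
  identity.\<close>

lemma rho_bracket_gamma_eta: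
  assumes X: "X \<in> pi_fields A" and a: "a \<in> vector_fields (slit_atlas A)" and "rho_field A a = eta A"
  shows "rho_field A (lie_bracket (slit_atlas A) (gamma_field A X) a) = X"
proof (rule pi_fields_eqI[OF rho_field_closed X])
  fix u c assume u: "u \<in> slit_bundle A" and c: "c \<in> charts_at A (fst u)"
  note sc = slit_chart_in[OF u c]
  have "dd (prep (eta A) c) (snd (slit_chart A c) u) (0, X u c) = dd snd (snd (slit_chart A c) u) (0, X u c)"
  proof (rule dd_cong[OF open_dom[OF sc(1)] sc(3)])
    fix q assume "q \<in> dom c"
    from dom_inv[OF sc(1) this] show "prep (eta A) c q = snd q"
      by (simp add: eta_def slit_chart_map prod_eq_iff)
  qed
  also have "\<dots> = X u c"
    by (subst dd_eqI[OF bounded_linear_imp_has_derivative[OF bounded_linear_snd]]) simp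
  finally show "rho_field A (lie_bracket (slit_atlas A) (gamma_field A X) a) u c = X u c"
    by (simp add: rho_bracket_gamma[OF X a u c] assms(3))
qed (intro slit.lie_bracket_closed gamma_field_closed X a)

end

section \<open>Regular connections\<close>

locale regular_pullback_connection = base_atlas A
  for A :: "('p, 'e::euclidean_space) chart set" +
  fixes D :: "('p, 'e) pconn"
  assumes regular: "regular_connection A D"
begin

lemma linear_conn: "linear_connection A D"
  using regular unfolding regular_connection_def by blast

lemma D_tangent:
  "u \<in> slit_bundle A \<Longrightarrow> a \<in> tangent_space (slit_atlas A) u \<Longrightarrow> Y \<in> pi_fields A \<Longrightarrow>
    D u a Y \<in> tangent_space A (fst u)"
  and D_add_vec: "u \<in> slit_bundle A \<Longrightarrow> a \<in> tangent_space (slit_atlas A) u \<Longrightarrow>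
    b \<in> tangent_space (slit_atlas A) u \<Longrightarrow> Y \<in> pi_fields A \<Longrightarrow> D u (a + b) Y = D u a Y + D u b Y"
  and D_scale_vec: "u \<in> slit_bundle A \<Longrightarrow> a \<in> tangent_space (slit_atlas A) u \<Longrightarrow> Y \<in> pi_fields A \<Longrightarrow>
    D u (r *\<^sub>R a) Y = r *\<^sub>R D u a Y"
  and D_add_section: "u \<in> slit_bundle A \<Longrightarrow> a \<in> tangent_space (slit_atlas A) u \<Longrightarrow> Y \<in> pi_fields A \<Longrightarrow>
    Z \<in> pi_fields A \<Longrightarrow> D u a (Y + Z) = D u a Y + D u a Z"
  and D_smooth: "Y \<in> pi_fields A \<Longrightarrow> openin (manifold_topology (slit_atlas A)) W \<Longrightarrow>
    vector_field_on (slit_atlas A) W X \<Longrightarrow> pi_field_on A W (\<lambda>u. D u (X u) Y)"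
  using linear_conn unfolding linear_connection_def by simp_all

lemma horizontal_iff:
  "a \<in> horizontal_space A D u \<longleftrightarrow> a \<in> tangent_space (slit_atlas A) u \<and> D u a (eta A) = 0"
  by (simp add: horizontal_space_def conn_map_def)

lemma rho_horizontal_inj:
  assumes u: "u \<in> slit_bundle A" and a: "a \<in> horizontal_space A D u" and b: "b \<in> horizontal_space A D u"
    and eq: "rho A u a = rho A u b"
  shows "a = b"
proof -
  have T: "a \<in> tangent_space (slit_atlas A) u" "b \<in> tangent_space (slit_atlas A) u"
    "a - b \<in> tangent_space (slit_atlas A) u"
    using a b slit.tangent_diff by (auto simp: horizontal_iff)
  have "rho A u (a - b) = 0" using rho_add[OF u T(3,2)] eq by simp
  moreover have "D u (a - b) (eta A) = 0"
    using D_add_vec[OF u T(3,2) eta_closed] a b by (simp add: horizontal_iff)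
  ultimately have "a - b \<in> vertical_space A u \<inter> horizontal_space A D u"
    using T(3) by (simp add: vertical_space_def horizontal_iff)
  then show ?thesis using regular u unfolding regular_connection_def by auto
qed

lemma rho_horizontal_surj:
  assumes u: "u \<in> slit_bundle A" and v: "v \<in> tangent_space A (fst u)"
  shows "v \<in> rho A u ` horizontal_space A D u"
proof -
  obtain c where c: "c \<in> charts_at A (fst u)" using slit_bundle_chart[OF u] by blast
  \<comment> \<open>Any lift of v would do; its vertical part is discarded afterwards.\<close>
  define a where "a = slit.tvec_of u (slit_chart A c) (v c, 0)"
  have a: "a \<in> tangent_space (slit_atlas A) u"
    unfolding a_def by (rule slit.tvec_of_tangent[OF slit_chart_at[OF u c]])
  have "rho A u a c = v c"
    using rho_component[OF u a c] slit.tvec_of_self[OF slit_chart_at[OF u c]] by (simp add: a_def)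
  then have va: "rho A u a = v" by (rule tangent_eqI[OF rho_tangent[OF u a] v c])
  have "a \<in> {a + b | a b. a \<in> vertical_space A u \<and> b \<in> horizontal_space A D u}"
    using a regular u unfolding regular_connection_def by blast
  then obtain w h where wh: "a = w + h" "w \<in> vertical_space A u" "h \<in> horizontal_space A D u" by blast
  then have "rho A u h = v"
    using rho_add[OF u, of w h] va by (simp add: vertical_space_def horizontal_iff)
  then show ?thesis using wh(3) by blast
qed

lemma beta:
  assumes u: "u \<in> slit_bundle A" and v: "v \<in> tangent_space A (fst u)"
  shows "beta A D u v \<in> tangent_space (slit_atlas A) u" "D u (beta A D u v) (eta A) = 0"
    "rho A u (beta A D u v) = v"
  using inv_into_into[OF rho_horizontal_surj[OF assms]] f_inv_into_f[OF rho_horizontal_surj[OF assms]]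
  by (simp_all add: beta_def horizontal_iff)

lemma beta_unique:
  assumes u: "u \<in> slit_bundle A" and a: "a \<in> tangent_space (slit_atlas A) u" "D u a (eta A) = 0"
  shows "beta A D u (rho A u a) = a"
  using rho_horizontal_inj[OF u, of "beta A D u (rho A u a)" a] beta[OF u rho_tangent[OF u a(1)]] a
  by (simp add: horizontal_iff)

lemma beta_add:
  assumes u: "u \<in> slit_bundle A" and v: "v \<in> tangent_space A (fst u)" and w: "w \<in> tangent_space A (fst u)"
  shows "beta A D u (v + w) = beta A D u v + beta A D u w"
  using beta_unique[OF u slit.tangent_add[OF beta(1)[OF u v] beta(1)[OF u w]]]
    rho_add[OF u beta(1)[OF u v] beta(1)[OF u w]]
    D_add_vec[OF u beta(1)[OF u v] beta(1)[OF u w] eta_closed] beta[OF u v] beta[OF u w]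
  by simp

text \<open>In a chart \<beta>X is (X, v), where v is determined by K(0, v) = - K(X, 0). Regularity
  makes the map v to K(0, v) injective, and its coefficients are smooth, so v is smooth by
  \<open>smooth_on_linear_solution\<close>.\<close>

lemma beta_field_smooth:
  assumes X: "X \<in> pi_fields A" and c: "c \<in> A"
  shows "smooth_on (dom c) (slit.rep (beta_field A D X) (slit_chart A c))"
proof -
  let ?C = "slit_chart A c"
  note S = open_dom[OF c] and CB = slit_atlas_in[OF c]
  \<comment> \<open>The connection map K in the chart, as a linear map of coordinate
    vectors.\<close>
  define \<kappa> where "\<kappa> q e = D (chart_inv ?C q) (slit.tvec_of (chart_inv ?C q) ?C e) (eta A) c" for q e
  have at: "chart_inv ?C q \<in> slit_bundle A" "?C \<in> charts_at (slit_atlas A) (chart_inv ?C q)"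
    "c \<in> charts_at A (fst (chart_inv ?C q))" if "q \<in> dom c" for q
    using dom_inv[OF c that] slit_chart_at by blast+
  have lin: "linear (\<kappa> q)" if "q \<in> dom c" for q
  proof (rule linearI)
    note t = slit.tvec_of_tangent[OF at(2)[OF that]] and l = slit.tvec_of_linear[OF at(2)[OF that]]
    show "\<kappa> q (x + y) = \<kappa> q x + \<kappa> q y" for x y
      by (simp add: \<kappa>_def l D_add_vec[OF at(1)[OF that] t t eta_closed])
    show "\<kappa> q (r *\<^sub>R x) = r *\<^sub>R \<kappa> q x" for r x
      unfolding \<kappa>_def l D_scale_vec[OF at(1)[OF that] t eta_closed] by (simp add: scaleR_fun_def)
  qed
  have smooth: "smooth_on (dom c) (\<lambda>q. \<kappa> q e)" for e
  proof -
    have "pi_field_on A (fst ?C) (\<lambda>u. D u (slit.tvec_of u ?C e) (eta A))"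
      by (rule D_smooth[OF eta_closed slit.openin_chart_domain[OF CB] slit.tvec_of_vector_field_on[OF CB]])
    then have "smooth_on (snd ?C ` (fst ?C \<inter> fst ?C)) (\<lambda>q. \<kappa> q e)"
      unfolding \<kappa>_def pi_field_on_def using c by blast
    then show ?thesis by simp
  qed
  have K: "D (chart_inv ?C q) a (eta A) c = \<kappa> q (a ?C)"
    if "q \<in> dom c" "a \<in> tangent_space (slit_atlas A) (chart_inv ?C q)" for q a
    using slit.tvec_of_eq[OF that(2) at(2)[OF that(1)]] by (simp add: \<kappa>_def)
  \<comment> \<open>A vector (0, v) in the kernel of K is both vertical and horizontal.\<close>
  have inj: "inj (\<lambda>v. \<kappa> q (0, v))" if q: "q \<in> dom c" for q
  proof (rule linear_injective_0[THEN iffD2, rule_format])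
    show "linear (\<lambda>v. \<kappa> q (0, v))"
      using linear_compose[OF _ lin[OF q], of "\<lambda>v. (0, v)"] by (simp add: o_def linear_iff)
    fix v assume v: "\<kappa> q (0, v) = 0"
    define a where "a = slit.tvec_of (chart_inv ?C q) ?C (0, v)"
    have a: "a \<in> tangent_space (slit_atlas A) (chart_inv ?C q)" "a ?C = (0, v)"
      unfolding a_def using slit.tvec_of_tangent[OF at(2)[OF q]] slit.tvec_of_self[OF at(2)[OF q]] by simp_all
    have "D (chart_inv ?C q) a (eta A) = 0"
      by (rule tangent_eqI[OF D_tangent[OF at(1)[OF q] a(1) eta_closed] tangent_zero at(3)[OF q]])
        (simp add: K[OF q a(1)] a(2) v)
    moreover have "rho A (chart_inv ?C q) a = 0"
      by (rule tangent_eqI[OF rho_tangent[OF at(1)[OF q] a(1)] tangent_zero at(3)[OF q]])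
        (simp add: rho_component[OF at(1)[OF q] a(1) at(3)[OF q]] a(2))
    ultimately have "a \<in> vertical_space A (chart_inv ?C q) \<inter> horizontal_space A D (chart_inv ?C q)"
      using a(1) by (simp add: vertical_space_def horizontal_iff)
    then have "a = 0" using regular at(1)[OF q] unfolding regular_connection_def by blast
    then show "v = 0" using a(2) by (simp add: zero_prod_def)
  qed
  define b where "b q = beta_field A D X (chart_inv ?C q) ?C" for q
  have bT: "beta_field A D X (chart_inv ?C q) \<in> tangent_space (slit_atlas A) (chart_inv ?C q)"
    "D (chart_inv ?C q) (beta_field A D X (chart_inv ?C q)) (eta A) = 0"
    "rho A (chart_inv ?C q) (beta_field A D X (chart_inv ?C q)) = X (chart_inv ?C q)" if "q \<in> dom c" for q
    using beta[OF at(1)[OF that] pi_fields_tangent[OF X]] at(1)[OF that] by (simp_all add: beta_field_def)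
  have fstb: "fst (b q) = prep X c q" if q: "q \<in> dom c" for q
    using rho_component[OF at(1)[OF q] bT(1)[OF q] at(3)[OF q]] bT(3)[OF q] by (simp add: b_def)
  have eq: "\<kappa> q (0, snd (b q)) = - \<kappa> q (prep X c q, 0)" if q: "q \<in> dom c" for q
  proof -
    have "\<kappa> q (b q) = 0" using K[OF q bT(1)[OF q]] bT(2)[OF q] by (simp add: b_def)
    moreover have "b q = (prep X c q, 0) + (0, snd (b q))" using fstb[OF q] by (simp add: prod_eq_iff)
    ultimately have "\<kappa> q (prep X c q, 0) + \<kappa> q (0, snd (b q)) = 0"
      using linear_add[OF lin[OF q]] by metis
    then show ?thesis by (simp add: eq_neg_iff_add_eq_0 add.commute)
  qed
  have rhs: "smooth_on (dom c) (\<lambda>q. - \<kappa> q (prep X c q, 0))"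
  proof (rule smooth_on_minus, rule smooth_on_cong[OF S])
    show "(\<Sum>i\<in>Basis. ((prep X c q, 0) \<bullet> i) *\<^sub>R \<kappa> q i) = \<kappa> q (prep X c q, 0)" if "q \<in> dom c" for q
      by (rule linear_euclidean_expansion[OF lin[OF that], symmetric])
    show "smooth_on (dom c) (\<lambda>q. \<Sum>i\<in>Basis. ((prep X c q, 0::'e) \<bullet> i) *\<^sub>R \<kappa> q i)"
      by (intro smooth_on_sum smooth_on_scaleR smooth smooth_on_inner_left smooth_on_Pair
          smooth_on_const pi_fields_rep X c)
  qed
  have "smooth_on (dom c) (\<lambda>q. snd (b q))"
  proof (rule smooth_on_linear_solution[OF S _ inj smooth rhs eq])
    show "linear (\<lambda>v. \<kappa> q (0, v))" if "q \<in> dom c" for q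
      using linear_compose[OF _ lin[OF that], of "\<lambda>v. (0, v)"] by (simp add: o_def linear_iff)
  qed
  then have "smooth_on (dom c) (\<lambda>q. (prep X c q, snd (b q)))"
    by (intro smooth_on_Pair pi_fields_rep X c)
  then show ?thesis
    by (rule smooth_on_cong[OF S, rotated]) (simp add: fstb[symmetric], simp add: b_def)
qed

lemma beta_field_closed:
  assumes X: "X \<in> pi_fields A"
  shows "beta_field A D X \<in> vector_fields (slit_atlas A)"
proof (rule slit_vector_fieldsI)
  show "beta_field A D X u \<in> tangent_space (slit_atlas A) u" if "u \<in> slit_bundle A" for u
    using beta(1)[OF that pi_fields_tangent[OF X]] that by (simp add: beta_field_def)
qed (simp_all add: beta_field_smooth X, simp add: beta_field_def)

lemma beta_field_add:
  "X \<in> pi_fields A \<Longrightarrow> Y \<in> pi_fields A \<Longrightarrow> beta_field A D (X + Y) = beta_field A D X + beta_field A D Y"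
  by (rule ext) (simp add: beta_field_def beta_add pi_fields_tangent)

lemma rho_beta_field: "X \<in> pi_fields A \<Longrightarrow> rho_field A (beta_field A D X) = X"
  by (rule ext) (simp add: rho_field_def beta_field_def beta pi_fields_tangent pi_fields_outside zero_fun_def)

lemma cov_beta_eta: "X \<in> pi_fields A \<Longrightarrow> cov A D (beta_field A D X) (eta A) = 0"
  by (rule ext) (simp add: cov_def beta_field_def beta pi_fields_tangent)

lemma cov_closed:
  assumes a: "a \<in> vector_fields (slit_atlas A)" and Y: "Y \<in> pi_fields A"
  shows "cov A D a Y \<in> pi_fields A"
proof (rule pi_fieldsI)
  show "cov A D a Y u \<in> tangent_space A (fst u)" if "u \<in> slit_bundle A" for u
    using D_tangent[OF that slit.vector_fields_tangent[OF a] Y] that by (simp add: cov_def)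
  have "vector_field_on (slit_atlas A) (manifold_points (slit_atlas A)) a"
    using a by (simp add: vector_fields_def)
  from D_smooth[OF Y slit.openin_manifold_points this]
  have "pi_field_on A (slit_bundle A) (\<lambda>u. D u (a u) Y)" by (simp only: slit_manifold_points)
  then have *: "smooth_on (dom c) (prep (\<lambda>u. D u (a u) Y) c)" if "c \<in> A" for c
    using that unfolding pi_field_on_def slit_Int_chart by blast
  show "smooth_on (dom c) (prep (cov A D a Y) c)" if c: "c \<in> A" for c
    by (rule smooth_on_cong[OF open_dom[OF c] _ *[OF c]]) (simp add: cov_def dom_inv[OF c])
qed (simp add: cov_def)

lemma cov_add_left:
  assumes "a \<in> vector_fields (slit_atlas A)" "b \<in> vector_fields (slit_atlas A)" "Y \<in> pi_fields A"
  shows "cov A D (a + b) Y = cov A D a Y + cov A D b Y"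
  by (rule ext) (simp add: cov_def D_add_vec slit.vector_fields_tangent assms)

lemma cov_add_right:
  assumes "a \<in> vector_fields (slit_atlas A)" "Y \<in> pi_fields A" "Z \<in> pi_fields A"
  shows "cov A D a (Y + Z) = cov A D a Y + cov A D a Z"
  by (rule ext) (simp add: cov_def D_add_section slit.vector_fields_tangent assms)

text \<open>The horizontal lift of a regular connection supplies the global lifts on which the
  vertical calculus rests.\<close>

lemma rho_field_surj: "X \<in> pi_fields A \<Longrightarrow> \<exists>a\<in>vector_fields (slit_atlas A). rho_field A a = X"
  using beta_field_closed rho_beta_field by blast

end

section \<open>Finsler connections algebraically\<close>

text \<open>\<open>PX\<close>, \<open>VX\<close> and \<open>FX\<close> play the roles of the \<open>\<pi>\<close>-vector fields and of the vector fields and functions on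
  the slit tangent bundle, \<open>br\<close> and \<open>act\<close> of the Lie bracket and the derivative of functions, and \<open>ga\<close>,
  \<open>rh\<close>, \<open>et\<close>, \<open>E\<close> of \<open>\<gamma>\<close>, \<open>\<rho>\<close>, \<open>\<eta>\<close> and \<open>L\<^sup>2/2\<close>. Only the additive structure of these modules is used. The
  operation \<open>dz\<close> below is \<open>\<nabla>\<^sup>v\<close>.\<close>

locale vertical_calculus =
  fixes PX :: "'x::ab_group_add set" and VX :: "'a::ab_group_add set" and FX :: "'f::real_vector set"
    and br :: "'a \<Rightarrow> 'a \<Rightarrow> 'a" and act :: "'a \<Rightarrow> 'f \<Rightarrow> 'f"
    and ga :: "'x \<Rightarrow> 'a" and rh :: "'a \<Rightarrow> 'x" and et :: 'x and E :: 'f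
  assumes PX_zero [simp, intro]: "0 \<in> PX"
    and PX_add [simp, intro]: "\<And>X Y. X \<in> PX \<Longrightarrow> Y \<in> PX \<Longrightarrow> X + Y \<in> PX"
    and PX_minus [simp, intro]: "\<And>X. X \<in> PX \<Longrightarrow> - X \<in> PX"
    and VX_zero [simp, intro]: "0 \<in> VX"
    and VX_add [simp, intro]: "\<And>a b. a \<in> VX \<Longrightarrow> b \<in> VX \<Longrightarrow> a + b \<in> VX"
    and VX_minus [simp, intro]: "\<And>a. a \<in> VX \<Longrightarrow> - a \<in> VX"
    and FX_zero [simp, intro]: "0 \<in> FX"
    and FX_add [simp, intro]: "\<And>f h. f \<in> FX \<Longrightarrow> h \<in> FX \<Longrightarrow> f + h \<in> FX"
    and FX_minus [simp, intro]: "\<And>f. f \<in> FX \<Longrightarrow> - f \<in> FX"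
    and br_closed [simp, intro]: "\<And>a b. a \<in> VX \<Longrightarrow> b \<in> VX \<Longrightarrow> br a b \<in> VX"
    and br_add_left: "\<And>a b c. a \<in> VX \<Longrightarrow> b \<in> VX \<Longrightarrow> c \<in> VX \<Longrightarrow> br (a + b) c = br a c + br b c"
    and br_antisym: "\<And>a b. a \<in> VX \<Longrightarrow> b \<in> VX \<Longrightarrow> br a b = - br b a"
    and jacobi: "\<And>a b c. a \<in> VX \<Longrightarrow> b \<in> VX \<Longrightarrow> c \<in> VX \<Longrightarrow>
      br a (br b c) + br b (br c a) + br c (br a b) = 0"
    and act_closed [simp, intro]: "\<And>a f. a \<in> VX \<Longrightarrow> f \<in> FX \<Longrightarrow> act a f \<in> FX"
    and act_add_left: "\<And>a b f. a \<in> VX \<Longrightarrow> b \<in> VX \<Longrightarrow> f \<in> FX \<Longrightarrow> act (a + b) f = act a f + act b f"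
    and act_add_right: "\<And>a f h. a \<in> VX \<Longrightarrow> f \<in> FX \<Longrightarrow> h \<in> FX \<Longrightarrow> act a (f + h) = act a f + act a h"
    and act_br: "\<And>a b f. a \<in> VX \<Longrightarrow> b \<in> VX \<Longrightarrow> f \<in> FX \<Longrightarrow>
      act (br a b) f = act a (act b f) - act b (act a f)"
    and ga_closed [simp, intro]: "\<And>X. X \<in> PX \<Longrightarrow> ga X \<in> VX"
    and ga_add: "\<And>X Y. X \<in> PX \<Longrightarrow> Y \<in> PX \<Longrightarrow> ga (X + Y) = ga X + ga Y"
    and rh_closed [simp, intro]: "\<And>a. a \<in> VX \<Longrightarrow> rh a \<in> PX"
    and rh_add: "\<And>a b. a \<in> VX \<Longrightarrow> b \<in> VX \<Longrightarrow> rh (a + b) = rh a + rh b"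
    and rh_ga [simp]: "\<And>X. X \<in> PX \<Longrightarrow> rh (ga X) = 0"
    and ker_rh: "\<And>a. a \<in> VX \<Longrightarrow> rh a = 0 \<Longrightarrow> \<exists>X\<in>PX. a = ga X"
    and rh_surj: "\<And>X. X \<in> PX \<Longrightarrow> \<exists>a\<in>VX. rh a = X"
    and rh_br_ga_ga: "\<And>X Y. X \<in> PX \<Longrightarrow> Y \<in> PX \<Longrightarrow> rh (br (ga X) (ga Y)) = 0"
    and et_closed [simp, intro]: "et \<in> PX"
    and rh_br_et: "\<And>X a. X \<in> PX \<Longrightarrow> a \<in> VX \<Longrightarrow> rh a = et \<Longrightarrow> rh (br (ga X) a) = X"
    and E_closed [simp, intro]: "E \<in> FX"
    and euler: "act (ga et) E = E + E"
begin

lemma PX_diff [simp, intro]: "X \<in> PX \<Longrightarrow> Y \<in> PX \<Longrightarrow> X - Y \<in> PX"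
  by (metis PX_add PX_minus diff_conv_add_uminus)

lemma VX_diff [simp, intro]: "X \<in> VX \<Longrightarrow> Y \<in> VX \<Longrightarrow> X - Y \<in> VX"
  by (metis VX_add VX_minus diff_conv_add_uminus)

lemma FX_diff [simp, intro]: "X \<in> FX \<Longrightarrow> Y \<in> FX \<Longrightarrow> X - Y \<in> FX"
  by (metis FX_add FX_minus diff_conv_add_uminus)

lemma ga_diff: "X \<in> PX \<Longrightarrow> Y \<in> PX \<Longrightarrow> ga (X - Y) = ga X - ga Y"
  using ga_add[of "X - Y" Y] by simp

lemma rh_diff: "a \<in> VX \<Longrightarrow> b \<in> VX \<Longrightarrow> rh (a - b) = rh a - rh b"
  using rh_add[of "a - b" b] by simp

lemma br_diff_left: "a \<in> VX \<Longrightarrow> b \<in> VX \<Longrightarrow> c \<in> VX \<Longrightarrow> br (a - b) c = br a c - br b c"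
  using br_add_left[of "a - b" b c] by simp

lemma br_add_right: "a \<in> VX \<Longrightarrow> b \<in> VX \<Longrightarrow> c \<in> VX \<Longrightarrow> br a (b + c) = br a b + br a c"
  using br_add_left[of b c a] br_antisym[of a "b + c"] br_antisym[of a b] br_antisym[of a c] by simp

lemma br_diff_right: "a \<in> VX \<Longrightarrow> b \<in> VX \<Longrightarrow> c \<in> VX \<Longrightarrow> br a (b - c) = br a b - br a c"
  using br_add_right[of a "b - c" c] by simp

lemma act_diff_left: "a \<in> VX \<Longrightarrow> b \<in> VX \<Longrightarrow> f \<in> FX \<Longrightarrow> act (a - b) f = act a f - act b f"
  using act_add_left[of "a - b" b f] by simp

lemma act_diff_right: "a \<in> VX \<Longrightarrow> f \<in> FX \<Longrightarrow> h \<in> FX \<Longrightarrow> act a (f - h) = act a f - act a h"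
  using act_add_right[of a "f - h" h] by simp

text \<open>The derivation form of the Jacobi identity. Minus signs are moved through brackets as
  differences from 0, additivity being the only linearity among the axioms.\<close>

lemma jacobi': "a \<in> VX \<Longrightarrow> b \<in> VX \<Longrightarrow> c \<in> VX \<Longrightarrow> br (br a b) c = br a (br b c) - br b (br a c)"
proof -
  assume *: "a \<in> VX" "b \<in> VX" "c \<in> VX"
  have "br b (br a c) = br b (0 - br c a)"
    using br_antisym[of a c] * by simp
  also have "\<dots> = - br b (br c a)"
    using * br_diff_right[of b 0 0] br_diff_right[of b 0 "br c a"] by simp
  finally have 1: "br b (br a c) = - br b (br c a)" .
  have "br a (br b c) + br b (br c a) = - br c (br a b)"
    using jacobi[OF *] by (simp add: eq_neg_iff_add_eq_0)
  with 1 show ?thesis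
    using br_antisym[of "br a b" c] * by simp
qed

definition dz :: "'x \<Rightarrow> 'x \<Rightarrow> 'x"
  where "dz X Y = rh (br (ga X) (SOME a. a \<in> VX \<and> rh a = Y))"

text \<open>Two lifts of the same field differ by a vertical field, and brackets of vertical fields
  are vertical; so the choice in \<open>dz\<close> is immaterial.\<close>

lemma rh_br_ga: "X \<in> PX \<Longrightarrow> a \<in> VX \<Longrightarrow> rh (br (ga X) a) = dz X (rh a)"
proof -
  assume X: "X \<in> PX" and a: "a \<in> VX"
  define b where "b = (SOME b. b \<in> VX \<and> rh b = rh a)"
  have b: "b \<in> VX" "rh b = rh a"
    unfolding b_def using someI_ex[of "\<lambda>b. b \<in> VX \<and> rh b = rh a"] a by auto
  then obtain V where V: "V \<in> PX" "a - b = ga V"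
    using ker_rh[of "a - b"] rh_diff[OF a b(1)] a by auto
  have "rh (br (ga X) a) - rh (br (ga X) b) = rh (br (ga X) (a - b))"
    using X a b by (simp add: br_diff_right rh_diff)
  also have "\<dots> = 0" using V X by (simp add: rh_br_ga_ga)
  finally show ?thesis by (simp add: dz_def b_def)
qed

lemma dz_closed [simp, intro]: "X \<in> PX \<Longrightarrow> Y \<in> PX \<Longrightarrow> dz X Y \<in> PX"
  using rh_surj[of Y] rh_br_ga[of X] by (metis br_closed ga_closed rh_closed)

lemma dz_add_left: "X \<in> PX \<Longrightarrow> Y \<in> PX \<Longrightarrow> Z \<in> PX \<Longrightarrow> dz (X + Y) Z = dz X Z + dz Y Z"
proof -
  assume *: "X \<in> PX" "Y \<in> PX" "Z \<in> PX"
  obtain a where "a \<in> VX" "rh a = Z" using rh_surj * by blast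
  with * show ?thesis
    using rh_br_ga[of "X + Y" a] rh_br_ga[of X a] rh_br_ga[of Y a]
    by (simp add: ga_add br_add_left rh_add)
qed

lemma dz_add_right: "X \<in> PX \<Longrightarrow> Y \<in> PX \<Longrightarrow> Z \<in> PX \<Longrightarrow> dz X (Y + Z) = dz X Y + dz X Z"
proof -
  assume *: "X \<in> PX" "Y \<in> PX" "Z \<in> PX"
  obtain a b where "a \<in> VX" "rh a = Y" "b \<in> VX" "rh b = Z" using rh_surj * by meson
  with * show ?thesis
    using rh_br_ga[of X "a + b"] rh_br_ga[of X a] rh_br_ga[of X b]
    by (simp add: br_add_right rh_add)
qed

lemma dz_diff_left: "X \<in> PX \<Longrightarrow> Y \<in> PX \<Longrightarrow> Z \<in> PX \<Longrightarrow> dz (X - Y) Z = dz X Z - dz Y Z"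
  using dz_add_left[of "X - Y" Y Z] by simp

lemma dz_et: "X \<in> PX \<Longrightarrow> dz X et = X"
  using rh_surj[OF et_closed] rh_br_et rh_br_ga by metis

text \<open>Applying \<open>\<rho>[\<cdot>, h]\<close> with a lift \<open>h\<close> of \<open>\<eta>\<close> recovers a \<open>\<pi>\<close>-vector field from its vertical lift.\<close>

lemma br_ga_ga: "X \<in> PX \<Longrightarrow> Y \<in> PX \<Longrightarrow> br (ga X) (ga Y) = ga (dz X Y - dz Y X)"
proof -
  assume *: "X \<in> PX" "Y \<in> PX"
  then obtain V where V: "V \<in> PX" "br (ga X) (ga Y) = ga V"
    using ker_rh[of "br (ga X) (ga Y)"] rh_br_ga_ga[OF *] by auto
  obtain h where h: "h \<in> VX" "rh h = et" using rh_surj by blast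
  have "V = rh (br (br (ga X) (ga Y)) h)"
    using V h rh_br_et by auto
  also have "\<dots> = rh (br (ga X) (br (ga Y) h)) - rh (br (ga Y) (br (ga X) h))"
    using * h by (simp add: jacobi' rh_diff)
  also have "\<dots> = dz X Y - dz Y X"
    using * h by (simp add: rh_br_ga dz_et)
  finally show ?thesis using V by simp
qed

text \<open>Jacobi identity for \<gamma>X, \<gamma>Y and a lift of Z, projected by \<rho>; the
  right-hand side is the derivative along [\<gamma>X, \<gamma>Y].\<close>

lemma dz_flat: "X \<in> PX \<Longrightarrow> Y \<in> PX \<Longrightarrow> Z \<in> PX \<Longrightarrow>
  dz X (dz Y Z) - dz Y (dz X Z) = dz (dz X Y) Z - dz (dz Y X) Z"
proof -
  assume *: "X \<in> PX" "Y \<in> PX" "Z \<in> PX"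
  obtain h where h: "h \<in> VX" "rh h = Z" using rh_surj * by blast
  have "dz X (dz Y Z) - dz Y (dz X Z) = rh (br (br (ga X) (ga Y)) h)"
    using * h rh_br_ga[of X "br (ga Y) h"] rh_br_ga[of Y "br (ga X) h"]
    by (simp add: jacobi' rh_diff rh_br_ga)
  also have "\<dots> = dz (dz X Y - dz Y X) Z"
    using * h by (simp add: br_ga_ga rh_br_ga)
  finally show ?thesis using * by (simp add: dz_diff_left)
qed

section \<open>The metric as a fibre Hessian, and its vertical derivative\<close>

definition g :: "'x \<Rightarrow> 'x \<Rightarrow> 'f"
  where "g X Y = act (ga X) (act (ga Y) E) - act (ga (dz X Y)) E"

lemma g_closed [simp, intro]: "X \<in> PX \<Longrightarrow> Y \<in> PX \<Longrightarrow> g X Y \<in> FX"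
  by (auto simp: g_def)

text \<open>By \<open>br_ga_ga\<close>, \<open>dz\<close> is torsion-free on vertical fields, so its
  Hessians are symmetric.\<close>

lemma g_sym: "X \<in> PX \<Longrightarrow> Y \<in> PX \<Longrightarrow> g X Y = g Y X"
  using act_br[of "ga X" "ga Y" E] by (simp add: g_def br_ga_ga ga_diff act_diff_left algebra_simps)

lemma g_add_left: "X \<in> PX \<Longrightarrow> Y \<in> PX \<Longrightarrow> Z \<in> PX \<Longrightarrow> g (X + Y) Z = g X Z + g Y Z"
  by (simp add: g_def ga_add act_add_left dz_add_left)

lemma g_add_right: "X \<in> PX \<Longrightarrow> Y \<in> PX \<Longrightarrow> Z \<in> PX \<Longrightarrow> g Z (X + Y) = g Z X + g Z Y"
  by (simp add: g_def ga_add act_add_left act_add_right dz_add_right)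

lemma g_diff_left: "X \<in> PX \<Longrightarrow> Y \<in> PX \<Longrightarrow> Z \<in> PX \<Longrightarrow> g (X - Y) Z = g X Z - g Y Z"
  using g_add_left[of "X - Y" Y Z] by simp

lemma g_diff_right: "X \<in> PX \<Longrightarrow> Y \<in> PX \<Longrightarrow> Z \<in> PX \<Longrightarrow> g Z (X - Y) = g Z X - g Z Y"
  using g_add_right[of "X - Y" Y Z] by simp

lemma g_zero_left [simp]: "Z \<in> PX \<Longrightarrow> g 0 Z = 0"
  using g_add_left[of 0 0 Z] by simp

lemma g_zero_right [simp]: "Z \<in> PX \<Longrightarrow> g Z 0 = 0"
  using g_add_right[of 0 0 Z] by simp

lemma g_minus_left: "X \<in> PX \<Longrightarrow> Z \<in> PX \<Longrightarrow> g (- X) Z = - g X Z"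
  using g_diff_left[of 0 X Z] by simp

text \<open>Euler's relation turns the first term of the Hessian into twice the derivative of E, and
  \<open>dz X et\<close> = X removes one of the two.\<close>

lemma g_et: "X \<in> PX \<Longrightarrow> g X et = act (ga X) E"
  by (simp add: g_def dz_et euler act_add_right)

text \<open>The third fibre derivative of E, that is, twice the Cartan tensor.\<close>

definition dg :: "'x \<Rightarrow> 'x \<Rightarrow> 'x \<Rightarrow> 'f"
  where "dg X Y Z = act (ga X) (g Y Z) - g (dz X Y) Z - g Y (dz X Z)"

text \<open>Third derivatives commute: equation 1 is flatness of \<open>dz\<close>, equation 2 its
  lack of torsion. Together with the symmetry of g this gives total symmetry.\<close>

lemma dg_sym: "X \<in> PX \<Longrightarrow> Y \<in> PX \<Longrightarrow> Z \<in> PX \<Longrightarrow> dg X Y Z = dg Y X Z"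
proof -
  assume *: "X \<in> PX" "Y \<in> PX" "Z \<in> PX"
  have 1: "act (ga (dz X (dz Y Z))) E - act (ga (dz Y (dz X Z))) E
      = act (ga (dz (dz X Y) Z)) E - act (ga (dz (dz Y X) Z)) E"
    using arg_cong[OF dz_flat[OF *], of "\<lambda>V. act (ga V) E"] *
    by (simp add: ga_diff act_diff_left)
  have 2: "act (ga X) (act (ga Y) (act (ga Z) E)) - act (ga Y) (act (ga X) (act (ga Z) E))
      = act (ga (dz X Y)) (act (ga Z) E) - act (ga (dz Y X)) (act (ga Z) E)"
    using act_br[of "ga X" "ga Y" "act (ga Z) E"] *
    by (simp add: br_ga_ga ga_diff act_diff_left)
  show ?thesis
    using 1 2 * by (simp add: dg_def g_def act_diff_right algebra_simps)
qed

lemma dg_sym': "X \<in> PX \<Longrightarrow> Y \<in> PX \<Longrightarrow> Z \<in> PX \<Longrightarrow> dg X Y Z = dg X Z Y"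
  by (simp add: dg_def g_sym)

text \<open>By symmetry \<eta> may be moved into an argument of g. There \<open>g_et\<close> turns
  the expression into the definition of g Y Z minus g Y Z. Classically, g is homogeneous of degree
  0.\<close>

lemma dg_et: "Y \<in> PX \<Longrightarrow> Z \<in> PX \<Longrightarrow> dg et Y Z = 0"
proof -
  assume *: "Y \<in> PX" "Z \<in> PX"
  have "dg Y et Z = 0"
    using * g_sym[of et Z] g_sym[of et "dz Y Z"] by (simp add: dg_def g_et dz_et g_def[of Y Z])
  then show ?thesis using dg_sym * by auto
qed

end

locale finsler_calculus = vertical_calculus PX VX FX br act ga rh et E
  for PX :: "'x::ab_group_add set" and VX :: "'a::ab_group_add set" and FX :: "'f::real_vector set"
    and br act ga rh et E +
  assumes g_definite: "\<And>X. X \<in> PX \<Longrightarrow> g X X = 0 \<Longrightarrow> X = 0"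
begin

text \<open>The test field is Z = X - Y.\<close>

lemma g_nondegenerate: "X \<in> PX \<Longrightarrow> Y \<in> PX \<Longrightarrow> (\<And>Z. Z \<in> PX \<Longrightarrow> g X Z = g Y Z) \<Longrightarrow> X = Y"
  using g_definite[of "X - Y"] by (simp add: g_diff_left)

end

text \<open>What the Cartan and the Hashiguchi connection have in common. The symmetry of the
  (h)hv-torsion is expressed through \<open>dz\<close>, because \<rho>\<gamma> = 0 reduces that
  torsion to the difference of D along \<gamma>X and \<open>dz X\<close>.\<close>

locale finsler_connection = finsler_calculus PX VX FX br act ga rh et E
  for PX :: "'x::ab_group_add set" and VX :: "'a::ab_group_add set" and FX :: "'f::real_vector set"
    and br act ga rh et E +
  fixes D :: "'a \<Rightarrow> 'x \<Rightarrow> 'x" and be :: "'x \<Rightarrow> 'a"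
  assumes D_closed [simp, intro]: "\<And>a X. a \<in> VX \<Longrightarrow> X \<in> PX \<Longrightarrow> D a X \<in> PX"
    and D_add_left: "\<And>a b X. a \<in> VX \<Longrightarrow> b \<in> VX \<Longrightarrow> X \<in> PX \<Longrightarrow> D (a + b) X = D a X + D b X"
    and D_add_right: "\<And>a X Y. a \<in> VX \<Longrightarrow> X \<in> PX \<Longrightarrow> Y \<in> PX \<Longrightarrow> D a (X + Y) = D a X + D a Y"
    and be_closed [simp, intro]: "\<And>X. X \<in> PX \<Longrightarrow> be X \<in> VX"
    and be_add: "\<And>X Y. X \<in> PX \<Longrightarrow> Y \<in> PX \<Longrightarrow> be (X + Y) = be X + be Y"
    and rh_be [simp]: "\<And>X. X \<in> PX \<Longrightarrow> rh (be X) = X"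
    and D_be_et [simp]: "\<And>X. X \<in> PX \<Longrightarrow> D (be X) et = 0"
    and D_ga_metric: "\<And>V X Y. V \<in> PX \<Longrightarrow> X \<in> PX \<Longrightarrow> Y \<in> PX \<Longrightarrow>
      act (ga V) (g X Y) = g (D (ga V) X) Y + g X (D (ga V) Y)"
    and hv_sym: "\<And>X Y Z. X \<in> PX \<Longrightarrow> Y \<in> PX \<Longrightarrow> Z \<in> PX \<Longrightarrow>
      g (D (ga X) Y - dz X Y) Z = g (D (ga X) Z - dz X Z) Y"
    and h_torsion_free: "\<And>X Y. X \<in> PX \<Longrightarrow> Y \<in> PX \<Longrightarrow>
      D (be X) Y - D (be Y) X = rh (br (be X) (be Y))"
begin

lemma D_diff_left: "a \<in> VX \<Longrightarrow> b \<in> VX \<Longrightarrow> X \<in> PX \<Longrightarrow> D (a - b) X = D a X - D b X"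
  using D_add_left[of "a - b" b X] by simp

lemma D_diff_right: "a \<in> VX \<Longrightarrow> X \<in> PX \<Longrightarrow> Y \<in> PX \<Longrightarrow> D a (X - Y) = D a X - D a Y"
  using D_add_right[of a "X - Y" Y] by simp

lemma D_zero_right [simp]: "a \<in> VX \<Longrightarrow> D a 0 = 0"
  using D_diff_right[of a 0 0] by simp

lemma D_minus_right: "a \<in> VX \<Longrightarrow> X \<in> PX \<Longrightarrow> D a (- X) = - D a X"
  using D_diff_right[of a 0 X] by simp

definition T :: "'x \<Rightarrow> 'x \<Rightarrow> 'x"
  where "T X Y = D (ga X) Y - dz X Y"

lemma T_closed [simp, intro]: "X \<in> PX \<Longrightarrow> Y \<in> PX \<Longrightarrow> T X Y \<in> PX"
  by (auto simp: T_def)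

lemma D_ga: "D (ga X) Y = dz X Y + T X Y"
  by (simp add: T_def)

lemma T_add_left: "X \<in> PX \<Longrightarrow> Y \<in> PX \<Longrightarrow> Z \<in> PX \<Longrightarrow> T (X + Y) Z = T X Z + T Y Z"
  by (simp add: T_def D_add_left ga_add dz_add_left algebra_simps)

lemma T_add_right: "X \<in> PX \<Longrightarrow> Y \<in> PX \<Longrightarrow> Z \<in> PX \<Longrightarrow> T X (Y + Z) = T X Y + T X Z"
  by (simp add: T_def D_add_right ga_add dz_add_right algebra_simps)

lemma T_diff_right: "X \<in> PX \<Longrightarrow> Y \<in> PX \<Longrightarrow> Z \<in> PX \<Longrightarrow> T X (Y - Z) = T X Y - T X Z"
  using T_add_right[of X "Y - Z" Z] by simp

lemma T_self_adjoint: "X \<in> PX \<Longrightarrow> Y \<in> PX \<Longrightarrow> Z \<in> PX \<Longrightarrow> g (T X Y) Z = g Y (T X Z)"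
  using hv_sym g_sym by (simp add: T_def)

lemma T_dg: "X \<in> PX \<Longrightarrow> Y \<in> PX \<Longrightarrow> Z \<in> PX \<Longrightarrow> 2 *\<^sub>R g (T X Y) Z = dg X Y Z"
  using D_ga_metric[of X Y Z] T_self_adjoint[of X Y Z]
  by (simp add: dg_def D_ga g_add_left g_add_right algebra_simps scaleR_2)

lemma T_cartan_tensor: "X \<in> PX \<Longrightarrow> Y \<in> PX \<Longrightarrow> Z \<in> PX \<Longrightarrow> g (T X Y) Z = (1/2) *\<^sub>R dg X Y Z"
  by (simp flip: T_dg)

lemma T_sym: "X \<in> PX \<Longrightarrow> Y \<in> PX \<Longrightarrow> T X Y = T Y X"
  by (rule g_nondegenerate) (auto simp: T_cartan_tensor dg_sym)

lemma T_et: "Y \<in> PX \<Longrightarrow> T et Y = 0"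
  by (rule g_nondegenerate) (auto simp: T_cartan_tensor dg_et)

lemma T_et_right: "Y \<in> PX \<Longrightarrow> T Y et = 0"
  using T_et T_sym by (metis et_closed)

lemma D_ga_et [simp]: "X \<in> PX \<Longrightarrow> D (ga X) et = X"
  by (simp add: D_ga dz_et T_et_right)

text \<open>The decomposition of a vector field into vertical and horizontal part: a -
  \<beta>\<rho>a is some \<gamma>V, and V is recovered by K since K\<gamma> is the identity.\<close>

lemma split: "a \<in> VX \<Longrightarrow> a = ga (D a et) + be (rh a)"
proof -
  assume a: "a \<in> VX"
  obtain V where V: "V \<in> PX" "a - be (rh a) = ga V"
    using ker_rh[of "a - be (rh a)"] a by (auto simp: rh_diff)
  have "D a et = D (a - be (rh a)) et" using a by (simp add: D_diff_left)
  also have "\<dots> = V" using V by simp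
  finally show ?thesis using V(2) by (simp add: algebra_simps)
qed

section \<open>Curvature and Bianchi identities\<close>

definition kc :: "'a \<Rightarrow> 'a \<Rightarrow> 'x \<Rightarrow> 'x"
  where "kc a b Z = - D a (D b Z) + D b (D a Z) + D (br a b) Z"

lemma kc_closed [simp, intro]: "a \<in> VX \<Longrightarrow> b \<in> VX \<Longrightarrow> Z \<in> PX \<Longrightarrow> kc a b Z \<in> PX"
  by (auto simp: kc_def)

lemma kc_antisym: "a \<in> VX \<Longrightarrow> b \<in> VX \<Longrightarrow> Z \<in> PX \<Longrightarrow> kc a b Z = - kc b a Z"
  using D_diff_left[of 0 "br b a" Z] br_antisym[of a b] D_diff_left[of 0 0 Z] by (simp add: kc_def)

lemma kc_add_right: "a \<in> VX \<Longrightarrow> b \<in> VX \<Longrightarrow> c \<in> VX \<Longrightarrow> Z \<in> PX \<Longrightarrow> kc a (b + c) Z = kc a b Z + kc a c Z"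
  by (simp add: kc_def br_add_right D_add_left D_add_right algebra_simps)

lemma kc_diff_right: "a \<in> VX \<Longrightarrow> b \<in> VX \<Longrightarrow> c \<in> VX \<Longrightarrow> Z \<in> PX \<Longrightarrow> kc a (b - c) Z = kc a b Z - kc a c Z"
  using kc_add_right[of a "b - c" c Z] by simp

text \<open>Second Bianchi identity for commutators of operators. The triple derivatives cancel by
  the Jacobi identity for composition, the derivatives along double brackets by that for vector
  fields.\<close>

lemma bianchi:
  assumes "a \<in> VX" "b \<in> VX" "c \<in> VX" "Z \<in> PX"
  shows "D a (kc b c Z) - kc b c (D a Z) + (D b (kc c a Z) - kc c a (D b Z))
      + (D c (kc a b Z) - kc a b (D c Z))
    = - kc a (br b c) Z - kc b (br c a) Z - kc c (br a b) Z"
proof -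
  have "D (br a (br b c) + br b (br c a) + br c (br a b)) Z = 0"
    using jacobi assms D_diff_left[of 0 0 Z] by simp
  then have "D (br a (br b c)) Z + D (br b (br c a)) Z + D (br c (br a b)) Z = 0"
    using assms by (simp add: D_add_left)
  then show ?thesis
    using assms by (simp add: kc_def D_add_right D_minus_right D_diff_right algebra_simps)
qed

definition S :: "'x \<Rightarrow> 'x \<Rightarrow> 'x \<Rightarrow> 'x"
  where "S X Y Z = kc (ga X) (ga Y) Z"

lemma S_closed [simp, intro]: "X \<in> PX \<Longrightarrow> Y \<in> PX \<Longrightarrow> Z \<in> PX \<Longrightarrow> S X Y Z \<in> PX"
  by (auto simp: S_def)

lemma S_antisym: "X \<in> PX \<Longrightarrow> Y \<in> PX \<Longrightarrow> Z \<in> PX \<Longrightarrow> S X Y Z = - S Y X Z"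
  unfolding S_def by (intro kc_antisym ga_closed)

text \<open>The action of [\<gamma>X, \<gamma>Y] on g Z W is a commutator of two metric derivatives.
  The bracket is again vertical, so metricity in vertical directions is all that enters.\<close>

lemma S_skew:
  assumes "X \<in> PX" "Y \<in> PX" "Z \<in> PX" "W \<in> PX"
  shows "g (S X Y Z) W = - g (S X Y W) Z"
proof -
  have m: "act a (g Z W) = g (D a Z) W + g Z (D a W)"
    if "a = ga V" "V \<in> PX" "Z \<in> PX" "W \<in> PX" for a V Z W
    using D_ga_metric that by auto
  define V where "V = dz X Y - dz Y X"
  have V: "V \<in> PX" "br (ga X) (ga Y) = ga V" using assms by (auto simp: V_def br_ga_ga)
  have "act (ga V) (g Z W) = act (ga X) (act (ga Y) (g Z W)) - act (ga Y) (act (ga X) (g Z W))"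
    using act_br[of "ga X" "ga Y" "g Z W"] V assms by simp
  then have "g (S X Y Z) W + g Z (S X Y W) = 0"
    using assms V by (simp add: S_def kc_def D_ga_metric act_add_right g_add_left g_add_right
        g_diff_left g_diff_right algebra_simps)
  then show ?thesis using assms g_sym[of Z "S X Y W"] by (simp add: eq_neg_iff_add_eq_0)
qed

text \<open>Since \<open>dz\<close> is flat, \<open>S X Y\<close> is the commutator of the self-adjoint operators \<open>T X\<close>, \<open>T Y\<close>
  minus a term built from the metric derivative of \<open>T\<close> (\<open>nT\<close> below), which is self-adjoint and
  hence vanishes because \<open>S X Y\<close> is skew-adjoint.\<close>

lemma S_formula:
  assumes X: "X \<in> PX" and Y: "Y \<in> PX" and Z: "Z \<in> PX"
  shows "S X Y Z = T X (T Y Z) - T Y (T X Z)"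
proof (rule g_nondegenerate)
  fix W assume W: "W \<in> PX"
  \<comment> \<open>The slot Y is differentiated by \<open>dz\<close>, to match the bracket of
    vertical lifts; the slot Z by the metric D, so that self-adjointness of T is inherited.\<close>
  define nT1 where "nT1 X Y Z = D (ga X) (T Y Z) - T Y (D (ga X) Z) - T (dz X Y) Z" for X Y Z
  define nT where "nT Z = nT1 X Y Z - nT1 Y X Z" for Z
  define cm where "cm Z = T X (T Y Z) - T Y (T X Z)" for Z
  define V where "V = dz X Y - dz Y X"
  have V: "V \<in> PX" "br (ga X) (ga Y) = ga V" using X Y by (auto simp: V_def br_ga_ga)
  have TV: "T V U = T (dz X Y) U - T (dz Y X) U" if "U \<in> PX" for U
    using T_add_left[of V "dz Y X" U] X Y V that by (simp add: V_def)
  have nT1_closed: "nT1 X Y Z \<in> PX" if "X \<in> PX" "Y \<in> PX" "Z \<in> PX" for X Y Z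
    using that by (auto simp: nT1_def)
  have nT_closed: "nT U \<in> PX" if "U \<in> PX" for U
    using that X Y by (auto simp: nT_def nT1_closed)
  have cm_closed: "cm U \<in> PX" if "U \<in> PX" for U using that X Y by (auto simp: cm_def)
  have S: "S X Y U = cm U - nT U" if "U \<in> PX" for U
  proof -
    have "dz X (dz Y U) - dz Y (dz X U) = dz V U"
      using dz_flat X Y that by (simp add: V_def dz_diff_left)
    then show ?thesis
      using X Y that V
      by (simp add: S_def kc_def D_ga nT_def nT1_def cm_def T_add_right dz_add_right TV algebra_simps)
  qed
  have adj: "g (nT1 X Y Z) W = g Z (nT1 X Y W)"
    if "X \<in> PX" "Y \<in> PX" "Z \<in> PX" "W \<in> PX" for X Y Z W
  proof -
    have "act (ga X) (g (T Y Z) W) = act (ga X) (g Z (T Y W))"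
      using that by (simp add: T_self_adjoint)
    moreover have "g (T Y Z) (D (ga X) W) = g Z (T Y (D (ga X) W))"
        "g (T Y (D (ga X) Z)) W = g (D (ga X) Z) (T Y W)" "g (T (dz X Y) Z) W = g Z (T (dz X Y) W)"
      using that by (simp_all add: T_self_adjoint)
    ultimately show ?thesis
      using that by (simp add: nT1_def D_ga_metric g_diff_left g_diff_right g_add_left g_add_right algebra_simps)
  qed
  have nT_adj: "g (nT U) W = g U (nT W)" if "U \<in> PX" "W \<in> PX" for U W
    using adj[of X Y U W] adj[of Y X U W] X Y that
    by (simp add: nT_def nT1_closed g_diff_left g_diff_right)
  have cm_skew: "g (cm U) W = - g U (cm W)" if "U \<in> PX" "W \<in> PX" for U W
    using that X Y by (simp add: cm_def g_diff_left g_diff_right T_self_adjoint)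
  have "g (S X Y Z) W = - g Z (S X Y W)"
    using S_skew[OF X Y Z W] X Y Z W g_sym[of "S X Y W" Z] by simp
  then have "g (cm Z) W - g (nT Z) W = - (g Z (cm W) - g Z (nT W))"
    using S Z W cm_closed nT_closed by (simp add: g_diff_left g_diff_right)
  \<comment> \<open>The commutator cancels, being skew-adjoint itself; what is left makes the
    self-adjoint \<open>nT\<close> skew-adjoint too.\<close>
  then have "g (nT Z) W = - g (nT Z) W"
    using nT_adj[OF Z W] cm_skew[OF Z W] by simp
  then have "g (nT Z) W + g (nT Z) W = 0"
    by (simp only: eq_neg_iff_add_eq_0)
  then have "2 *\<^sub>R g (nT Z) W = 0" by (simp add: scaleR_2)
  then have "g (nT Z) W = 0" by simp
  then show "g (S X Y Z) W = g (T X (T Y Z) - T Y (T X Z)) W"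
    using S[of Z] Z W cm_closed nT_closed by (simp add: cm_def[symmetric] g_diff_left)
qed (use assms in auto)

lemma S_T:
  assumes "X \<in> PX" "Y \<in> PX" "Z \<in> PX" "W \<in> PX"
  shows "g (S X Y Z) W = g (T X W) (T Y Z) - g (T Y W) (T X Z)"
  using assms g_sym[of "T X W" "T Y Z"] g_sym[of "T Y W" "T X Z"]
  by (simp add: S_formula g_diff_left T_self_adjoint)

text \<open>Symmetry of T lets D take the place of \<open>dz\<close>.\<close>

lemma br_ga_ga_D: "X \<in> PX \<Longrightarrow> Y \<in> PX \<Longrightarrow> br (ga X) (ga Y) = ga (D (ga X) Y - D (ga Y) X)"
  by (simp add: br_ga_ga D_ga T_sym[of X Y])

lemma S_add_left: "X \<in> PX \<Longrightarrow> Y \<in> PX \<Longrightarrow> V \<in> PX \<Longrightarrow> Z \<in> PX \<Longrightarrow> S (X + Y) V Z = S X V Z + S Y V Z"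
  by (simp add: S_formula T_add_left T_add_right)

lemma S_diff_left: "X \<in> PX \<Longrightarrow> Y \<in> PX \<Longrightarrow> V \<in> PX \<Longrightarrow> Z \<in> PX \<Longrightarrow> S (X - Y) V Z = S X V Z - S Y V Z"
  using S_add_left[of "X - Y" Y V Z] by simp

lemma S_et: "Y \<in> PX \<Longrightarrow> Z \<in> PX \<Longrightarrow> S et Y Z = 0"
  by (simp add: S_formula T_et) (metis T_et T_diff_right diff_self et_closed T_closed)

definition DS :: "'a \<Rightarrow> 'x \<Rightarrow> 'x \<Rightarrow> 'x \<Rightarrow> 'x"
  where "DS a X Y Z = D a (S X Y Z) - S (D a X) Y Z - S X (D a Y) Z - S X Y (D a Z)"

text \<open>Since D is torsion-free on vertical fields, the bracket terms of \<open>bianchi\<close>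
  are exactly the derivatives of the first two arguments of S that complete the commutators to
  \<open>DS\<close>.\<close>

lemma v_bianchi:
  assumes "X \<in> PX" "Y \<in> PX" "Z \<in> PX" "W \<in> PX"
  shows "DS (ga X) Y Z W + DS (ga Y) Z X W + DS (ga Z) X Y W = 0"
proof -
  have r: "kc (ga X) (br (ga Y) (ga Z)) W = S (D (ga Z) Y) X W - S (D (ga Y) Z) X W"
    if "X \<in> PX" "Y \<in> PX" "Z \<in> PX" for X Y Z
    using that assms S_antisym[of X "D (ga Y) Z - D (ga Z) Y" W]
    by (simp add: br_ga_ga_D S_def[symmetric] S_diff_left)
  have a: "S X (D (ga Y) Z) W = - S (D (ga Y) Z) X W" if "X \<in> PX" "Y \<in> PX" "Z \<in> PX" for X Y Z
    using that assms by (intro S_antisym) auto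
  show ?thesis
    using bianchi[of "ga X" "ga Y" "ga Z" W] assms
    by (simp add: r DS_def S_def[symmetric] a algebra_simps)
qed

text \<open>S vanishes when one of its first two arguments is \<eta>, so its derivative in that slot
  only sees the derivative of \<eta>, which along \<gamma>X is X. Two of the three cyclic terms
  therefore equal S X Y, whence the factor 2.\<close>

lemma DS_ga_et:
  assumes "X \<in> PX" "Y \<in> PX" "W \<in> PX"
  shows "DS (ga et) X Y W = - (S X Y W + S X Y W)"
proof -
  have z: "S Y et W = 0" if "Y \<in> PX" "W \<in> PX" for Y W
    using S_antisym[of Y et W] S_et that by simp
  have "DS (ga X) Y et W = S X Y W" "DS (ga Y) et X W = S X Y W"
    using assms z S_et S_antisym[of X Y W] by (simp_all add: DS_def)
  then have "DS (ga et) X Y W + (S X Y W + S X Y W) = 0"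
    using v_bianchi[of et X Y W] assms by (simp add: algebra_simps)
  then show ?thesis
    by (simp only: eq_neg_iff_add_eq_0)
qed

definition P :: "'x \<Rightarrow> 'x \<Rightarrow> 'x \<Rightarrow> 'x"
  where "P X Y Z = kc (be X) (ga Y) Z"

lemma P_closed [simp, intro]: "X \<in> PX \<Longrightarrow> Y \<in> PX \<Longrightarrow> Z \<in> PX \<Longrightarrow> P X Y Z \<in> PX"
  by (auto simp: P_def)

definition DP :: "'a \<Rightarrow> 'x \<Rightarrow> 'x \<Rightarrow> 'x \<Rightarrow> 'x"
  where "DP a X Y Z = D a (P X Y Z) - P (D a X) Y Z - P X (D a Y) Z - P X Y (D a Z)"

end

section \<open>The Hashiguchi connection in horizontal directions\<close>

locale hashiguchi_calculus = finsler_connection PX VX FX br act ga rh et E D be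
  for PX :: "'x::ab_group_add set" and VX :: "'a::ab_group_add set" and FX :: "'f::real_vector set"
    and br act ga rh et E D be +
  assumes P_et: "\<And>X Y. X \<in> PX \<Longrightarrow> Y \<in> PX \<Longrightarrow> P X Y et = 0"
    and conservative: "\<And>X. X \<in> PX \<Longrightarrow> act (be X) E = 0"
begin

text \<open>On \<eta> the connection gives 0 along \<beta>X and Y along \<gamma>Y, so the contracted
  hv-curvature is the vertical part of the bracket minus D along \<beta>X of Y.\<close>

lemma br_be_ga_et: "X \<in> PX \<Longrightarrow> Y \<in> PX \<Longrightarrow> D (br (be X) (ga Y)) et = D (be X) Y"
  using P_et[of X Y] by (simp add: P_def kc_def)

lemma br_ga_be:
  assumes "X \<in> PX" "Z \<in> PX"
  shows "br (ga X) (be Z) = be (dz X Z) - ga (D (be Z) X)"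
proof -
  have "D (br (ga X) (be Z)) et = - D (be Z) X"
    using br_be_ga_et[of Z X] br_antisym[of "ga X" "be Z"] assms
      D_diff_left[of 0 "br (be Z) (ga X)" et] D_diff_left[of 0 0 et] by simp
  then show ?thesis
    using split[of "br (ga X) (be Z)"] assms rh_br_ga[of X "be Z"] ga_diff[of 0 "D (be Z) X"]
      ga_diff[of 0 0] by simp
qed

text \<open>The Bianchi identity for \<beta>Z, \<gamma>X, \<gamma>Y. The vertical parts of the mixed
  brackets supply the derivatives of the arguments of S, the horizontal parts give P with
  \<open>dz\<close> in its first argument.\<close>

lemma h_bianchi:
  assumes X: "X \<in> PX" and Y: "Y \<in> PX" and Z: "Z \<in> PX" and W: "W \<in> PX"
  shows "DS (be Z) X Y W = DP (ga X) Z Y W - DP (ga Y) Z X W - P (T Y Z) X W + P (T X Z) Y W"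
proof -
  have p: "kc (ga X) (be Y) W = - P Y X W" if "X \<in> PX" "Y \<in> PX" "W \<in> PX" for X Y W
    using kc_antisym[of "ga X" "be Y" W] that by (simp add: P_def)
  have P_add: "P (U + V) X W = P U X W + P V X W" "P X (U + V) W = P X U W + P X V W"
    if "U \<in> PX" "V \<in> PX" "X \<in> PX" "W \<in> PX" for U V X W
    using that kc_antisym[of "be (U + V)" "ga X" W] kc_antisym[of "be U" "ga X" W]
      kc_antisym[of "be V" "ga X" W]
    by (simp_all add: P_def ga_add be_add kc_add_right)
  have P_diff: "P X (U - V) W = P X U W - P X V W"
    if "U \<in> PX" "V \<in> PX" "X \<in> PX" "W \<in> PX" for U V X W
    using P_add(2)[of "U - V" V X W] that by simp
  have r: "kc (ga X) (br (ga Y) (be Z)) W = - P (dz Y Z) X W - S X (D (be Z) Y) W"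
    if "X \<in> PX" "Y \<in> PX" "Z \<in> PX" "W \<in> PX" for X Y Z W
    using that by (simp add: br_ga_be kc_diff_right p S_def[symmetric])
  have r': "kc (ga Y) (br (be Z) (ga X)) W = P (dz X Z) Y W - S (D (be Z) X) Y W"
  proof -
    have "kc (ga Y) (br (be Z) (ga X)) W = - kc (ga Y) (br (ga X) (be Z)) W"
      using kc_diff_right[of "ga Y" 0 "br (ga X) (be Z)" W] kc_diff_right[of "ga Y" 0 0 W]
        br_antisym[of "be Z" "ga X"] X Y Z W by simp
    then show ?thesis
      using r[of Y X Z W] X Y Z W S_antisym[of Y "D (be Z) X" W] by simp
  qed
  have r'': "kc (be Z) (br (ga X) (ga Y)) W = P Z (D (ga X) Y) W - P Z (D (ga Y) X) W"
    using X Y Z W by (simp add: br_ga_ga_D P_def[symmetric] P_diff)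
  \<comment> \<open>Origin of the two terms with T: the bracket provides \<open>dz\<close>, but the
    covariant derivative of P requires D.\<close>
  have e: "P (dz X Z) Y W = P (D (ga X) Z) Y W - P (T X Z) Y W"
    if "X \<in> PX" "Y \<in> PX" for X Y
    using that Z W by (simp add: D_ga P_add)
  show ?thesis
    using bianchi[of "be Z" "ga X" "ga Y" W] X Y Z W
    by (simp add: r r' r'' p e P_def[symmetric] S_def[symmetric] D_minus_right)
      (simp add: DS_def DP_def algebra_simps)
qed

text \<open>g et Z is the derivative of E along \<gamma>Z, and E is constant along \<beta>X.
  Exchanging the two derivatives leaves the vertical part of their bracket. So D is metric along
  every horizontal field when one argument is \<eta>.\<close>

lemma act_be_g_et:
  assumes "X \<in> PX" "Z \<in> PX"
  shows "act (be X) (g et Z) = g et (D (be X) Z)"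
proof -
  have "act (br (ga Z) (be X)) E = - act (ga (D (be X) Z)) E"
    using assms by (simp add: br_ga_be act_diff_left conservative)
  moreover have "act (ga Z) (act (be X) E) = 0"
    using assms act_diff_right[of "ga Z" 0 0] by (simp add: conservative)
  ultimately have "act (be X) (act (ga Z) E) = act (ga (D (be X) Z)) E"
    using assms act_br[of "ga Z" "be X" E] by simp
  then show ?thesis
    using assms g_sym[of et] by (simp add: g_et)
qed

lemma rh_br_be_et: "X \<in> PX \<Longrightarrow> rh (br (be et) (be X)) = D (be et) X"
  using h_torsion_free[of et X] by simp

text \<open>Jacobi identity for \<gamma>Y, \<beta>\<eta>, \<beta>Z, projected by \<rho>. D along
  \<beta>\<eta> fails to be a derivation of \<open>dz\<close> by the horizontal derivative of Z
  along \<beta>Y, which is what is needed to differentiate the Hessian g along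
  \<beta>\<eta>.\<close>

lemma D_be_et_dz:
  assumes "Y \<in> PX" "Z \<in> PX"
  shows "D (be Y) Z + D (be et) (dz Y Z) = dz (D (be et) Y) Z + dz Y (D (be et) Z)"
proof -
  have rb: "rh (br (be et) (ga V)) = - V" if "V \<in> PX" for V
    using br_antisym[of "be et" "ga V"] rh_diff[of 0 "br (ga V) (be et)"] rh_diff[of 0 0] rh_br_et that
    by simp
  have "rh (br (br (ga Y) (be et)) (be Z))
      = rh (br (ga Y) (br (be et) (be Z))) - rh (br (be et) (br (ga Y) (be Z)))"
    using assms by (simp add: jacobi' rh_diff)
  moreover have "rh (br (ga Y) (br (be et) (be Z))) = dz Y (D (be et) Z)"
    using assms by (simp add: rh_br_ga rh_br_be_et)
  moreover have "rh (br (be et) (br (ga Y) (be Z))) = D (be et) (dz Y Z) + D (be Z) Y"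
    using assms by (simp add: br_ga_be br_diff_right rh_diff rh_br_be_et rb)
  moreover have "rh (br (br (ga Y) (be et)) (be Z)) = D (be Y) Z - D (be Z) Y - dz (D (be et) Y) Z"
    using assms h_torsion_free[of Y Z] by (simp add: br_ga_be dz_et br_diff_left rh_diff rh_br_ga)
  ultimately show ?thesis by (simp add: algebra_simps)
qed

text \<open>This is the vanishing of the Landsberg tensor contracted with \<open>\<eta>\<close>.\<close>

lemma act_be_et_g:
  assumes "Y \<in> PX" "Z \<in> PX"
  shows "act (be et) (g Y Z) = g (D (be et) Y) Z + g Y (D (be et) Z)"
proof -
  \<comment> \<open>The bracket of \<gamma>V and \<beta>\<eta> is \<beta>V minus the lift of D along
    \<beta>\<eta> of V, because \<open>dz V et\<close> = V. Used twice, this moves \<beta>\<eta>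
    through both vertical derivatives until it meets E and gives 0.\<close>
  have cm: "act (be et) (act (ga V) f) = act (ga V) (act (be et) f) + act (ga (D (be et) V)) f - act (be V) f"
    if "V \<in> PX" "f \<in> FX" for V f
    using that act_br[of "ga V" "be et" f] by (simp add: br_ga_be dz_et act_diff_left algebra_simps)
  have z: "act (ga V) 0 = 0" if "V \<in> PX" for V
    using act_diff_right[of "ga V" 0 0] that by simp
  have ver: "act (be V) (act (ga Z) E) = act (ga (D (be V) Z)) E" if "V \<in> PX" for V
    using act_be_g_et[of V Z] assms that g_sym[of et Z] g_sym[of et "D (be V) Z"] by (simp add: g_et)
  have "act (ga (D (be Y) Z)) E + act (ga (D (be et) (dz Y Z))) E
      = act (ga (dz (D (be et) Y) Z)) E + act (ga (dz Y (D (be et) Z))) E"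
    using arg_cong[OF D_be_et_dz[OF assms], of "\<lambda>V. act (ga V) E"] assms
    by (simp add: ga_add act_add_left)
  then show ?thesis
    using assms ver[of Y]
    by (simp add: g_def act_diff_right act_add_right cm conservative z algebra_simps)
qed

end

section \<open>Comparison of the two connections\<close>

locale cartan_hashiguchi =
  H: hashiguchi_calculus PX VX FX br act ga rh et E DH bh +
  C: finsler_connection PX VX FX br act ga rh et E DC bc
  for PX :: "'x::ab_group_add set" and VX :: "'a::ab_group_add set" and FX :: "'f::real_vector set"
    and br act ga rh et E DH bh DC bc +
  assumes C_metric: "\<And>a X Y. a \<in> VX \<Longrightarrow> X \<in> PX \<Longrightarrow> Y \<in> PX \<Longrightarrow>
      act a (H.g X Y) = H.g (DC a X) Y + H.g X (DC a Y)"
begin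

lemma T_eq: "X \<in> PX \<Longrightarrow> Y \<in> PX \<Longrightarrow> C.T X Y = H.T X Y"
  by (rule H.g_nondegenerate) (auto simp: C.T_cartan_tensor H.T_cartan_tensor)

lemma S_eq: "X \<in> PX \<Longrightarrow> Y \<in> PX \<Longrightarrow> Z \<in> PX \<Longrightarrow> C.S X Y Z = H.S X Y Z"
  by (simp add: C.S_formula H.S_formula T_eq)

text \<open>Koszul's formula for \<open>2 g(D\<^bsub>\<beta>X\<^esub>\<eta>, Z) = 0\<close>, evaluated with both horizontal lifts. Their
  difference is vertical; the terms with \<open>\<eta>\<close> in the Cartan tensor vanish, and what remains shows
  that the difference is zero.\<close>

lemma bc_eq_bh:
  assumes X: "X \<in> PX"
  shows "bc X = bh X"
proof -
  define N where "N X = DH (bc X) et" for X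
  have N: "N X \<in> PX" "bc X = bh X + ga (N X)" if "X \<in> PX" for X
    using H.split[of "bc X"] that by (auto simp: N_def add.commute)
  have key: "H.g (N X) Z + H.g (N X) Z + H.dg (N et) X Z = 0" if X: "X \<in> PX" and Z: "Z \<in> PX" for X Z
  proof -
    have kC: "act (bc X) (H.g et Z) + act (bc et) (H.g X Z) - act (bc Z) (H.g X et)
      = H.g et (rh (br (bc X) (bc Z))) + H.g (rh (br (bc et) (bc X))) Z + H.g X (rh (br (bc et) (bc Z)))"
      using X Z H.g_sym[of "DC (bc Z) X" et]
      by (simp add: C_metric C.h_torsion_free[symmetric] H.g_diff_right)
    \<comment> \<open>Each derivative on the left either has \<eta> as an argument of g or is taken
      along \<beta>\<eta>; these are the cases in which the Hashiguchi connection is known to be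
      metric.\<close>
    have kH: "act (bh X) (H.g et Z) + act (bh et) (H.g X Z) - act (bh Z) (H.g X et)
      = H.g et (rh (br (bh X) (bh Z))) + H.g (rh (br (bh et) (bh X))) Z + H.g X (rh (br (bh et) (bh Z)))"
      using X Z H.g_sym[of X et]
      by (simp add: H.act_be_g_et H.act_be_et_g H.h_torsion_free[symmetric] H.g_diff_right)
    \<comment> \<open>Expansion of the brackets after writing one lift as the other plus \<gamma>N;
      the bracket of the two vertical parts is vertical and disappears under \<rho>.\<close>
    have rb: "rh (br (bc X) (bc Z)) = rh (br (bh X) (bh Z)) + H.dz (N X) Z - H.dz (N Z) X"
      if "X \<in> PX" "Z \<in> PX" for X Z
      using that N[of X] N[of Z] H.rh_br_ga_ga[of "N X" "N Z"] H.rh_br_ga[of "N X" "bh Z"]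
        H.rh_br_ga[of "N Z" "bh X"] H.br_antisym[of "bh X" "ga (N Z)"]
        H.rh_diff[of 0 "br (ga (N Z)) (bh X)"] H.rh_diff[of 0 0]
      by (simp add: H.br_add_left H.br_add_right H.rh_add H.rh_diff)
    have "act (ga (N X)) (H.g et Z) + act (ga (N et)) (H.g X Z) - act (ga (N Z)) (H.g X et)
        = H.g et (H.dz (N X) Z) - H.g et (H.dz (N Z) X)
          + (H.g (H.dz (N et) X) Z - H.g (N X) Z) + (H.g X (H.dz (N et) Z) - H.g X (N Z))"
      using arg_cong2[where f = "(-)",
          OF kC[unfolded rb[OF X Z] rb[OF H.et_closed X] rb[OF H.et_closed Z]] kH] X Z N
      by (simp add: H.act_add_left H.g_diff_left H.g_diff_right H.g_add_left H.g_add_right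
          H.dz_et algebra_simps)
    \<comment> \<open>Of the three Cartan tensor terms in the difference of the formulas, these two
      contain \<eta>; only the one with N et, X and Z survives.\<close>
    moreover have "H.dg (N X) et Z = 0" "H.dg (N Z) X et = 0"
      using H.dg_et H.dg_sym H.dg_sym' X Z N by (metis H.et_closed)+
    ultimately show ?thesis
      using X Z N H.g_sym[of "H.dz (N Z) X" et]
      by (simp add: H.dg_def H.dz_et algebra_simps)
  qed
  have half: "x = 0" if "x + x = 0" for x :: 'f
    using that by (metis scaleR_2 scaleR_eq_0_iff zero_neq_numeral)
  \<comment> \<open>At X = \<eta> the remaining Cartan tensor term of \<open>key\<close> vanishes
    too, which gives N et = 0; this in turn removes that term for every X.\<close>
  have "N et = 0"
  proof (rule H.g_nondegenerate)
    fix Z assume Z: "Z \<in> PX"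
    have "H.dg (N et) et Z = 0"
      using H.dg_et H.dg_sym Z N by (metis H.et_closed)
    then show "H.g (N et) Z = H.g 0 Z"
      using key[of et Z] Z half[of "H.g (N et) Z"] by simp
  qed (use N in auto)
  moreover have "H.dg 0 X Z = 0" if "Z \<in> PX" for Z
    using H.dg_sym[of X 0 Z] H.dg_sym[of 0 X Z] H.T_dg[of X Z 0, symmetric] H.dg_sym'[of X 0 Z] X that by simp
  ultimately have "H.g (N X) Z = H.g 0 Z" if "Z \<in> PX" for Z
    using key[OF X that] half[of "H.g (N X) Z"] that by simp
  then have "N X = 0"
    using N[OF X] by (intro H.g_nondegenerate) auto
  then show ?thesis
    using N[OF X] H.ga_diff[of 0 0] by simp
qed

end

context atlas
begin

text \<open>Allows \<open>metric_field\<close>, whose values off the slit bundle are arbitrary, to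
  be exchanged for the normalised metric of the abstract calculus.\<close>

lemma dir_deriv_cong:
  assumes p: "p \<in> manifold_points B" and eq: "\<And>q. q \<in> manifold_points B \<Longrightarrow> f q = h q"
  shows "dir_deriv B p v f = dir_deriv B p v h"
proof -
  define c where "c = (SOME c. c \<in> charts_at B p)"
  have c: "c \<in> B" "p \<in> fst c"
    using someI_ex[of "\<lambda>c. c \<in> charts_at B p"] p unfolding c_def manifold_points_iff charts_at_iff
    by blast+
  have "dd (f \<circ> chart_inv c) (snd c p) (v c) = dd (h \<circ> chart_inv c) (snd c p) (v c)"
  proof (rule dd_cong[OF open_chart_image[OF c(1)]])
    fix z assume "z \<in> snd c ` fst c"
    then have "chart_inv c z \<in> manifold_points B"
      using chart_inv_in[of z c] c(1) unfolding manifold_points_def by blast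
    then show "(f \<circ> chart_inv c) z = (h \<circ> chart_inv c) z" using eq by simp
  qed (use c in simp)
  then show ?thesis by (simp add: dir_deriv_def c_def dd_def Let_def)
qed

end

section \<open>The Finsler metric\<close>

locale finsler = base_atlas A
  for A :: "('p, 'e::euclidean_space) chart set" +
  fixes L :: "('p, 'e) tpoint \<Rightarrow> real"
  assumes finsler: "finsler_manifold A L"
begin

text \<open>The value 0 off the slit bundle, in particular on the zero section, makes E an element
  of \<open>smooth_funs\<close>.\<close>

definition energy :: "('p, 'e) tpoint \<Rightarrow> real"
  where "energy u = (if u \<in> slit_bundle A then (L u)\<^sup>2 / 2 else 0)"

lemma L_homogeneous: "u \<in> slit_bundle A \<Longrightarrow> r > 0 \<Longrightarrow> L (fst u, r *\<^sub>R snd u) = r * L u"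
  using finsler unfolding finsler_manifold_def slit_bundle_def by blast

lemma metric_positive:
  "u \<in> slit_bundle A \<Longrightarrow> v \<in> tangent_space A (fst u) \<Longrightarrow> v \<noteq> 0 \<Longrightarrow> 0 < finsler_metric L u v v"
  using finsler unfolding finsler_manifold_def by blast

lemma L_smooth:
  assumes "c \<in> A"
  shows "smooth_on (dom c) (L \<circ> chart_inv (slit_chart A c))"
proof -
  have "smooth_fun (slit_atlas A) L" using finsler by (simp add: finsler_manifold_def)
  then show ?thesis unfolding smooth_fun_def by (rule bspec[OF _ slit_atlas_in[OF assms]])
qed

lemma energy_rep:
  "c \<in> A \<Longrightarrow> q \<in> dom c \<Longrightarrow> (energy \<circ> chart_inv (slit_chart A c)) q = (L (chart_inv (slit_chart A c) q))\<^sup>2 / 2"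
  by (simp add: energy_def dom_inv)

lemma energy_smooth: "c \<in> A \<Longrightarrow> smooth_on (dom c) (energy \<circ> chart_inv (slit_chart A c))"
proof (rule smooth_on_cong[OF open_dom])
  assume c: "c \<in> A"
  show "smooth_on (dom c) (\<lambda>q. (1/2) *\<^sub>R ((L \<circ> chart_inv (slit_chart A c)) q *\<^sub>R (L \<circ> chart_inv (slit_chart A c)) q))"
    by (intro smooth_on_scaleR smooth_on_const L_smooth c)
  show "(1/2) *\<^sub>R ((L \<circ> chart_inv (slit_chart A c)) q *\<^sub>R (L \<circ> chart_inv (slit_chart A c)) q)
      = (energy \<circ> chart_inv (slit_chart A c)) q" if "q \<in> dom c" for q
    using energy_rep[OF c that] by (simp add: power2_eq_square)
qed

lemma energy_closed: "energy \<in> slit.smooth_funs"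
proof -
  have "smooth_fun (slit_atlas A) energy"
    unfolding smooth_fun_def slit_atlas_def using energy_smooth by blast
  then show ?thesis by (simp add: slit.smooth_funs_def slit_manifold_points energy_def)
qed

text \<open>Relates lines in the fibre, with which g is defined, to lines in the chart. The shifted
  point belongs to the slit bundle because its chart image lies in \<open>dom c\<close>, where the
  second coordinate is nonzero.\<close>

lemma energy_fibre:
  assumes u: "u \<in> slit_bundle A" and c: "c \<in> charts_at A (fst u)" and w: "w \<in> tangent_space A (fst u)"
    and q: "snd (slit_chart A c) u + (0, w c) \<in> dom c"
  shows "(energy \<circ> chart_inv (slit_chart A c)) (snd (slit_chart A c) u + (0, w c))
    = (L (fst u, snd u + w))\<^sup>2 / 2"
proof -
  let ?u = "(fst u, snd u + w)"
  note sc = slit_chart_in[OF u c]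
  have q': "snd (slit_chart A c) ?u = snd (slit_chart A c) u + (0, w c)"
    by (simp add: slit_chart_map)
  have "(snd u + w) c \<noteq> 0"
    using q unfolding slit_chart_image[OF sc(1)] slit_chart_map by auto
  then have "snd u + w \<noteq> 0" by (metis zero_fun_apply)
  then have "?u \<in> slit_bundle A"
    using u w tangent_add by (simp add: slit_bundle_iff)
  then have "chart_inv (slit_chart A c) (snd (slit_chart A c) ?u) = ?u"
    using slit_chart_in(4)[of ?u c] c by simp
  then show ?thesis using energy_rep[OF sc(1) q] by (simp add: q')
qed

lemma DERIV_on_line:
  fixes f :: "'a::euclidean_space \<Rightarrow> real"
  assumes S: "open S" "q \<in> S" and f: "smooth_on S f"
    and eq: "\<And>t. q + t *\<^sub>R v \<in> S \<Longrightarrow> f (q + t *\<^sub>R v) = h t"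
  shows "(h has_real_derivative dd f q v) (at 0)"
proof -
  have U: "open ((\<lambda>t. q + t *\<^sub>R v) -` S)"
    by (intro open_vimage S continuous_intros)
  have "((\<lambda>t. f (q + t *\<^sub>R v)) has_real_derivative dd f q v) (at 0)"
    using has_vector_derivative_line[of f q 0 v] smooth_on_differentiable[OF S(1) f S(2)]
    by (simp add: has_real_derivative_iff_has_vector_derivative)
  then show ?thesis
    by (rule has_field_derivative_transform_within_open[OF _ U]) (use S eq in auto)
qed

text \<open>Two derivatives along lines. The inner one is identified for those s whose base point
  stays in the chart domain; they form a neighbourhood of 0, which is all that the outer derivative
  sees.\<close>

lemma finsler_metric_chart:
  assumes u: "u \<in> slit_bundle A" and c: "c \<in> charts_at A (fst u)"
    and v: "v \<in> tangent_space A (fst u)" and w: "w \<in> tangent_space A (fst u)"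
  shows "finsler_metric L u v w
    = dd (\<lambda>p. dd (energy \<circ> chart_inv (slit_chart A c)) p (0, w c)) (snd (slit_chart A c) u) (0, v c)"
proof -
  let ?f = "energy \<circ> chart_inv (slit_chart A c)" and ?q = "snd (slit_chart A c) u"
  note sc = slit_chart_in[OF u c]
  note S = open_dom[OF sc(1)] and f = energy_smooth[OF sc(1)]
  have "deriv (\<lambda>t. (L (fst u, snd u + s *\<^sub>R v + t *\<^sub>R w))\<^sup>2 / 2) 0 = dd ?f (?q + s *\<^sub>R (0, v c)) (0, w c)"
    if p: "?q + s *\<^sub>R (0, v c) \<in> dom c" for s
  proof (rule DERIV_imp_deriv, rule DERIV_on_line[OF S p f])
    fix t assume "?q + s *\<^sub>R (0, v c) + t *\<^sub>R (0, w c) \<in> dom c"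
    moreover have "?q + s *\<^sub>R (0, v c) + t *\<^sub>R (0, w c) = ?q + (0, (s *\<^sub>R v + t *\<^sub>R w) c)"
      by (simp add: scaleR_fun_def)
    ultimately show "?f (?q + s *\<^sub>R (0, v c) + t *\<^sub>R (0, w c)) = (L (fst u, snd u + s *\<^sub>R v + t *\<^sub>R w))\<^sup>2 / 2"
      using energy_fibre[OF u c tangent_add[OF tangent_scaleR[OF v] tangent_scaleR[OF w]], of s t]
      by (simp add: add.assoc)
  qed
  then have "((\<lambda>s. deriv (\<lambda>t. (L (fst u, snd u + s *\<^sub>R v + t *\<^sub>R w))\<^sup>2 / 2) 0)
      has_real_derivative dd (\<lambda>p. dd ?f p (0, w c)) ?q (0, v c)) (at 0)"
    by (intro DERIV_on_line[OF S sc(3) smooth_on_dd[OF S f]]) simp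
  then show ?thesis by (simp add: finsler_metric_def DERIV_imp_deriv)
qed

text \<open>The product rule for the iterated derivative along \<gamma>X and the lift of \<rho>a
  yields the fibre Hessian plus the derivative of E along the differentiated components; the latter
  is subtracted. The projected bracket stands for \<open>dz\<close>, which becomes available only
  with the interpretation of the abstract calculus below.\<close>

lemma metric_field_energy:
  assumes X: "X \<in> pi_fields A" and a: "a \<in> vector_fields (slit_atlas A)" and u: "u \<in> slit_bundle A"
  shows "metric_field L X (rho_field A a) u
    = slit.deriv_along (gamma_field A X) (slit.deriv_along (gamma_field A (rho_field A a)) energy) u
      - slit.deriv_along (gamma_field A (rho_field A (lie_bracket (slit_atlas A) (gamma_field A X) a))) energy u"
proof -
  obtain c where c: "c \<in> charts_at A (fst u)" using slit_bundle_chart[OF u] by blast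
  let ?C = "slit_chart A c" and ?f = "energy \<circ> chart_inv (slit_chart A c)" and ?q = "snd (slit_chart A c) u"
  define Y where "Y = rho_field A a"
  note sc = slit_chart_in[OF u c] and C = slit_chart_at[OF u c]
  note S = open_dom[OF sc(1)] and f = energy_smooth[OF sc(1)]
  have Y: "Y \<in> pi_fields A" unfolding Y_def by (rule rho_field_closed[OF a])
  note gX = gamma_field_closed[OF X] and gY = gamma_field_closed[OF Y]
  have Z: "rho_field A (lie_bracket (slit_atlas A) (gamma_field A X) a) \<in> pi_fields A"
    by (intro rho_field_closed slit.lie_bracket_closed gX a)
  have V: "smooth_on (dom c) (\<lambda>p. (0::'e, prep Y c p))"
    by (intro smooth_on_Pair smooth_on_const pi_fields_rep Y sc(1))
  have "slit.deriv_along (gamma_field A X) (slit.deriv_along (gamma_field A Y) energy) u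
      = dd (slit.deriv_along (gamma_field A Y) energy \<circ> chart_inv ?C) ?q (0, X u c)"
    by (simp add: slit.deriv_along_chart[OF gX slit.deriv_along_closed[OF gY energy_closed] C]
        gamma_field_component[OF u c])
  also have "\<dots> = dd (\<lambda>p. dd ?f p (0, prep Y c p)) ?q (0, X u c)"
  proof (rule dd_cong[OF S sc(3)])
    fix p assume p: "p \<in> dom c"
    show "(slit.deriv_along (gamma_field A Y) energy \<circ> chart_inv ?C) p = dd ?f p (0, prep Y c p)"
      using slit.deriv_along_rep[OF gY energy_closed slit_atlas_in[OF sc(1)] p]
      by (simp add: gamma_field_component dom_inv[OF sc(1) p])
  qed
  also have "\<dots> = dd (\<lambda>p. dd ?f p (0, Y u c)) ?q (0, X u c) + dd ?f ?q (dd (\<lambda>p. (0, prep Y c p)) ?q (0, X u c))"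
    using dd_dd_field[OF S f V sc(3)] sc(4) by simp
  also have "dd (\<lambda>p. (0::'e, prep Y c p)) ?q (0, X u c) = (0, dd (prep Y c) ?q (0, X u c))"
    by (rule dd_eqI[OF has_derivative_Pair[OF has_derivative_const dd_works[OF pi_fields_rep_differentiable[OF Y u c]]]])
  also have "dd (\<lambda>p. dd ?f p (0, Y u c)) ?q (0, X u c) = metric_field L X Y u"
    by (simp add: metric_field_def finsler_metric_chart[OF u c pi_fields_tangent[OF X] pi_fields_tangent[OF Y]])
  also have "dd (prep Y c) ?q (0, X u c) = rho_field A (lie_bracket (slit_atlas A) (gamma_field A X) a) u c"
    by (simp add: rho_bracket_gamma[OF X a u c] Y_def)
  also have "dd ?f ?q (0, rho_field A (lie_bracket (slit_atlas A) (gamma_field A X) a) u c)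
      = slit.deriv_along (gamma_field A (rho_field A (lie_bracket (slit_atlas A) (gamma_field A X) a))) energy u"
    by (simp add: slit.deriv_along_chart[OF gamma_field_closed[OF Z] energy_closed C] gamma_field_component[OF u c])
  finally show ?thesis by (simp add: Y_def)
qed

lemma energy_euler: "slit.deriv_along (gamma_field A (eta A)) energy = energy + energy"
proof (rule slit.smooth_funs_eqI)
  note gE = gamma_field_closed[OF eta_closed]
  show "slit.deriv_along (gamma_field A (eta A)) energy \<in> slit.smooth_funs"
    by (rule slit.deriv_along_closed[OF gE energy_closed])
  show "energy + energy \<in> slit.smooth_funs" by (intro slit.smooth_funs_add energy_closed)
  fix u C assume "C \<in> charts_at (slit_atlas A) u"
  then obtain c where u: "u \<in> slit_bundle A" and c: "c \<in> charts_at A (fst u)" and C: "C = slit_chart A c"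
    unfolding slit_charts_at by blast
  let ?f = "energy \<circ> chart_inv (slit_chart A c)" and ?q = "snd (slit_chart A c) u"
  note sc = slit_chart_in[OF u c]
  note S = open_dom[OF sc(1)] and f = energy_smooth[OF sc(1)]
  have "((\<lambda>t. (L (fst u, snd u + t *\<^sub>R snd u))\<^sup>2 / 2) has_real_derivative dd ?f ?q (0, snd u c)) (at 0)"
  proof (rule DERIV_on_line[OF S sc(3) f])
    fix t assume "?q + t *\<^sub>R (0, snd u c) \<in> dom c"
    then show "?f (?q + t *\<^sub>R (0, snd u c)) = (L (fst u, snd u + t *\<^sub>R snd u))\<^sup>2 / 2"
      using energy_fibre[OF u c tangent_scaleR[OF slit_bundle_fst_tangent[OF u]], of t]
      by (simp add: scaleR_fun_def)
  qed
  moreover have "((\<lambda>t. (L (fst u, snd u + t *\<^sub>R snd u))\<^sup>2 / 2) has_real_derivative (L u)\<^sup>2) (at 0)"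
  proof (rule has_field_derivative_transform_within_open)
    show "((\<lambda>t. ((1 + t) * L u)\<^sup>2 / 2) has_real_derivative (L u)\<^sup>2) (at 0)"
      by (auto intro!: derivative_eq_intros simp: power2_eq_square)
    \<comment> \<open>Homogeneity holds for positive factors only, hence the restriction to t >
      -1.\<close>
    show "((1 + t) * L u)\<^sup>2 / 2 = (L (fst u, snd u + t *\<^sub>R snd u))\<^sup>2 / 2" if "t \<in> {-1<..}" for t
      using L_homogeneous[OF u, of "1 + t"] that by (simp add: scaleR_add_left)
  qed auto
  ultimately have "dd ?f ?q (0, snd u c) = (L u)\<^sup>2" by (rule DERIV_unique)
  then show "slit.deriv_along (gamma_field A (eta A)) energy u = (energy + energy) u"
    using u slit.deriv_along_chart[OF gE energy_closed slit_chart_at[OF u c]]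
      gamma_field_component[OF u c, of "eta A"]
    by (simp add: eta_def[of A, THEN fun_cong, of u] energy_def)
qed

text \<open>Chain rule for E = \<open>L\<^sup>2/2\<close>: the Hashiguchi condition speaks of L, the
  abstract calculus of E.\<close>

lemma deriv_along_energy_eq_0:
  assumes a: "a \<in> vector_fields (slit_atlas A)" and u: "u \<in> slit_bundle A"
    and "dir_deriv (slit_atlas A) u (a u) L = 0"
  shows "slit.deriv_along a energy u = 0"
proof -
  obtain c where c: "c \<in> charts_at A (fst u)" using slit_bundle_chart[OF u] by blast
  let ?C = "slit_chart A c" and ?q = "snd (slit_chart A c) u"
  let ?l = "L \<circ> chart_inv (slit_chart A c)"
  note sc = slit_chart_in[OF u c] and C = slit_chart_at[OF u c]
  have l: "?l differentiable (at ?q)"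
    by (rule smooth_on_differentiable[OF open_dom[OF sc(1)] L_smooth[OF sc(1)] sc(3)])
  have 0: "dd ?l ?q (a u ?C) = 0"
    using slit.dir_deriv_chart[OF C slit.vector_fields_tangent[OF a] l] assms(3) by simp
  have "slit.deriv_along a energy u = dd (energy \<circ> chart_inv ?C) ?q (a u ?C)"
    by (rule slit.deriv_along_chart[OF a energy_closed C])
  also have "\<dots> = dd (\<lambda>q. (1/2) *\<^sub>R (?l q * ?l q)) ?q (a u ?C)"
    by (rule dd_cong[OF open_dom[OF sc(1)] sc(3)]) (use energy_rep[OF sc(1)] in \<open>simp add: power2_eq_square\<close>)
  also have "\<dots> = (1/2) *\<^sub>R (?l ?q * dd ?l ?q (a u ?C) + dd ?l ?q (a u ?C) * ?l ?q)"
    by (rule dd_eqI[OF has_derivative_scaleR_right[OF has_derivative_mult[OF dd_works[OF l] dd_works[OF l]]]])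
  finally show ?thesis by (simp add: 0)
qed

end

section \<open>Global fields as a model of the abstract calculus\<close>

locale finsler_regular_connection = finsler A L + regular_pullback_connection A D
  for A :: "('p, 'e::euclidean_space) chart set" and L D
begin

text \<open>The connection D contributes the lifts in \<open>rho_field_surj\<close> but occurs in no
  parameter. The interpretations belonging to two connections therefore have the same
  \<open>dz\<close> and the same metric.\<close>

sublocale V: vertical_calculus "pi_fields A" "vector_fields (slit_atlas A)" slit.smooth_funs
  "lie_bracket (slit_atlas A)" slit.deriv_along "gamma_field A" "rho_field A" "eta A" energy
  by unfold_locales
    (rule pi_fields_zero pi_fields_add pi_fields_minus slit.vector_fields_zero slit.vector_fields_add
      slit.vector_fields_minus slit.smooth_funs_zero slit.smooth_funs_add slit.smooth_funs_minus
      slit.lie_bracket_closed slit.lie_bracket_add_left slit.lie_bracket_antisym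
      slit.lie_bracket_jacobi slit.deriv_along_closed slit.deriv_along_add_left
      slit.deriv_along_add_right slit.deriv_along_lie_bracket gamma_field_closed gamma_field_add
      rho_field_closed rho_field_add rho_gamma_field ker_rho_field rho_field_surj
      rho_bracket_gamma_gamma eta_closed rho_bracket_gamma_eta energy_closed energy_euler; assumption)+

lemma metric_field_eq:
  assumes X: "X \<in> pi_fields A" and Y: "Y \<in> pi_fields A" and u: "u \<in> slit_bundle A"
  shows "metric_field L X Y u = V.g X Y u"
  using metric_field_energy[OF X beta_field_closed[OF Y] u]
    V.rh_br_ga[OF X beta_field_closed[OF Y]]
  by (simp add: rho_beta_field[OF Y] V.g_def)

sublocale V: finsler_calculus "pi_fields A" "vector_fields (slit_atlas A)" slit.smooth_funs
  "lie_bracket (slit_atlas A)" slit.deriv_along "gamma_field A" "rho_field A" "eta A" energy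
proof
  fix X assume X: "X \<in> pi_fields A" and "V.g X X = 0"
  then have "finsler_metric L u (X u) (X u) = 0" if "u \<in> slit_bundle A" for u
    using metric_field_eq[OF X X that] by (simp add: metric_field_def)
  then have "X u = 0" if "u \<in> slit_bundle A" for u
    using metric_positive[OF that pi_fields_tangent[OF X]] that by (metis less_irrefl)
  then have "X u = 0" for u using pi_fields_outside[OF X, of u] by blast
  then show "X = 0" by (intro ext) simp
qed

lemma dir_deriv_metric:
  assumes X: "X \<in> pi_fields A" and Y: "Y \<in> pi_fields A" and u: "u \<in> slit_bundle A"
  shows "dir_deriv (slit_atlas A) u v (metric_field L X Y) = dir_deriv (slit_atlas A) u v (V.g X Y)"
  by (rule slit.dir_deriv_cong) (simp_all add: slit_manifold_points u metric_field_eq[OF X Y])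

lemma cov_metric_eq_0:
  assumes a: "a \<in> vector_fields (slit_atlas A)" and X: "X \<in> pi_fields A" and Y: "Y \<in> pi_fields A"
    and 0: "\<And>u. u \<in> slit_bundle A \<Longrightarrow> cov_metric A L D a X Y u = 0"
  shows "slit.deriv_along a (V.g X Y) = V.g (cov A D a X) Y + V.g X (cov A D a Y)"
proof (rule slit.smooth_funs_eqI)
  note aX = cov_closed[OF a X] and aY = cov_closed[OF a Y]
  show "slit.deriv_along a (V.g X Y) \<in> slit.smooth_funs"
    by (intro slit.deriv_along_closed a V.g_closed X Y)
  show "V.g (cov A D a X) Y + V.g X (cov A D a Y) \<in> slit.smooth_funs"
    by (intro slit.smooth_funs_add V.g_closed aX aY X Y)
  fix u C assume "C \<in> charts_at (slit_atlas A) u"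
  then have u: "u \<in> slit_bundle A" unfolding slit_charts_at by blast
  then show "slit.deriv_along a (V.g X Y) u = (V.g (cov A D a X) Y + V.g X (cov A D a Y)) u"
    using 0[OF u] dir_deriv_metric[OF X Y u, of "a u"] metric_field_eq[OF aX Y u] metric_field_eq[OF X aY u]
    by (simp add: cov_metric_def slit.deriv_along_def slit_manifold_points)
qed

text \<open>\<rho>\<gamma>X = 0 removes one term, and the projected bracket is \<open>dz\<close> for
  any lift of Y; so the (h)hv-torsion does not depend on the horizontal lift.\<close>

lemma hv_torsion_eq:
  assumes X: "X \<in> pi_fields A" and Y: "Y \<in> pi_fields A"
  shows "hv_torsion A D X Y = cov A D (gamma_field A X) Y - V.dz X Y"
proof -
  have "cov A D (beta_field A D Y) 0 = 0"
    using cov_add_right[OF beta_field_closed[OF Y] pi_fields_zero pi_fields_zero] by simp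
  then show ?thesis
    using V.rh_br_ga[OF X beta_field_closed[OF Y]]
    by (simp add: hv_torsion_def torsion_def rho_beta_field[OF Y] rho_gamma_field[OF X])
qed

text \<open>Metricity is demanded along vertical lifts only, so that the Cartan and the Hashiguchi
  connection both qualify.\<close>

lemma finsler_connectionI:
  assumes m: "\<And>V X Y u. V \<in> pi_fields A \<Longrightarrow> X \<in> pi_fields A \<Longrightarrow> Y \<in> pi_fields A \<Longrightarrow> u \<in> slit_bundle A \<Longrightarrow>
      cov_metric A L D (gamma_field A V) X Y u = 0"
    and s: "hv_torsion_symmetric A L D"
    and t: "\<And>X Y. X \<in> pi_fields A \<Longrightarrow> Y \<in> pi_fields A \<Longrightarrow> h_torsion A D X Y = 0"
  shows "finsler_connection (pi_fields A) (vector_fields (slit_atlas A)) slit.smooth_funs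
    (lie_bracket (slit_atlas A)) slit.deriv_along (gamma_field A) (rho_field A) (eta A) energy
    (cov A D) (beta_field A D)"
proof
  fix X Y Z assume X: "X \<in> pi_fields A" and Y: "Y \<in> pi_fields A"
  show "cov A D (beta_field A D X) Y - cov A D (beta_field A D Y) X
      = rho_field A (lie_bracket (slit_atlas A) (beta_field A D X) (beta_field A D Y))"
    using t[OF X Y] by (simp add: h_torsion_def torsion_def rho_beta_field X Y)
  show "slit.deriv_along (gamma_field A Z) (V.g X Y)
      = V.g (cov A D (gamma_field A Z) X) Y + V.g X (cov A D (gamma_field A Z) Y)" if Z: "Z \<in> pi_fields A"
    by (rule cov_metric_eq_0[OF gamma_field_closed[OF Z] X Y m[OF Z X Y]])
  assume Z: "Z \<in> pi_fields A"
  have T: "cov A D (gamma_field A X) Y - V.dz X Y \<in> pi_fields A" if "Y \<in> pi_fields A" for Y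
    by (intro V.PX_diff cov_closed gamma_field_closed V.dz_closed X that)
  show "V.g (cov A D (gamma_field A X) Y - V.dz X Y) Z = V.g (cov A D (gamma_field A X) Z - V.dz X Z) Y"
  proof (rule slit.smooth_funs_eqI[OF V.g_closed[OF T[OF Y] Z] V.g_closed[OF T[OF Z] Y]])
    fix u C assume "C \<in> charts_at (slit_atlas A) u"
    then have u: "u \<in> slit_bundle A" unfolding slit_charts_at by blast
    have "metric_field L (hv_torsion A D X Y) Z u = metric_field L (hv_torsion A D X Z) Y u"
      using s X Y Z u unfolding hv_torsion_symmetric_def by blast
    then show "V.g (cov A D (gamma_field A X) Y - V.dz X Y) Z u
        = V.g (cov A D (gamma_field A X) Z - V.dz X Z) Y u"
      by (simp add: hv_torsion_eq[OF X Y] hv_torsion_eq[OF X Z] metric_field_eq[OF T[OF Y] Z u]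
          metric_field_eq[OF T[OF Z] Y u])
  qed
qed (simp_all add: cov_closed cov_add_left cov_add_right beta_field_closed beta_field_add rho_beta_field cov_beta_eta)

end

section \<open>The six identities for the curvatures of the Hashiguchi connection\<close>

theorem proposition6p5:
  fixes A :: "('p, 'e::euclidean_space) chart set"
    and L :: "('p, 'e) tpoint \<Rightarrow> real"
    and C H :: "('p, 'e) pconn"
    and X Y Z W :: "('p, 'e) pfield"
  assumes "finsler_manifold A L"
    and "cartan_connection A L C"
    and "hashiguchi_connection A L H"
    and "X \<in> pi_fields A" "Y \<in> pi_fields A" "Z \<in> pi_fields A" "W \<in> pi_fields A"
  shows "let g = metric_field L;
             T = hv_torsion A C;
             S = v_curvature A C;
             S' = v_curvature A H;
             P' = hv_curvature A H;
             \<gamma> = gamma_field A;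
             \<beta> = beta_field A C
         in
           (\<forall>u\<in>slit_bundle A. g (S' X Y Z) W u = - g (S' Y X Z) W u) \<and>
           (\<forall>u\<in>slit_bundle A. g (S' X Y Z) W u = - g (S' X Y W) Z u) \<and>
           (\<forall>u\<in>slit_bundle A. g (S' X Y Z) W u = g (S X Y Z) W u \<and>
              g (S X Y Z) W u = g (T X W) (T Y Z) u - g (T Y W) (T X Z) u) \<and>
           cov_tensor A H (\<gamma> X) S Y Z W + cov_tensor A H (\<gamma> Y) S Z X W
             + cov_tensor A H (\<gamma> Z) S X Y W = 0 \<and>
           cov_tensor A H (\<gamma> (eta A)) S X Y Z = - (2 *\<^sub>R S X Y Z) \<and>
           cov_tensor A H (\<beta> Z) S X Y W =
             cov_tensor A H (\<gamma> X) P' Z Y W - cov_tensor A H (\<gamma> Y) P' Z X W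
               - P' (T Y Z) X W + P' (T X Z) Y W"
proof -
  have "smooth_atlas A" using assms(1) by (simp add: finsler_manifold_def smooth_manifold_def)
  then interpret base_atlas A by unfold_locales
  have reg: "regular_connection A C" "regular_connection A H"
    using assms(2,3) by (simp_all add: cartan_connection_def hashiguchi_connection_def)
  interpret FC: finsler_regular_connection A L C
    by unfold_locales (fact assms(1) reg)+
  interpret FH: finsler_regular_connection A L H
    by unfold_locales (fact assms(1) reg)+
  let ?PX = "pi_fields A" and ?VX = "vector_fields (slit_atlas A)"
  let ?br = "lie_bracket (slit_atlas A)"
  have C: "finsler_connection ?PX ?VX slit.smooth_funs ?br slit.deriv_along (gamma_field A)
      (rho_field A) (eta A) FC.energy (cov A C) (beta_field A C)"
    by (rule FC.finsler_connectionI)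
      (use assms(2) in \<open>simp_all add: cartan_connection_def gamma_field_closed\<close>)
  have H: "finsler_connection ?PX ?VX slit.smooth_funs ?br slit.deriv_along (gamma_field A)
      (rho_field A) (eta A) FC.energy (cov A H) (beta_field A H)"
    by (rule FH.finsler_connectionI)
      (use assms(3) in \<open>simp_all add: hashiguchi_connection_def\<close>)
  interpret C0: finsler_connection ?PX ?VX slit.smooth_funs ?br slit.deriv_along "gamma_field A"
    "rho_field A" "eta A" FC.energy "cov A C" "beta_field A C"
    by (fact C)
  interpret H0: finsler_connection ?PX ?VX slit.smooth_funs ?br slit.deriv_along "gamma_field A"
    "rho_field A" "eta A" FC.energy "cov A H" "beta_field A H"
    by (fact H)
  interpret CH: cartan_hashiguchi ?PX ?VX slit.smooth_funs ?br slit.deriv_along "gamma_field A"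
    "rho_field A" "eta A" FC.energy "cov A H" "beta_field A H" "cov A C" "beta_field A C"
  proof
    fix X Y assume X: "X \<in> ?PX" and Y: "Y \<in> ?PX"
    show "H0.P X Y (eta A) = 0"
      using assms(3) X Y
      by (simp add: hashiguchi_connection_def H0.P_def H0.kc_def hv_curvature_def curvature_def)
    show "slit.deriv_along (beta_field A H X) FC.energy = 0"
    proof (rule slit.smooth_funs_eqI)
      fix u D assume "D \<in> charts_at (slit_atlas A) u"
      then have u: "u \<in> slit_bundle A" unfolding slit_charts_at by blast
      \<comment> \<open>The hypothesis concerns horizontal parts of arbitrary vector fields;
        \<beta>X is its own horizontal part.\<close>
      have "dir_deriv (slit_atlas A) u (beta A H u (rho A u (beta_field A H X u))) L = 0"
        using assms(3) u FH.beta_field_closed[OF X] unfolding hashiguchi_connection_def by blast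
      moreover have "beta A H u (rho A u (beta_field A H X u)) = beta_field A H X u"
        using FH.beta(3)[OF u pi_fields_tangent[OF X]] u by (simp add: beta_field_def)
      ultimately show "slit.deriv_along (beta_field A H X) FC.energy u = 0 u"
        using FC.deriv_along_energy_eq_0[OF FH.beta_field_closed[OF X] u] by simp
    qed (intro slit.deriv_along_closed slit.smooth_funs_zero FH.beta_field_closed FC.energy_closed X)+
    show "slit.deriv_along a (FC.V.g X Y) = FC.V.g (cov A C a X) Y + FC.V.g X (cov A C a Y)"
      if a: "a \<in> ?VX" for a
      by (rule FC.cov_metric_eq_0[OF a X Y]) (use assms(2) a X Y in \<open>simp add: cartan_connection_def\<close>)
  qed
  note XYZW = assms(4-7)
  have SC: "v_curvature A C X Y Z = C0.S X Y Z" for X Y Z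
    by (simp add: v_curvature_def curvature_def C0.S_def C0.kc_def)
  have SH: "v_curvature A H X Y Z = H0.S X Y Z" for X Y Z
    by (simp add: v_curvature_def curvature_def H0.S_def H0.kc_def)
  have PH: "hv_curvature A H X Y Z = H0.P X Y Z" for X Y Z
    by (simp add: hv_curvature_def curvature_def H0.P_def H0.kc_def)
  have T: "hv_torsion A C X Y = C0.T X Y" "C0.T X Y = H0.T X Y" if "X \<in> ?PX" "Y \<in> ?PX" for X Y
    using FC.hv_torsion_eq[OF that] CH.T_eq[OF that] by (simp_all add: C0.T_def)
  have S: "v_curvature A C X Y Z = H0.S X Y Z" if "X \<in> ?PX" "Y \<in> ?PX" "Z \<in> ?PX" for X Y Z
    using CH.S_eq[OF that] by (simp add: SC)
  \<comment> \<open>The tensor is that of the Cartan connection, the derivative that of the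
    Hashiguchi connection. S is also evaluated at differentiated fields; these are \<pi>-vector
    fields again, so \<open>S\<close> applies to them.\<close>
  have DS: "cov_tensor A H a (v_curvature A C) X Y Z = H0.DS a X Y Z"
    if "a \<in> ?VX" "X \<in> ?PX" "Y \<in> ?PX" "Z \<in> ?PX" for a X Y Z
    using that by (simp add: cov_tensor_def H0.DS_def S)
  have DP: "cov_tensor A H a (hv_curvature A H) X Y Z = H0.DP a X Y Z" for a X Y Z
    by (simp add: cov_tensor_def H0.DP_def PH)
  have g: "metric_field L X Y u = FC.V.g X Y u" if "X \<in> ?PX" "Y \<in> ?PX" "u \<in> slit_bundle A" for X Y u
    by (rule FC.metric_field_eq[OF that])
  have a: "FC.V.g (H0.S X Y Z) W = - FC.V.g (H0.S Y X Z) W"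
    using XYZW H0.S_antisym[of X Y Z] FC.V.g_minus_left by simp
  have b: "FC.V.g (H0.S X Y Z) W = - FC.V.g (H0.S X Y W) Z"
    by (rule H0.S_skew[OF XYZW])
  have c: "FC.V.g (H0.S X Y Z) W
      = FC.V.g (H0.T X W) (H0.T Y Z) - FC.V.g (H0.T Y W) (H0.T X Z)"
    by (rule H0.S_T[OF XYZW])
  have d: "H0.DS (gamma_field A X) Y Z W + H0.DS (gamma_field A Y) Z X W
      + H0.DS (gamma_field A Z) X Y W = 0"
    by (rule H0.v_bianchi[OF XYZW])
  have e: "H0.DS (gamma_field A (eta A)) X Y Z = - (2 *\<^sub>R H0.S X Y Z)"
    using H0.DS_ga_et[OF XYZW(1-3)] by (simp add: scaleR_2)
  \<comment> \<open>The derivative is along the Cartan lift of Z, whereas \<open>h_bianchi\<close>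
    provides it along the Hashiguchi lift; \<open>bc_eq_bh\<close> identifies the two.\<close>
  have f: "H0.DS (beta_field A C Z) X Y W = H0.DP (gamma_field A X) Z Y W
      - H0.DP (gamma_field A Y) Z X W - H0.P (H0.T Y Z) X W + H0.P (H0.T X Z) Y W"
    using CH.H.h_bianchi[OF XYZW] CH.bc_eq_bh[OF XYZW(3)] by simp
  show ?thesis
    unfolding Let_def
    using fun_cong[OF a] fun_cong[OF b] fun_cong[OF c] d e f XYZW
    by (simp add: SH PH S T DS DP g H0.S_closed H0.T_closed gamma_field_closed eta_closed
        FC.beta_field_closed)
qed

end
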